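(* Let $(\Omega,\Sigma,P)$ be a probability space, $\Theta:\Omega\to\mathbb{R}^d$ a random vector, $D\in\mathfrak{B}(\mathbb{R}^d)$ with $\Theta(\Omega)\subseteq D$, and $\{P_\theta\}_{\theta\in D}$ a disintegration of $P$ over $P_\Theta$ consistent with $\Theta$. Let $h:D\to\mathbb{R}^k$ ($k\in\mathbb{N}$) be a Borel measurable function for which there is a $P_\Theta$-null set $L_0\in\mathfrak{B}(D)$ such that $h\upharpoonright D\setminus L_0$ is injective. Let $N=\{N_t\}_{t\in\mathbb{R}_+}$ be a counting process on $(\Omega,\Sigma,P)$ with interarrival process $\{W_n\}_{n\in\mathbb{N}}$, and suppose that $N$ is a $P$-eMRP$(\mathbf{K}(h(\Theta)))$, with $(P_\theta)_{W_n}=\mathbf{K}(h(\theta))$ for all $n\in\mathbb{N}$ and $\theta\in D$. Put $F_{h(\theta)}(t):=P_\theta(\{W_n\le t\})$ for $\theta\in D$, $t\ge 0$ (this does not depend on $n$). Assume that there exist a $P_\Theta$-null set $L_h\in\mathfrak{B}(D)$ and a function $C\in\mathcal{L}^1(P_{h(\Theta)})$ such that for every $\theta\in D\setminus L_h$ the function $F_{h(\theta)}$ is continuously differentiable on $(0,\infty)$ with $0<F'_{h(\theta)}(t)<C(h(\theta))$ for each $t>0$, and such that the function $p_h:D\setminus L_h\to\mathbb{R}$, $p_h(\theta):=\lim_{t\to 0}F'_{h(\theta)}(t)$, is (well defined,) positive and injective. Put $O_h:=L_0\cup L_h$, let $\widehat\Theta(\omega):=p_h(\Theta(\omega))$ for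 $\omega\in\Theta^{-1}(D\setminus O_h)$, and denote again by $\widehat\Theta$ any measurable extension of this function from $\Theta^{-1}(D\setminus O_h)$ to a real-valued random variable on $\Omega$. Then the following are equivalent: (i) $N$ has the multinomial property; (ii) $N$ has the Markov property; (iii) $N$ is a $P$-MPP$(\widehat\Theta)$.
   Context: Notation: $\mathfrak{B}(E)$ is the Borel $\sigma$-algebra of $E$; $P_X$ is the law of $X$ under $P$, and $(P_\theta)_X$ the law of $X$ under $P_\theta$; $\mathcal{L}^1(Q)$ is the set of real-valued $Q$-integrable functions; $\sigma(\Theta)$ is the $\sigma$-algebra generated by $\Theta$; $f\upharpoonright A$ is the restriction of $f$ to $A$; $h(\Theta):=h\circ\Theta$. Disintegration: a family $\{P_\theta\}_{\theta\in D}$ of probability measures on $\Sigma$ is a disintegration of $P$ over $P_\Theta$ if $\theta\mapsto P_\theta(A)$ is $\mathfrak{B}(D)$-measurable and $\int_D P_\theta(A)\,P_\Theta(d\theta)=P(A)$ for every $A\in\Sigma$. It is consistent with $\Theta$ if for each $B\in\mathfrak{B}(D)$ one has $P_\theta(\Theta^{-1}(B))=1$ for $P_\Theta$-almost every $\theta\in B$. Counting process: a family $N=\{N_t\}_{t\ge0}$ of random variables with values in $\mathbb{N}_0\cup\{\infty\}$ whose paths are right-continuous, have jumps of size at most one, vanish at $t=0$ and increase to infinity (these path properties are assumed to hold for every $\omega\in\Omega$). Arrival process: $T_0:=0$, $T_n:=\inf\{t\ge0:N_t=n\}$. Interarrival process: $W_n:=T_n-T_{n-1}$, $n\in\mathbb{N}$.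 Conditional distribution of a real random variable $X$ over $\Theta$: a map $P_{X|\Theta}:\mathfrak{B}(\mathbb{R})\times\Omega\to[0,1]$ such that $P_{X|\Theta}(\cdot,\omega)$ is a probability measure for each $\omega$, and for each $B$, $P_{X|\Theta}(B,\cdot)$ is $\sigma(\Theta)$-measurable and a version of $P(X^{-1}(B)\mid\sigma(\Theta))$. $\mathbf{K}$ denotes a family of probability measures $\mathbf{K}(y)$, $y\in\mathbb{R}^k$, on $\mathfrak{B}(\mathbb{R})$ with $y\mapsto\mathbf{K}(y)(B)$ Borel measurable for each $B$; $\mathbf{K}(h(\Theta))$ is the map $(B,\omega)\mapsto\mathbf{K}(h(\Theta(\omega)))(B)$. $N$ is an extended mixed renewal process, written $P$-eMRP$(\mathbf{K}(h(\Theta)))$, if $W=\{W_n\}_{n\in\mathbb{N}}$ is $P$-conditionally independent given $\sigma(\Theta)$ and for every $n$, $P_{W_n|\Theta}=\mathbf{K}(h(\Theta))$ $P\upharpoonright\sigma(\Theta)$-a.s. (equality of measures on $\mathfrak{B}(\mathbb{R})$ for all $\omega$ off a $P$-null set in $\sigma(\Theta)$). Mixed Poisson process: for a real random variable $\Psi$ with $P(\Psi\in(0,\infty))=1$, $N$ is a $P$-MPP$(\Psi)$ if $N$ has $P$-conditionally independent increments given $\Psi$ and, for all $t\ge0$, $s>0$, the conditional distribution of $N_{t+s}-N_t$ over $\Psi$ is a.s. the Poisson distribution with parameter $s\Psi$. Markov property (w.r.t. $P$): $P(N_{t_{m+1}}=n_{m+1}\mid\bigcap_{j=1}^m\{N_{t_j}=n_j\})=P(N_{t_{m+1}}=n_{m+1}\mid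 N_{t_m}=n_m)$ for all $m\in\mathbb{N}$, $0<t_1<\dots<t_{m+1}$ and $n_1,\dots,n_{m+1}\in\mathbb{N}_0$ with $P(\bigcap_{j=1}^m\{N_{t_j}=n_j\})>0$. Multinomial property (w.r.t. $P$): for all $m\in\mathbb{N}$, $0=t_0<t_1<\dots<t_m$ and $k_1,\dots,k_m\in\mathbb{N}_0$ with $n:=\sum_{j=1}^m k_j$, $P(\bigcap_{j=1}^m\{N_{t_j}-N_{t_{j-1}}=k_j\})=\frac{n!}{\prod_{j=1}^m k_j!}\prod_{j=1}^m\bigl(\frac{t_j-t_{j-1}}{t_m}\bigr)^{k_j}P(N_{t_m}=n)$. *)

theory Defs
  imports "HOL-Probability.Probability"
begin

definition gen_sigma :: "'w measure \<Rightarrow> ('w \<Rightarrow> 'a::topological_space) \<Rightarrow> 'w measure" where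
  "gen_sigma M Y = vimage_algebra (space M) Y borel"

definition law_on :: "'w measure \<Rightarrow> 'a::topological_space set \<Rightarrow> ('w \<Rightarrow> 'a) \<Rightarrow> 'a measure" where
  "law_on M D Y = distr M (restrict_space borel D) Y"

definition disintegration ::
  "'w measure \<Rightarrow> 'a::topological_space set \<Rightarrow> ('w \<Rightarrow> 'a) \<Rightarrow> ('a \<Rightarrow> 'w measure) \<Rightarrow> bool" where
  "disintegration M D \<Theta> Q \<longleftrightarrow>
     (\<forall>\<theta>\<in>D. prob_space (Q \<theta>) \<and> sets (Q \<theta>) = sets M) \<and>
     (\<forall>A\<in>sets M. (\<lambda>\<theta>. measure (Q \<theta>) A) \<in> borel_measurable (restrict_space borel D) \<and>
        (\<integral>\<theta>. measure (Q \<theta>) A \<partial>law_on M D \<Theta>) = measure M A)"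

definition consistent_with ::
  "'w measure \<Rightarrow> 'a::topological_space set \<Rightarrow> ('w \<Rightarrow> 'a) \<Rightarrow> ('a \<Rightarrow> 'w measure) \<Rightarrow> bool" where
  "consistent_with M D \<Theta> Q \<longleftrightarrow>
     (\<forall>B\<in>sets (restrict_space borel D).
        AE \<theta> in law_on M D \<Theta>. \<theta> \<in> B \<longrightarrow> measure (Q \<theta>) (\<Theta> -` B \<inter> space M) = 1)"

text \<open>The values lie in \<open>\<nat>\<^sub>0 \<union> {\<infinity>}\<close>, so a path may explode in finite time; right-continuity and
  the limit at infinity refer to the order topology of \<^typ>\<open>enat\<close>. As the paths are monotone,
  the supremum over \<open>[0, t)\<close> is the left limit at \<open>t\<close>. Only the times \<open>t \<ge> 0\<close> matter.\<close>

definition counting_process :: "'w measure \<Rightarrow> (real \<Rightarrow> 'w \<Rightarrow> enat) \<Rightarrow> bool" where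
  "counting_process M N \<longleftrightarrow>
     (\<forall>t\<ge>0. N t \<in> measurable M (count_space UNIV)) \<and>
     (\<forall>\<omega>\<in>space M.
        N 0 \<omega> = 0 \<and>
        mono_on {0..} (\<lambda>t. N t \<omega>) \<and>
        ((\<lambda>t. N t \<omega>) \<longlongrightarrow> \<infinity>) at_top \<and>
        (\<forall>t\<ge>0. continuous (at_right t) (\<lambda>t. N t \<omega>)) \<and>
        (\<forall>t>0. N t \<omega> \<le> (SUP s\<in>{0..<t}. N s \<omega>) + 1))"

definition arrival :: "(real \<Rightarrow> 'w \<Rightarrow> enat) \<Rightarrow> nat \<Rightarrow> 'w \<Rightarrow> real" where
  "arrival N n \<omega> = (if n = 0 then 0 else Inf {t. 0 \<le> t \<and> N t \<omega> = enat n})"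

text \<open>The index of the interarrival times starts at 1.\<close>

definition interarrival :: "(real \<Rightarrow> 'w \<Rightarrow> enat) \<Rightarrow> nat \<Rightarrow> 'w \<Rightarrow> real" where
  "interarrival N n \<omega> = arrival N n \<omega> - arrival N (n - 1) \<omega>"

text \<open>Subtraction on \<^typ>\<open>enat\<close> has \<open>\<infinity> - \<infinity> = \<infinity>\<close>: an increment of an exploded path never has a
  finite value.\<close>

definition increment :: "(real \<Rightarrow> 'w \<Rightarrow> enat) \<Rightarrow> real \<Rightarrow> real \<Rightarrow> 'w \<Rightarrow> enat" where
  "increment N s t \<omega> = N t \<omega> - N s \<omega>"

definition cond_probability :: "'w measure \<Rightarrow> 'w measure \<Rightarrow> 'w set \<Rightarrow> 'w \<Rightarrow> real" where
  "cond_probability M F A = real_cond_exp M F (indicator A)"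

definition cond_distribution ::
  "'w measure \<Rightarrow> 'w measure \<Rightarrow> 'b measure \<Rightarrow> ('w \<Rightarrow> 'b) \<Rightarrow> ('w \<Rightarrow> 'b measure) \<Rightarrow> bool" where
  "cond_distribution M F S X \<kappa> \<longleftrightarrow>
     X \<in> measurable M S \<and>
     (\<forall>\<omega>\<in>space M. prob_space (\<kappa> \<omega>) \<and> sets (\<kappa> \<omega>) = sets S) \<and>
     (\<forall>B\<in>sets S. (\<lambda>\<omega>. measure (\<kappa> \<omega>) B) \<in> borel_measurable F \<and>
        (AE \<omega> in M. measure (\<kappa> \<omega>) B = cond_probability M F (X -` B \<inter> space M) \<omega>))"

text \<open>Conditional distributions are unique only up to null sets, so the equation
  \<open>P\<^bsub>X|F\<^esub> = \<mu>\<close> a.s. says that some version agrees with \<open>\<mu>\<close> off a null set of \<open>F\<close>.\<close>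

definition has_cond_distribution ::
  "'w measure \<Rightarrow> 'w measure \<Rightarrow> 'b measure \<Rightarrow> ('w \<Rightarrow> 'b) \<Rightarrow> ('w \<Rightarrow> 'b measure) \<Rightarrow> bool" where
  "has_cond_distribution M F S X \<mu> \<longleftrightarrow>
     (\<exists>\<kappa>. cond_distribution M F S X \<kappa> \<and> (AE \<omega> in restr_to_subalg M F. \<kappa> \<omega> = \<mu> \<omega>))"

definition cond_indep_vars ::
  "'w measure \<Rightarrow> 'w measure \<Rightarrow> 'b measure \<Rightarrow> ('i \<Rightarrow> 'w \<Rightarrow> 'b) \<Rightarrow> 'i set \<Rightarrow> bool" where
  "cond_indep_vars M F S X I \<longleftrightarrow>
     (\<forall>i\<in>I. X i \<in> measurable M S) \<and>
     (\<forall>J\<subseteq>I. J \<noteq> {} \<longrightarrow> finite J \<longrightarrow> (\<forall>B. (\<forall>j\<in>J. B j \<in> sets S) \<longrightarrow>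
        (AE \<omega> in M. cond_probability M F (\<Inter>j\<in>J. X j -` B j \<inter> space M) \<omega>
                    = (\<Prod>j\<in>J. cond_probability M F (X j -` B j \<inter> space M) \<omega>))))"

definition prob_family :: "('b::topological_space \<Rightarrow> real measure) \<Rightarrow> bool" where
  "prob_family K \<longleftrightarrow>
     (\<forall>y. prob_space (K y) \<and> sets (K y) = sets borel) \<and>
     (\<forall>B\<in>sets borel. (\<lambda>y. measure (K y) B) \<in> borel_measurable borel)"

definition eMRP ::
  "'w measure \<Rightarrow> ('b \<Rightarrow> real measure) \<Rightarrow> ('a \<Rightarrow> 'b) \<Rightarrow> ('w \<Rightarrow> 'a::topological_space) \<Rightarrow>
    (real \<Rightarrow> 'w \<Rightarrow> enat) \<Rightarrow> bool" where
  "eMRP M K h \<Theta> N \<longleftrightarrow>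
     cond_indep_vars M (gen_sigma M \<Theta>) borel (interarrival N) {1..} \<and>
     (\<forall>n\<ge>1. has_cond_distribution M (gen_sigma M \<Theta>) borel (interarrival N n)
        (\<lambda>\<omega>. K (h (\<Theta> \<omega>))))"

definition cond_indep_increments ::
  "'w measure \<Rightarrow> 'w measure \<Rightarrow> (real \<Rightarrow> 'w \<Rightarrow> enat) \<Rightarrow> bool" where
  "cond_indep_increments M F N \<longleftrightarrow>
     (\<forall>m\<ge>1. \<forall>t::nat \<Rightarrow> real. t 0 = 0 \<longrightarrow> (\<forall>j<m. t j < t (Suc j)) \<longrightarrow>
        cond_indep_vars M F (count_space UNIV) (\<lambda>j. increment N (t (j - 1)) (t j)) {1..m})"

text \<open>The library specifies \<open>poisson_pmf\<close> only for positive rates; \<open>\<Psi> > 0\<close> holds almost surely, and the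
  Poisson law is prescribed only almost surely. It is pushed forward to \<^typ>\<open>enat\<close>, where
  increments take their values.\<close>

definition MPP :: "'w measure \<Rightarrow> (real \<Rightarrow> 'w \<Rightarrow> enat) \<Rightarrow> ('w \<Rightarrow> real) \<Rightarrow> bool" where
  "MPP M N \<Psi> \<longleftrightarrow>
     \<Psi> \<in> borel_measurable M \<and> measure M {\<omega>\<in>space M. 0 < \<Psi> \<omega>} = 1 \<and>
     cond_indep_increments M (gen_sigma M \<Psi>) N \<and>
     (\<forall>t\<ge>0. \<forall>s>0. has_cond_distribution M (gen_sigma M \<Psi>) (count_space UNIV)
        (increment N t (t + s))
        (\<lambda>\<omega>. measure_pmf (map_pmf enat (poisson_pmf (s * \<Psi> \<omega>)))))"

definition markov_property :: "'w measure \<Rightarrow> (real \<Rightarrow> 'w \<Rightarrow> enat) \<Rightarrow> bool" where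
  "markov_property M N \<longleftrightarrow>
     (\<forall>m\<ge>1. \<forall>(t::nat \<Rightarrow> real) (n::nat \<Rightarrow> nat).
        0 < t 1 \<longrightarrow> (\<forall>j\<in>{1..m}. t j < t (Suc j)) \<longrightarrow>
        measure M {\<omega>\<in>space M. \<forall>j\<in>{1..m}. N (t j) \<omega> = enat (n j)} > 0 \<longrightarrow>
        \<P>(\<omega> in M. N (t (Suc m)) \<omega> = enat (n (Suc m)) \<bar> \<forall>j\<in>{1..m}. N (t j) \<omega> = enat (n j))
        = \<P>(\<omega> in M. N (t (Suc m)) \<omega> = enat (n (Suc m)) \<bar> N (t m) \<omega> = enat (n m)))"

definition multinomial_property :: "'w measure \<Rightarrow> (real \<Rightarrow> 'w \<Rightarrow> enat) \<Rightarrow> bool" where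
  "multinomial_property M N \<longleftrightarrow>
     (\<forall>m\<ge>1. \<forall>(t::nat \<Rightarrow> real) (k::nat \<Rightarrow> nat). t 0 = 0 \<longrightarrow> (\<forall>j<m. t j < t (Suc j)) \<longrightarrow>
        (let n = (\<Sum>j=1..m. k j) in
          measure M {\<omega>\<in>space M. \<forall>j\<in>{1..m}. increment N (t (j - 1)) (t j) \<omega> = enat (k j)}
          = fact n / (\<Prod>j=1..m. fact (k j))
            * (\<Prod>j=1..m. ((t j - t (j - 1)) / t m) ^ k j)
            * measure M {\<omega>\<in>space M. N (t m) \<omega> = enat n}))"

end

theory Submission
  imports Defs
begin

text \<open>Integrating products of Poisson probabilities gives the multinomial property, and dividing
  multinomial weights gives the Markov property. For the converse, fix \<open>0 < a < t \<le> u\<close> and put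
  \<open>\<phi>\<^sub>a(u) = P\<^sub>\<theta>(a < W\<^sub>1 \<le> t, W\<^sub>1 + W\<^sub>2 > u)\<close>. Given \<open>N\<^sub>t = 1\<close>, the Markov property makes the past
  event \<open>N\<^sub>a = 0\<close> independent of \<open>W\<^sub>1 + W\<^sub>2 > u\<close> together with any event in \<open>(W\<^sub>3, W\<^sub>4)\<close>. As
  \<open>(W\<^sub>3, W\<^sub>4)\<close> is a conditionally independent copy of \<open>(W\<^sub>1, W\<^sub>2)\<close>, the functions \<open>\<phi>\<^sub>a(u)\<close> and \<open>\<phi>\<^sub>0(u)\<close> of
  \<open>\<Theta>\<close> can be tested against themselves, which forces \<open>P(N\<^sub>t = 1) \<phi>\<^sub>a(u) = P(N\<^sub>a = 0, N\<^sub>t = 1) \<phi>\<^sub>0(u)\<close>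
  almost surely. So \<open>\<phi>\<^sub>a(u) / \<phi>\<^sub>0(u)\<close> does not depend on \<open>u\<close>; letting the window for \<open>W\<^sub>1\<close> shrink to a
  point turns this into the functional equation of the exponential law for the tail of \<open>W\<^sub>1\<close> under
  \<open>P\<^sub>\<theta>\<close>, whose rate is the limit of the density at 0.\<close>

section \<open>Counts of a Poisson process\<close>

text \<open>The obstacle is that the Markov property speaks of \<open>P\<close> only, while
  exponential gaps are wanted for almost every value of \<open>\<Theta>\<close>. Under
  \<open>N t = 1\<close> the past constrains W_1 and the future feels W_1 through W_1 + W_2. The
  constants P(N_t = 1) and P(N_a = 0, N_t = 1) belong to the mixture and are the same for all
  parameters, so they drop out of the ratio. Heuristic for the functional equation, with S the tail
  of W_1: the ratio statement reads \<phi>_a(u) = c(u) \<phi>_a(t) for all a. Differentiating in a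
  gives S(u - a) = c(u) S(t - a), and a -> t gives c(u) = S(u - t), so S(u - a) = S(u - t) S(t - a).
  Two-sided bounds on increments in a stand in for the derivative. Each identity holds off a null
  set depending on a, t, u; hence only rational parameters are used, and continuity of S supplies
  the rest. A second obstacle: the gaps are understood given \<open>\<Theta>\<close>, but a mixed
  Poisson process conditions on its own rate. The rate is therefore read off the kernel, as a
  function measurable with respect to \<open>\<Theta>\<close>. The equivalences are closed as a
  cycle: Markov, mixed Poisson, multinomial, Markov.\<close>

abbreviation expo :: "real \<Rightarrow> real measure" where
  "expo l \<equiv> density lborel (\<lambda>x. ennreal (exponential_density l x))"

text \<open>The head of the stream is the residual waiting time: an interval without further arrivals
  shortens it, an arrival consumes it.\<close>

function counts :: "(real \<times> nat) list \<Rightarrow> real stream \<Rightarrow> bool" where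
  "counts [] w = True"
| "counts ((d, 0) # L) w = (d < shd w \<and> counts L ((shd w - d) ## stl w))"
| "counts ((d, Suc k) # L) w = (shd w \<le> d \<and> counts ((d - shd w, k) # L) (stl w))"
  by pat_completeness auto
termination
  by (relation "measures [\<lambda>(L, w). length L, \<lambda>(L, w). snd (hd L)]") auto

text \<open>The length of the first interval is a measurable function \<open>f z\<close> and not a
  constant, because each arrival replaces \<open>d\<close> by \<open>d - shd w\<close>, which
  depends on the stream. The hypothesis on \<open>L\<close> ranges over all \<open>g\<close> because
  passing to the next interval changes the head of the stream.\<close>

lemma pred_counts_Cons:
  assumes L: "\<And>g. g \<in> N \<rightarrow>\<^sub>M stream_space borel \<Longrightarrow> Measurable.pred N (\<lambda>z. counts L (g z))"
    and "f \<in> borel_measurable N" "g \<in> N \<rightarrow>\<^sub>M stream_space borel"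
  shows "Measurable.pred N (\<lambda>z. counts ((f z, k) # L) (g z))"
  using assms(2,3)
proof (induction k arbitrary: f g)
  case 0
  note [measurable] = 0
  have [measurable]: "Measurable.pred N (\<lambda>z. counts L ((shd (g z) - f z) ## stl (g z)))"
    by (rule L) measurable
  show ?case by simp
next
  case (Suc k)
  note [measurable] = Suc.prems
  have [measurable]: "Measurable.pred N (\<lambda>z. counts ((f z - shd (g z), k) # L) (stl (g z)))"
    by (rule Suc.IH) measurable
  show ?case by simp
qed

lemma pred_counts:
  "g \<in> N \<rightarrow>\<^sub>M stream_space borel \<Longrightarrow> Measurable.pred N (\<lambda>z. counts L (g z))"
proof (induction L arbitrary: g)
  case (Cons a L)
  then show ?case
    using pred_counts_Cons[of N L "\<lambda>_. fst a" g "snd a"] by simp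
qed simp

lemma sets_counts [measurable]: "{w. counts L w} \<in> sets (stream_space borel)"
  using pred_counts[of "\<lambda>w. w" "stream_space borel" L]
  by (simp add: pred_def space_stream_space)

lemma emeasure_stream_space_UNIV:
  assumes "prob_space \<mu>" "sets \<mu> = sets borel" "{w. P w} \<in> sets (stream_space borel)"
  shows "emeasure (stream_space \<mu>) {w. P w} = (\<integral>\<^sup>+x. emeasure (stream_space \<mu>) {w. P (x ## w)} \<partial>\<mu>)"
proof -
  interpret prob_space \<mu> by fact
  have "sets (stream_space \<mu>) = sets (stream_space borel)"
    using assms(2) by (rule sets_stream_space_cong)
  moreover have "space \<mu> = UNIV"
    using sets_eq_imp_space_eq[OF assms(2)] by simp
  ultimately show ?thesis
    using emeasure_stream_space[of "{w. P w}"] assms(3) by (simp add: space_stream_space)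
qed

lemma measurable_emeasure_counts [measurable]:
  assumes "0 < l"
  shows "(\<lambda>x. emeasure (stream_space (expo l)) {w. counts L (x ## w)}) \<in> borel_measurable borel"
proof -
  interpret prob_space "expo l" using assms by (rule prob_space_exponential_density)
  interpret S: prob_space "stream_space (expo l)" by (rule prob_space_stream_space)
  have s: "sets (stream_space (expo l)) = sets (stream_space borel)"
    by (rule sets_stream_space_cong) simp
  have [measurable]: "Measurable.pred (borel \<Otimes>\<^sub>M stream_space (expo l)) (\<lambda>z. counts L (fst z ## snd z))"
    by (rule pred_counts) (simp add: measurable_cong_sets[OF sets_pair_measure_cong[OF refl s] refl])
  have "{z \<in> space (borel \<Otimes>\<^sub>M stream_space (expo l)). counts L (fst z ## snd z)} \<in> sets (borel \<Otimes>\<^sub>M stream_space (expo l))"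
    by measurable
  from S.measurable_emeasure_Pair[OF this] show ?thesis
    by (simp add: space_pair_measure space_stream_space vimage_def)
qed

text \<open>Memorylessness: shifting the first gap by \<open>d\<close> splits the factor
  \<open>exp (- l * d)\<close> off the density and leaves an exponential residual gap in front of
  the same tail of the stream.\<close>

lemma emeasure_counts_zero:
  assumes l: "0 < l" and d: "0 \<le> d"
  shows "emeasure (stream_space (expo l)) {w. counts ((d, 0) # L) w}
    = ennreal (exp (- l * d)) * emeasure (stream_space (expo l)) {w. counts L w}"
proof -
  interpret prob_space "expo l" using l by (rule prob_space_exponential_density)
  let ?S = "stream_space (expo l)"
  define g where "g x = emeasure ?S {w. counts L (x ## w)}" for x
  have [measurable]: "g \<in> borel_measurable borel"
    unfolding g_def using l by measurable
  have "emeasure ?S {w. counts ((d, 0) # L) w} = (\<integral>\<^sup>+x. emeasure ?S {w. counts ((d, 0) # L) (x ## w)} \<partial>expo l)"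
    by (rule emeasure_stream_space_UNIV[OF prob_space_axioms _ sets_counts]) simp
  also have "\<dots> = (\<integral>\<^sup>+x. indicator {d<..} x * g (x - d) \<partial>expo l)"
    by (rule nn_integral_cong) (auto simp: g_def split: split_indicator)
  also have "\<dots> = (\<integral>\<^sup>+x. ennreal (exponential_density l x) * (indicator {d<..} x * g (x - d)) \<partial>lborel)"
    by (rule nn_integral_density) auto
  also have "\<dots> = (\<integral>\<^sup>+x. ennreal (exponential_density l (d + x)) * (indicator {d<..} (d + x) * g (d + x - d)) \<partial>lborel)"
    using nn_integral_real_affine[of "\<lambda>x. ennreal (exponential_density l x) * (indicator {d<..} x * g (x - d))" 1 d]
    by simp
  also have "\<dots> = (\<integral>\<^sup>+x. ennreal (exp (- l * d)) * (ennreal (exponential_density l x) * g x) \<partial>lborel)"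
  proof (rule nn_integral_cong_AE)
    \<comment> \<open>At 0 the strict indicator vanishes while the density is \<open>l\<close>, so
      the integrands agree only off this point.\<close>
    have "AE x in lborel. x \<noteq> (0::real)" by (rule AE_lborel_singleton)
    then show "AE x in lborel. ennreal (exponential_density l (d + x)) * (indicator {d<..} (d + x) * g (d + x - d))
      = ennreal (exp (- l * d)) * (ennreal (exponential_density l x) * g x)"
    proof (rule AE_mp, intro AE_I2 impI)
      fix x :: real assume "x \<noteq> 0"
      show "ennreal (exponential_density l (d + x)) * (indicator {d<..} (d + x) * g (d + x - d))
        = ennreal (exp (- l * d)) * (ennreal (exponential_density l x) * g x)"
      proof (cases "x < 0")
        case True then show ?thesis by (simp add: exponential_density_def)
      next
        case False
        then have "exponential_density l (d + x) = exp (- l * d) * exponential_density l x"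
          using d by (simp add: exponential_density_def exp_add[symmetric] algebra_simps)
        then show ?thesis using False \<open>x \<noteq> 0\<close> l
          by (simp add: ennreal_mult exponential_density_nonneg mult.assoc)
      qed
    qed
  qed
  also have "\<dots> = ennreal (exp (- l * d)) * (\<integral>\<^sup>+x. ennreal (exponential_density l x) * g x \<partial>lborel)"
    by (rule nn_integral_cmult) auto
  also have "(\<integral>\<^sup>+x. ennreal (exponential_density l x) * g x \<partial>lborel) = (\<integral>\<^sup>+x. g x \<partial>expo l)"
    by (rule nn_integral_density[symmetric]) auto
  also have "\<dots> = emeasure ?S {w. counts L w}"
    unfolding g_def by (rule emeasure_stream_space_UNIV[OF prob_space_axioms _ sets_counts, symmetric]) simp
  finally show ?thesis .
qed

text \<open>Conditioning on the first arrival \<open>x \<le> d\<close> leaves an interval of length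
  \<open>d - x\<close> with \<open>k\<close> arrivals. The exponential factors combine to the
  constant \<open>exp (- l * d)\<close>, so a power of \<open>d - x\<close> is all that is
  integrated. \<open>R\<close> carries the later intervals, and \<open>IH\<close> is needed at every
  length because \<open>d - x\<close> varies.\<close>

lemma emeasure_counts_Suc:
  assumes l: "0 < l" and d: "0 \<le> d" and R: "0 \<le> R"
    and IH: "\<And>x. 0 \<le> x \<Longrightarrow> emeasure (stream_space (expo l)) {w. counts ((x, k) # L) w}
      = ennreal (exp (- l * x) * (l * x) ^ k / fact k * R)"
  shows "emeasure (stream_space (expo l)) {w. counts ((d, Suc k) # L) w}
    = ennreal (exp (- l * d) * (l * d) ^ Suc k / fact (Suc k) * R)"
proof -
  interpret prob_space "expo l" using l by (rule prob_space_exponential_density)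
  let ?S = "stream_space (expo l)"
  have "emeasure ?S {w. counts ((d, Suc k) # L) w} = (\<integral>\<^sup>+x. emeasure ?S {w. counts ((d, Suc k) # L) (x ## w)} \<partial>expo l)"
    by (rule emeasure_stream_space_UNIV[OF prob_space_axioms _ sets_counts]) simp
  also have "\<dots> = (\<integral>\<^sup>+x. indicator {..d} x * ennreal (exp (- l * (d - x)) * (l * (d - x)) ^ k / fact k * R) \<partial>expo l)"
    by (rule nn_integral_cong) (auto simp: IH split: split_indicator)
  also have "\<dots> = (\<integral>\<^sup>+x. ennreal (exponential_density l x) * (indicator {..d} x * ennreal (exp (- l * (d - x)) * (l * (d - x)) ^ k / fact k * R)) \<partial>lborel)"
    by (rule nn_integral_density) auto
  also have "\<dots> = (\<integral>\<^sup>+x. ennreal (l * exp (- l * d) * (l * (d - x)) ^ k / fact k * R) * indicator {0..d} x \<partial>lborel)"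
  proof (rule nn_integral_cong)
    fix x :: real
    have "exp (- x * l) * exp (- l * (d - x)) = exp (- l * d)"
      by (simp add: exp_add[symmetric] algebra_simps)
    then show "ennreal (exponential_density l x) * (indicator {..d} x * ennreal (exp (- l * (d - x)) * (l * (d - x)) ^ k / fact k * R))
      = ennreal (l * exp (- l * d) * (l * (d - x)) ^ k / fact k * R) * indicator {0..d} x"
      using l R by (auto simp: exponential_density_def ennreal_mult[symmetric] mult_ac split: split_indicator)
  qed
  also have "\<dots> = ennreal (- (exp (- l * d) * (l * (d - d)) ^ Suc k / fact (Suc k) * R) - - (exp (- l * d) * (l * (d - 0)) ^ Suc k / fact (Suc k) * R))"
  proof (rule nn_integral_FTC_Icc[where F = "\<lambda>x. - (exp (- l * d) * (l * (d - x)) ^ Suc k / fact (Suc k) * R)"])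
    fix x assume x: "x \<in> {0..d}"
    have D: "((\<lambda>x. - (exp (- l * d) * (l * (d - x)) ^ Suc k / fact (Suc k) * R)) has_real_derivative
       - (exp (- l * d) * (real (Suc k) * (l * (d - x)) ^ k * (l * (0 - 1))) / fact (Suc k) * R)) (at x)"
      by (rule derivative_eq_intros refl | simp)+
    have "- (exp (- l * d) * (real (Suc k) * (l * (d - x)) ^ k * (l * (0 - 1))) / fact (Suc k) * R)
        = l * exp (- l * d) * (l * (d - x)) ^ k / fact k * R"
      by (simp add: fact_Suc field_simps del: of_nat_Suc)
    with D show "((\<lambda>x. - (exp (- l * d) * (l * (d - x)) ^ Suc k / fact (Suc k) * R)) has_real_derivative
      l * exp (- l * d) * (l * (d - x)) ^ k / fact k * R) (at x)"
      by (simp only:)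
    show "0 \<le> l * exp (- l * d) * (l * (d - x)) ^ k / fact k * R"
      using x l R by auto
  qed (use d in auto)
  finally show ?thesis by simp
qed

text \<open>Counts of a renewal stream with exponential gaps over consecutive intervals are
  independent Poisson variables. The inner induction on the count keeps the length of the first
  interval arbitrary.\<close>

lemma emeasure_counts:
  assumes l: "0 < l" and "\<forall>(d, k)\<in>set L. 0 \<le> d"
  shows "emeasure (stream_space (expo l)) {w. counts L w}
    = ennreal (\<Prod>(d, k)\<leftarrow>L. exp (- l * d) * (l * d) ^ k / fact k)"
  using assms(2)
proof (induction L)
  case Nil
  interpret prob_space "expo l" using l by (rule prob_space_exponential_density)
  interpret S: prob_space "stream_space (expo l)" by (rule prob_space_stream_space)
  show ?case using S.emeasure_space_1 by (simp add: space_stream_space)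
next
  case (Cons a L)
  define R where "R = (\<Prod>(d, k)\<leftarrow>L. exp (- l * d) * (l * d) ^ k / fact k)"
  have R: "0 \<le> R" unfolding R_def using Cons.prems l by (intro prod_list_nonneg) auto
  have L: "emeasure (stream_space (expo l)) {w. counts L w} = ennreal R"
    using Cons by (simp add: R_def)
  obtain d k where a: "a = (d, k)" by (cases a)
  have "0 \<le> d" using Cons.prems a by auto
  then have "emeasure (stream_space (expo l)) {w. counts ((d, k) # L) w}
      = ennreal (exp (- l * d) * (l * d) ^ k / fact k * R)"
  proof (induction k arbitrary: d)
    case 0 then show ?case using emeasure_counts_zero[OF l, of d L] L R by (simp add: ennreal_mult)
  next
    case (Suc k)
    show ?case by (rule emeasure_counts_Suc[OF l Suc.prems R]) (rule Suc.IH)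
  qed
  then show ?case by (simp add: a R_def)
qed

section \<open>Mixtures of i.i.d. sequences\<close>

lemma stream_cylinder_0: "{w. \<forall>i<Suc n. (x ## w) !! i \<in> B i}
    = (if x \<in> B 0 then {w. \<forall>i<n. w !! i \<in> B (Suc i)} else {})"
  by (auto simp: less_Suc_eq_0_disj)

lemma sets_stream_cylinder [measurable]:
  assumes "\<And>i. B i \<in> sets borel"
  shows "{w. \<forall>i<n. w !! i \<in> B i} \<in> sets (stream_space borel)"
proof -
  have "{w \<in> space (stream_space borel). \<forall>i\<in>{..<n}. w !! i \<in> B i} \<in> sets (stream_space borel)"
    by (rule sets.sets_Collect_finite_All) (use assms in auto)
  then show ?thesis by (simp add: space_stream_space Ball_def)
qed

lemma emeasure_stream_cylinder:
  assumes \<mu>: "prob_space \<mu>" "sets \<mu> = sets borel" and "\<And>i. B i \<in> sets borel"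
  shows "emeasure (stream_space \<mu>) {w. \<forall>i<n. w !! i \<in> B i} = (\<Prod>i<n. emeasure \<mu> (B i))"
  using assms(3)
proof (induction n arbitrary: B)
  case 0
  interpret prob_space \<mu> by fact
  interpret S: prob_space "stream_space \<mu>" by (rule prob_space_stream_space)
  show ?case using S.emeasure_space_1 sets_eq_imp_space_eq[OF \<mu>(2)]
    by (simp add: space_stream_space)
next
  case (Suc n)
  have "emeasure (stream_space \<mu>) {w. \<forall>i<Suc n. w !! i \<in> B i}
    = (\<integral>\<^sup>+x. emeasure (stream_space \<mu>) {w. \<forall>i<Suc n. (x ## w) !! i \<in> B i} \<partial>\<mu>)"
    by (rule emeasure_stream_space_UNIV[OF \<mu>]) (rule sets_stream_cylinder[OF Suc.prems])
  also have "\<dots> = (\<integral>\<^sup>+x. (\<Prod>i<n. emeasure \<mu> (B (Suc i))) * indicator (B 0) x \<partial>\<mu>)"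
    using Suc.IH[of "\<lambda>i. B (Suc i)"] Suc.prems
    by (intro nn_integral_cong) (auto simp: stream_cylinder_0 split: split_indicator)
  also have "\<dots> = (\<Prod>i<n. emeasure \<mu> (B (Suc i))) * emeasure \<mu> (B 0)"
    using Suc.prems \<mu>(2) by (intro nn_integral_cmult_indicator) auto
  finally show ?case by (simp add: prod.lessThan_Suc_shift mult.commute del: prod.lessThan_Suc)
qed

definition stream_cylinders :: "real stream set set" where
  "stream_cylinders = {{w. \<forall>i<n. w !! i \<in> B i} |n B. \<forall>i. B i \<in> sets borel}"

lemma sets_stream_space_borel:
  "sets (stream_space borel) = sigma_sets UNIV stream_cylinders"
proof (rule antisym)
  have "sets (stream_space borel) \<subseteq> sets (sigma UNIV stream_cylinders)"
  proof (rule sets_stream_space_in_sets)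
    show "(\<lambda>x. x !! i) \<in> sigma UNIV stream_cylinders \<rightarrow>\<^sub>M borel" for i
    proof (rule measurableI)
      fix A :: "real set" assume A: "A \<in> sets borel"
      have "(\<lambda>x. x !! i) -` A = {w. \<forall>j<Suc i. w !! j \<in> (if j = i then A else UNIV)}"
        by auto
      also have "\<dots> \<in> stream_cylinders"
        unfolding stream_cylinders_def using A
        by (intro CollectI exI[of _ "Suc i"] exI[of _ "\<lambda>j. if j = i then A else UNIV"]) auto
      finally show "(\<lambda>x. x !! i) -` A \<inter> space (sigma UNIV stream_cylinders) \<in> sets (sigma UNIV stream_cylinders)"
        by auto
    qed simp
  qed simp
  then show "sets (stream_space borel) \<subseteq> sigma_sets UNIV stream_cylinders" by simp
  have "stream_cylinders \<subseteq> sets (stream_space borel)"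
    by (auto simp: stream_cylinders_def)
  then show "sigma_sets UNIV stream_cylinders \<subseteq> sets (stream_space borel)"
    using sets.sigma_sets_subset[of stream_cylinders "stream_space borel"]
    by (simp add: space_stream_space)
qed

lemma Int_stable_stream_cylinders: "Int_stable stream_cylinders"
proof (rule Int_stableI)
  fix a b assume "a \<in> stream_cylinders" "b \<in> stream_cylinders"
  then obtain n B m C where a: "a = {w. \<forall>i<n. w !! i \<in> B i}" "\<And>i. B i \<in> sets borel"
    and b: "b = {w. \<forall>i<m. w !! i \<in> C i}" "\<And>i. C i \<in> sets borel"
    unfolding stream_cylinders_def by blast
  let ?E = "\<lambda>i. (if i < n then B i else UNIV) \<inter> (if i < m then C i else UNIV)"
  have "x \<in> ?E i \<longleftrightarrow> (i < n \<longrightarrow> x \<in> B i) \<and> (i < m \<longrightarrow> x \<in> C i)" for i x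
    by simp
  then have "a \<inter> b = {w. \<forall>i<max n m. w !! i \<in> ?E i}"
    unfolding a(1) b(1) less_max_iff_disj by blast
  moreover have "?E i \<in> sets borel" for i using a(2)[of i] b(2)[of i] by auto
  ultimately show "a \<inter> b \<in> stream_cylinders"
    unfolding stream_cylinders_def
    by (intro CollectI exI[of _ "max n m"] exI[of _ ?E] conjI allI) assumption+
qed

text \<open>\<open>cyl\<close> says that, given \<open>F\<close>, the \<open>W i\<close> are
  independent with common law \<open>\<kappa>\<close>; a Dynkin argument carries this from finite
  cylinders to all events of the stream. Measurability and the integral identity are proved
  together, since the complement and union steps of the identity integrate the function whose
  measurability is claimed.\<close>

lemma mixture_of_iid_streams:
  fixes W :: "nat \<Rightarrow> 'w \<Rightarrow> real"
  assumes M: "prob_space M" and sub: "subalgebra M F"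
    and \<kappa>: "\<And>\<omega>. prob_space (\<kappa> \<omega>)" "\<And>\<omega>. sets (\<kappa> \<omega>) = sets borel"
    and \<kappa>_meas: "\<And>B. B \<in> sets borel \<Longrightarrow> (\<lambda>\<omega>. measure (\<kappa> \<omega>) B) \<in> borel_measurable F"
    and W [measurable]: "\<And>i. W i \<in> borel_measurable M"
    and cyl: "\<And>A n B. A \<in> sets F \<Longrightarrow> (\<And>i. B i \<in> sets borel) \<Longrightarrow>
      emeasure M (A \<inter> {\<omega>\<in>space M. \<forall>i<n. W i \<omega> \<in> B i})
      = (\<integral>\<^sup>+\<omega>. indicator A \<omega> * (\<Prod>i<n. emeasure (\<kappa> \<omega>) (B i)) \<partial>M)"
    and E: "E \<in> sets (stream_space borel)"
  shows "(\<lambda>\<omega>. emeasure (stream_space (\<kappa> \<omega>)) E) \<in> borel_measurable F \<and>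
    (\<forall>A\<in>sets F. emeasure M (A \<inter> {\<omega>\<in>space M. to_stream (\<lambda>i. W i \<omega>) \<in> E})
      = (\<integral>\<^sup>+\<omega>. indicator A \<omega> * emeasure (stream_space (\<kappa> \<omega>)) E \<partial>M))"
proof -
  interpret prob_space M by (rule M)
  have \<kappa>S: "prob_space (stream_space (\<kappa> \<omega>))" for \<omega>
    using \<kappa>(1) by (rule prob_space.prob_space_stream_space)
  have \<kappa>sets: "sets (stream_space (\<kappa> \<omega>)) = sets (stream_space borel)" for \<omega>
    using \<kappa>(2) by (rule sets_stream_space_cong)
  have \<kappa>space: "space (stream_space (\<kappa> \<omega>)) = UNIV" for \<omega>
    using sets_eq_imp_space_eq[OF \<kappa>(2)[of \<omega>]] by (simp add: space_stream_space)
  have [measurable]: "(\<lambda>\<omega>. to_stream (\<lambda>i. W i \<omega>)) \<in> M \<rightarrow>\<^sub>M stream_space borel"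
    by (rule measurable_stream_space2) (simp add: to_stream_def)
  have FM: "A \<in> sets M" if "A \<in> sets F" for A using sub that by (auto simp: subalgebra_def)
  have FMf: "f \<in> borel_measurable M" if "f \<in> borel_measurable F" for f :: "'w \<Rightarrow> ennreal"
    using measurable_from_subalg[OF sub that] .
  have E': "E \<in> sigma_sets UNIV stream_cylinders"
    using E by (simp add: sets_stream_space_borel)
  have "stream_cylinders \<subseteq> Pow UNIV" by simp
  from Int_stable_stream_cylinders this E' show ?thesis
  proof (induction rule: sigma_sets_induct_disjoint)
    case (basic C)
    then obtain n B where C: "C = {w. \<forall>i<n. w !! i \<in> B i}" and B: "\<And>i. B i \<in> sets borel"
      unfolding stream_cylinders_def by blast
    have "(\<lambda>\<omega>. emeasure (stream_space (\<kappa> \<omega>)) C) = (\<lambda>\<omega>. \<Prod>i<n. ennreal (measure (\<kappa> \<omega>) (B i)))"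
      by (rule ext) (simp add: C emeasure_stream_cylinder[OF \<kappa> B]
          finite_measure.emeasure_eq_measure[OF prob_space.finite_measure[OF \<kappa>(1)]])
    moreover have "(\<lambda>\<omega>. \<Prod>i<n. ennreal (measure (\<kappa> \<omega>) (B i))) \<in> borel_measurable F"
      using \<kappa>_meas[OF B] by measurable
    moreover have "{\<omega>\<in>space M. to_stream (\<lambda>i. W i \<omega>) \<in> C} = {\<omega>\<in>space M. \<forall>i<n. W i \<omega> \<in> B i}"
      by (simp add: C to_stream_def)
    ultimately show ?case
      using cyl[OF _ B] by (simp add: C emeasure_stream_cylinder[OF \<kappa> B])
  next
    case empty then show ?case by simp
  next
    case (compl C)
    then have C[measurable]: "C \<in> sets (stream_space borel)" by (simp add: sets_stream_space_borel)
    have IHm [measurable]: "(\<lambda>\<omega>. emeasure (stream_space (\<kappa> \<omega>)) C) \<in> borel_measurable F"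
      using compl by simp
    have eq: "emeasure (stream_space (\<kappa> \<omega>)) (UNIV - C) = 1 - emeasure (stream_space (\<kappa> \<omega>)) C" for \<omega>
    proof -
      interpret S: prob_space "stream_space (\<kappa> \<omega>)" by (rule \<kappa>S)
      show ?thesis
        using emeasure_compl[of C "stream_space (\<kappa> \<omega>)"] C S.emeasure_space_1
        by (simp add: \<kappa>sets \<kappa>space S.emeasure_finite)
    qed
    have le1: "emeasure (stream_space (\<kappa> \<omega>)) C \<le> 1" for \<omega>
      using prob_space.emeasure_le_1[OF \<kappa>S] .
    show ?case
    proof (intro conjI ballI)
      show "(\<lambda>\<omega>. emeasure (stream_space (\<kappa> \<omega>)) (UNIV - C)) \<in> borel_measurable F"
        unfolding eq by measurable
    next
      fix A assume A: "A \<in> sets F"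
      note FM[OF A, measurable] FMf[OF IHm, measurable]
      let ?W = "{\<omega>\<in>space M. to_stream (\<lambda>i. W i \<omega>) \<in> C}"
      have "A \<inter> {\<omega>\<in>space M. to_stream (\<lambda>i. W i \<omega>) \<in> UNIV - C} = A - A \<inter> ?W"
        using sets.sets_into_space[OF FM[OF A]] by auto
      moreover have W: "A \<inter> ?W \<in> sets M" by measurable
      ultimately have "emeasure M (A \<inter> {\<omega>\<in>space M. to_stream (\<lambda>i. W i \<omega>) \<in> UNIV - C})
          = emeasure M A - emeasure M (A \<inter> ?W)"
        by (simp add: emeasure_Diff FM[OF A])
      also have "\<dots> = (\<integral>\<^sup>+\<omega>. indicator A \<omega> \<partial>M) - (\<integral>\<^sup>+\<omega>. indicator A \<omega> * emeasure (stream_space (\<kappa> \<omega>)) C \<partial>M)"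
        using compl A by simp
      also have "\<dots> = (\<integral>\<^sup>+\<omega>. indicator A \<omega> - indicator A \<omega> * emeasure (stream_space (\<kappa> \<omega>)) C \<partial>M)"
      proof (rule nn_integral_diff[symmetric])
        have "(\<integral>\<^sup>+\<omega>. indicator A \<omega> * emeasure (stream_space (\<kappa> \<omega>)) C \<partial>M) = emeasure M (A \<inter> ?W)"
          using compl A by simp
        then show "(\<integral>\<^sup>+\<omega>. indicator A \<omega> * emeasure (stream_space (\<kappa> \<omega>)) C \<partial>M) \<noteq> \<infinity>"
          by (simp add: emeasure_finite)
      qed (use le1 in \<open>auto split: split_indicator\<close>)
      also have "\<dots> = (\<integral>\<^sup>+\<omega>. indicator A \<omega> * emeasure (stream_space (\<kappa> \<omega>)) (UNIV - C) \<partial>M)"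
        by (intro nn_integral_cong) (auto simp: eq split: split_indicator)
      finally show "emeasure M (A \<inter> {\<omega>\<in>space M. to_stream (\<lambda>i. W i \<omega>) \<in> UNIV - C})
        = (\<integral>\<^sup>+\<omega>. indicator A \<omega> * emeasure (stream_space (\<kappa> \<omega>)) (UNIV - C) \<partial>M)" .
    qed
  next
    case (union C)
    then have C: "range C \<subseteq> sets (stream_space borel)" by (simp add: sets_stream_space_borel)
    then have C'[measurable]: "C i \<in> sets (stream_space borel)" for i by auto
    have IHm [measurable]: "(\<lambda>\<omega>. emeasure (stream_space (\<kappa> \<omega>)) (C i)) \<in> borel_measurable F" for i
      using union by simp
    have eq: "emeasure (stream_space (\<kappa> \<omega>)) (\<Union>(range C)) = (\<Sum>i. emeasure (stream_space (\<kappa> \<omega>)) (C i))" for \<omega>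
      using suminf_emeasure[of C "stream_space (\<kappa> \<omega>)"] C \<open>disjoint_family C\<close> by (simp add: \<kappa>sets)
    show ?case
    proof (intro conjI ballI)
      show "(\<lambda>\<omega>. emeasure (stream_space (\<kappa> \<omega>)) (\<Union>(range C))) \<in> borel_measurable F"
        unfolding eq by measurable
    next
      fix A assume A: "A \<in> sets F"
      note FM[OF A, measurable] FMf[OF IHm, measurable]
      let ?W = "\<lambda>i. A \<inter> {\<omega>\<in>space M. to_stream (\<lambda>i. W i \<omega>) \<in> C i}"
      have "A \<inter> {\<omega>\<in>space M. to_stream (\<lambda>i. W i \<omega>) \<in> \<Union>(range C)} = (\<Union>i. ?W i)"
        by auto
      also have "emeasure M \<dots> = (\<Sum>i. emeasure M (?W i))"
      proof (rule suminf_emeasure[symmetric])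
        have "?W i \<in> sets M" for i by measurable
        then show "range ?W \<subseteq> sets M" by auto
        show "disjoint_family ?W"
          using \<open>disjoint_family C\<close> by (auto simp: disjoint_family_on_def)
      qed
      also have "\<dots> = (\<Sum>i. \<integral>\<^sup>+\<omega>. indicator A \<omega> * emeasure (stream_space (\<kappa> \<omega>)) (C i) \<partial>M)"
        using union A by simp
      also have "\<dots> = (\<integral>\<^sup>+\<omega>. (\<Sum>i. indicator A \<omega> * emeasure (stream_space (\<kappa> \<omega>)) (C i)) \<partial>M)"
        by (rule nn_integral_suminf[symmetric]) measurable
      also have "\<dots> = (\<integral>\<^sup>+\<omega>. indicator A \<omega> * emeasure (stream_space (\<kappa> \<omega>)) (\<Union>(range C)) \<partial>M)"
        by (simp add: eq)
      finally show "emeasure M (A \<inter> {\<omega>\<in>space M. to_stream (\<lambda>i. W i \<omega>) \<in> \<Union>(range C)})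
        = (\<integral>\<^sup>+\<omega>. indicator A \<omega> * emeasure (stream_space (\<kappa> \<omega>)) (\<Union>(range C)) \<partial>M)" .
    qed
  qed
qed

section \<open>Conditional probabilities as integral identities over the events of a
  sub-sigma-algebra\<close>

lemma (in prob_space) emeasure_Int_cond_probability:
  assumes sub: "subalgebra M F" and X [measurable]: "X \<in> sets M" and A: "A \<in> sets F"
    and g: "AE \<omega> in M. cond_probability M F X \<omega> = g \<omega>"
    and [measurable]: "g \<in> borel_measurable M" and "\<And>\<omega>. 0 \<le> g \<omega>" "\<And>\<omega>. g \<omega> \<le> 1"
  shows "emeasure M (A \<inter> X) = (\<integral>\<^sup>+\<omega>. indicator A \<omega> * ennreal (g \<omega>) \<partial>M)"
proof -
  interpret finite_measure_subalgebra M F by unfold_locales (rule sub)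
  have [measurable]: "A \<in> sets M" using sub A by (auto simp: subalgebra_def)
  have "measure M (A \<inter> X) = (\<integral>x\<in>A. indicator X x \<partial>M)"
    by (simp add: set_lebesgue_integral_def indicator_inter_arith[symmetric])
  also have "\<dots> = (\<integral>x\<in>A. cond_probability M F X x \<partial>M)"
    unfolding cond_probability_def by (rule real_cond_exp_intA) (use A in \<open>auto simp: integrable_real_indicator emeasure_finite less_top[symmetric]\<close>)
  also have "\<dots> = (\<integral>x. indicator A x * g x \<partial>M)"
    unfolding set_lebesgue_integral_def
    by (rule integral_cong_AE) (use g in \<open>auto simp: cond_probability_def\<close>)
  finally have "emeasure M (A \<inter> X) = ennreal (\<integral>x. indicator A x * g x \<partial>M)"
    by (simp add: emeasure_eq_measure)
  also have "\<dots> = (\<integral>\<^sup>+x. ennreal (indicator A x * g x) \<partial>M)"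
  proof (rule nn_integral_eq_integral[symmetric])
    show "integrable M (\<lambda>x. indicator A x * g x)"
      by (rule integrable_const_bound[of _ 1]) (use assms in \<open>auto split: split_indicator\<close>)
  qed (use assms in auto)
  finally show ?thesis
    by (simp add: ennreal_mult assms ennreal_indicator)
qed

text \<open>Almost sure uniqueness of conditional expectations turns the set-wise identities that
  counting and Dynkin arguments deliver back into statements about conditional
  probabilities.\<close>

lemma (in prob_space) cond_probability_eqI:
  assumes sub: "subalgebra M F" and X [measurable]: "X \<in> sets M"
    and g [measurable]: "g \<in> borel_measurable F" and g01: "\<And>\<omega>. 0 \<le> g \<omega>" "\<And>\<omega>. g \<omega> \<le> 1"
    and eq: "\<And>A. A \<in> sets F \<Longrightarrow> emeasure M (A \<inter> X) = (\<integral>\<^sup>+\<omega>. indicator A \<omega> * ennreal (g \<omega>) \<partial>M)"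
  shows "AE \<omega> in M. cond_probability M F X \<omega> = g \<omega>"
proof -
  interpret finite_measure_subalgebra M F by unfold_locales (rule sub)
  have [measurable]: "g \<in> borel_measurable M" by (rule measurable_from_subalg[OF sub g])
  show ?thesis
    unfolding cond_probability_def
  proof (rule real_cond_exp_charact)
    fix A assume A: "A \<in> sets F"
    have [measurable]: "A \<in> sets M" using sub A by (auto simp: subalgebra_def)
    have "(\<integral>x\<in>A. indicator X x \<partial>M) = measure M (A \<inter> X)"
      by (simp add: set_lebesgue_integral_def indicator_inter_arith[symmetric])
    also have "\<dots> = enn2real (\<integral>\<^sup>+\<omega>. ennreal (indicator A \<omega> * g \<omega>) \<partial>M)"
      using eq[OF A] by (simp add: measure_def ennreal_mult g01 ennreal_indicator)
    also have "\<dots> = (\<integral>x\<in>A. g x \<partial>M)"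
      unfolding set_lebesgue_integral_def
      by (subst integral_eq_nn_integral) (use g01 in auto)
    finally show "(\<integral>x\<in>A. indicator X x \<partial>M) = (\<integral>x\<in>A. g x \<partial>M)" .
  next
    show "integrable M g"
      by (rule integrable_const_bound[of _ 1]) (use g01 in auto)
  qed (auto simp: integrable_real_indicator emeasure_finite less_top[symmetric])
qed

lemma subalgebra_gen_sigma: "Y \<in> borel_measurable M \<Longrightarrow> subalgebra M (gen_sigma M Y)"
  by (simp add: subalgebra_def gen_sigma_def sets_image_in_sets)

lemma measurable_gen_sigma: "Y \<in> borel_measurable M \<Longrightarrow> Y \<in> borel_measurable (gen_sigma M Y)"
  unfolding gen_sigma_def by (rule measurable_vimage_algebra1) auto

section \<open>Paths of a counting process\<close>

lemma counting_process_path: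
  assumes "counting_process M N" "\<omega> \<in> space M"
  shows "N 0 \<omega> = 0" "mono_on {0..} (\<lambda>t. N t \<omega>)" "((\<lambda>t. N t \<omega>) \<longlongrightarrow> \<infinity>) at_top"
    "0 \<le> t \<Longrightarrow> continuous (at_right t) (\<lambda>t. N t \<omega>)"
    "0 < t \<Longrightarrow> N t \<omega> \<le> (SUP s\<in>{0..<t}. N s \<omega>) + 1"
  using assms unfolding counting_process_def by auto

lemma counting_process_mono:
  assumes "counting_process M N" "\<omega> \<in> space M" "0 \<le> s" "s \<le> t"
  shows "N s \<omega> \<le> N t \<omega>"
  using mono_onD[OF counting_process_path(2)[OF assms(1,2)], of s t] assms by simp

text \<open>The infimum defining \<open>arrival\<close> runs over a level set, which is not upward
  closed, so the first passage \<open>\<tau>\<close> into \<open>{n..}\<close> is studied instead.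
  Right-continuity gives \<open>N \<tau> \<omega> \<ge> n\<close>, and unit jumps give the reverse
  bound because the path stays at most \<open>n - 1\<close> before \<open>\<tau>\<close>. Hence
  level \<open>n\<close> is hit exactly at \<open>\<tau>\<close> and the two infima agree, also on
  exploding paths.\<close>

lemma arrival_first_passage:
  assumes N: "counting_process M N" "\<omega> \<in> space M"
  shows "0 \<le> arrival N n \<omega> \<and> N (arrival N n \<omega>) \<omega> = enat n \<and>
    (\<forall>t\<ge>0. enat n \<le> N t \<omega> \<longleftrightarrow> arrival N n \<omega> \<le> t)"
proof (cases "n = 0")
  case True
  then show ?thesis using counting_process_path(1)[OF N] by (simp add: arrival_def zero_enat_def[symmetric])
next
  case False
  note mono = counting_process_mono[OF N]
  define S where "S = {t. 0 \<le> t \<and> enat n \<le> N t \<omega>}"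
  define \<tau> where "\<tau> = Inf S"
  have "eventually (\<lambda>t. enat n < N t \<omega>) at_top"
    using order_tendstoD(1)[OF counting_process_path(3)[OF N], of "enat n"] by simp
  then obtain b where b: "\<And>t. b \<le> t \<Longrightarrow> enat n < N t \<omega>"
    unfolding eventually_at_top_linorder by blast
  have "max b 0 \<in> S" unfolding S_def using b[of "max b 0"] by (simp add: order.strict_implies_order)
  then have ne: "S \<noteq> {}" by blast
  have bdd: "bdd_below S" unfolding S_def by (auto intro: bdd_belowI[of _ 0])
  have \<tau>0: "0 \<le> \<tau>" unfolding \<tau>_def by (rule cInf_greatest[OF ne]) (simp add: S_def)
  have ge: "enat n \<le> N \<tau> \<omega>"
  proof (rule ccontr)
    assume "\<not> enat n \<le> N \<tau> \<omega>"
    then have lt: "N \<tau> \<omega> < enat n" by simp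
    have "((\<lambda>t. N t \<omega>) \<longlongrightarrow> N \<tau> \<omega>) (at_right \<tau>)"
      using counting_process_path(4)[OF N \<tau>0] by (simp add: continuous_within)
    from order_tendstoD(2)[OF this lt] obtain b where b: "\<tau> < b" "\<And>y. \<tau> < y \<Longrightarrow> y < b \<Longrightarrow> N y \<omega> < enat n"
      unfolding eventually_at_right_field by blast
    obtain s where s: "s \<in> S" "s < b" using cInf_lessD[OF ne, of b] b(1) by (auto simp: \<tau>_def)
    have "\<tau> \<le> s" unfolding \<tau>_def by (rule cInf_lower[OF s(1) bdd])
    with s lt b(2)[of s] show False by (cases "s = \<tau>") (auto simp: S_def)
  qed
  \<comment> \<open>The bound on jumps is available at positive times only; \<open>\<tau>\<close> is
    positive because the path starts at 0 and \<open>n \<noteq> 0\<close>.\<close>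
  then have \<tau>: "0 < \<tau>"
    using \<tau>0 False counting_process_path(1)[OF N] by (cases "\<tau> = 0") (auto simp: zero_enat_def)
  have iff: "enat n \<le> N t \<omega> \<longleftrightarrow> \<tau> \<le> t" if "0 \<le> t" for t
  proof
    assume "enat n \<le> N t \<omega>" then show "\<tau> \<le> t"
      unfolding \<tau>_def using that by (intro cInf_lower[OF _ bdd]) (simp add: S_def)
  next
    assume "\<tau> \<le> t" then show "enat n \<le> N t \<omega>" using ge mono[OF \<tau>0] order_trans by blast
  qed
  have "(SUP s\<in>{0..<\<tau>}. N s \<omega>) \<le> enat (n - 1)"
  proof (rule SUP_least)
    fix s assume s: "s \<in> {0..<\<tau>}"
    then have "N s \<omega> < enat n" using iff[of s] by simp
    then show "N s \<omega> \<le> enat (n - 1)" by (cases "N s \<omega>") auto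
  qed
  then have "N \<tau> \<omega> \<le> enat (n - 1) + 1"
    by (rule order_trans[OF counting_process_path(5)[OF N \<tau>] add_right_mono])
  then have eq: "N \<tau> \<omega> = enat n" using ge False by (cases "N \<tau> \<omega>") (auto simp: one_enat_def)
  have "Inf {t. 0 \<le> t \<and> N t \<omega> = enat n} = \<tau>"
  proof (rule cInf_eq_minimum)
    fix t assume "t \<in> {t. 0 \<le> t \<and> N t \<omega> = enat n}"
    then show "\<tau> \<le> t" using iff[of t] by simp
  qed (use eq \<tau>0 in simp)
  then have "arrival N n \<omega> = \<tau>" using False by (simp add: arrival_def)
  then show ?thesis using \<tau>0 eq iff by simp
qed

lemma arrival_le_iff:
  "counting_process M N \<Longrightarrow> \<omega> \<in> space M \<Longrightarrow> 0 \<le> t \<Longrightarrow> arrival N n \<omega> \<le> t \<longleftrightarrow> enat n \<le> N t \<omega>"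
  using arrival_first_passage[of M N \<omega> n] by simp

lemma arrival_less_Suc:
  assumes N: "counting_process M N" "\<omega> \<in> space M"
  shows "arrival N n \<omega> < arrival N (Suc n) \<omega>"
proof -
  have "\<not> enat (Suc n) \<le> N (arrival N n \<omega>) \<omega>"
    using arrival_first_passage[OF N, of n] by simp
  then show ?thesis
    using arrival_le_iff[OF N, of "arrival N n \<omega>" "Suc n"] arrival_first_passage[OF N, of n] by simp
qed

lemma counting_process_eq_iff:
  assumes N: "counting_process M N" "\<omega> \<in> space M" and "0 \<le> t"
  shows "N t \<omega> = enat n \<longleftrightarrow> arrival N n \<omega> \<le> t \<and> t < arrival N (Suc n) \<omega>"
  using arrival_le_iff[OF assms, of n] arrival_le_iff[OF assms, of "Suc n"]
  by (cases "N t \<omega>") auto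

section \<open>Reading the increments of a path off its sequence of gaps\<close>

fun path_matches :: "(real \<Rightarrow> enat) \<Rightarrow> real \<Rightarrow> nat \<Rightarrow> (real \<times> nat) list \<Rightarrow> bool" where
  "path_matches f c n [] = True"
| "path_matches f c n ((d, k) # L) = (f (c + d) = enat (n + k) \<and> path_matches f (c + d) (n + k) L)"

definition interarrival_stream :: "(real \<Rightarrow> 'w \<Rightarrow> enat) \<Rightarrow> nat \<Rightarrow> 'w \<Rightarrow> real stream" where
  "interarrival_stream N n \<omega> = to_stream (\<lambda>i. interarrival N (Suc (n + i)) \<omega>)"

lemma interarrival_stream_unfold:
  "interarrival_stream N n \<omega> = interarrival N (Suc n) \<omega> ## interarrival_stream N (Suc n) \<omega>"
proof -
  have "(\<lambda>i. interarrival N (Suc (n + i)) \<omega>)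
      = case_nat (interarrival N (Suc n) \<omega>) (\<lambda>i. interarrival N (Suc (Suc n + i)) \<omega>)"
    by (auto simp: fun_eq_iff split: nat.split)
  then show ?thesis unfolding interarrival_stream_def by (simp only: to_stream_nat_case)
qed

text \<open>If \<open>c\<close> lies between the \<open>n\<close>-th and the next arrival, the
  residual waiting time is \<open>arrival N (Suc n) \<omega> - c\<close>; this is the head that
  \<open>counts\<close> expects. The two recursions of \<open>counts\<close> then move
  \<open>c\<close> either to the end of the interval or to the next arrival.\<close>

lemma counts_iff_path_matches:
  assumes N: "counting_process M N" "\<omega> \<in> space M"
    and "\<forall>(d, k)\<in>set L. 0 \<le> d" "arrival N n \<omega> \<le> c" "c < arrival N (Suc n) \<omega>"
  shows "counts L ((arrival N (Suc n) \<omega> - c) ## interarrival_stream N (Suc n) \<omega>)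
    \<longleftrightarrow> path_matches (\<lambda>t. N t \<omega>) c n L"
  using assms(3-)
proof (induction L arbitrary: c n)
  case (Cons a L)
  obtain d k where a: "a = (d, k)" by (cases a)
  have "0 \<le> d" using Cons.prems a by auto
  then have "counts ((d, k) # L) ((arrival N (Suc n) \<omega> - c) ## interarrival_stream N (Suc n) \<omega>)
    \<longleftrightarrow> path_matches (\<lambda>t. N t \<omega>) c n ((d, k) # L)"
    using Cons.prems(2,3)
  proof (induction k arbitrary: d c n)
    case 0
    have c: "0 \<le> c" using 0 arrival_first_passage[OF N, of n] by simp
    show ?case
    proof (cases "c + d < arrival N (Suc n) \<omega>")
      case True
      then have "N (c + d) \<omega> = enat n" using c 0 by (simp add: counting_process_eq_iff[OF N])
      then show ?thesis using True Cons.IH[of n "c + d"] Cons.prems(1) 0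
        by (simp add: diff_diff_eq less_diff_eq add.commute)
    next
      case False
      then have "N (c + d) \<omega> \<noteq> enat n" using c 0 by (simp add: counting_process_eq_iff[OF N])
      then show ?thesis using False by (simp add: algebra_simps)
    qed
  next
    case (Suc k)
    have c: "0 \<le> c" using Suc.prems arrival_first_passage[OF N, of n] by simp
    \<comment> \<open>An arrival inside the interval restarts the clock at \<open>?c'\<close>.
      Shortening the interval by \<open>?c' - c\<close> keeps its right end at \<open>c + d\<close>,
      and the residual waiting time becomes a full gap.\<close>
    let ?c' = "arrival N (Suc n) \<omega>"
    show ?case
    proof (cases "?c' \<le> c + d")
      case True
      have *: "arrival N (Suc (Suc n)) \<omega> - ?c' = interarrival N (Suc (Suc n)) \<omega>"
        by (simp add: interarrival_def)
      have "counts ((d - (?c' - c), k) # L) (interarrival_stream N (Suc n) \<omega>)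
        \<longleftrightarrow> path_matches (\<lambda>t. N t \<omega>) ?c' (Suc n) ((d - (?c' - c), k) # L)"
        using Suc.IH[of "d - (?c' - c)" "Suc n" ?c'] True arrival_less_Suc[OF N, of "Suc n"]
        unfolding * interarrival_stream_unfold[symmetric] by simp
      then show ?thesis using True by (simp add: algebra_simps)
    next
      case False
      then have "\<not> enat (Suc n) \<le> N (c + d) \<omega>"
        using arrival_le_iff[OF N, of "c + d" "Suc n"] c Suc.prems by simp
      then have "N (c + d) \<omega> \<noteq> enat (n + Suc k)" by auto
      then show ?thesis using False by (simp add: algebra_simps)
    qed
  qed
  then show ?case by (simp add: a)
qed simp

lemma path_matches_iff_increments:
  assumes N: "counting_process M N" "\<omega> \<in> space M"
    and t: "\<And>j. j < m \<Longrightarrow> t j < t (Suc j)" "0 \<le> t 0" and "i \<le> m" "N (t i) \<omega> = enat n"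
  shows "path_matches (\<lambda>t. N t \<omega>) (t i) n (map (\<lambda>j. (t (Suc j) - t j, k (Suc j))) [i..<m])
    \<longleftrightarrow> (\<forall>j\<in>{i<..m}. increment N (t (j - 1)) (t j) \<omega> = enat (k j))"
  using assms(5,6)
proof (induction i arbitrary: n rule: inc_induct)
  case base then show ?case by simp
next
  case (step i)
  have "0 \<le> t i" using \<open>i < m\<close>
  proof (induction i)
    case (Suc i) then show ?case using t(1)[of i] by simp
  qed (use t in simp)
  then have le: "N (t i) \<omega> \<le> N (t (Suc i)) \<omega>"
    using counting_process_mono[OF N] t(1)[OF step(2)] by simp
  have *: "increment N (t i) (t (Suc i)) \<omega> = enat (k (Suc i)) \<longleftrightarrow> N (t (Suc i)) \<omega> = enat (n + k (Suc i))"
    using le step.prems unfolding increment_def by (cases "N (t (Suc i)) \<omega>") auto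
  have "{i<..m} = insert (Suc i) {Suc i<..m}" using step(2) by auto
  then show ?case
    using * step.IH[of "n + k (Suc i)"] step(2) by (auto simp: upt_conv_Cons)
qed

definition increments_spec :: "nat \<Rightarrow> (nat \<Rightarrow> real) \<Rightarrow> (nat \<Rightarrow> nat) \<Rightarrow> (real \<times> nat) list" where
  "increments_spec m t k = map (\<lambda>j. (t (Suc j) - t j, k (Suc j))) [0..<m]"

lemma counts_iff_increments:
  assumes N: "counting_process M N" "\<omega> \<in> space M"
    and t: "t 0 = 0" "\<And>j. j < m \<Longrightarrow> t j < t (Suc j)"
  shows "counts (increments_spec m t k) (interarrival_stream N 0 \<omega>)
    \<longleftrightarrow> (\<forall>j\<in>{1..m}. increment N (t (j - 1)) (t j) \<omega> = enat (k j))"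
proof -
  have "\<forall>(d, k)\<in>set (increments_spec m t k). 0 \<le> d"
    using t(2) by (auto simp: increments_spec_def less_imp_le)
  moreover have "arrival N 0 \<omega> = 0" by (simp add: arrival_def)
  moreover have "arrival N (Suc 0) \<omega> ## interarrival_stream N (Suc 0) \<omega> = interarrival_stream N 0 \<omega>"
    by (subst interarrival_stream_unfold[of N 0]) (simp add: interarrival_def arrival_def)
  ultimately have "counts (increments_spec m t k) (interarrival_stream N 0 \<omega>)
      \<longleftrightarrow> path_matches (\<lambda>t. N t \<omega>) 0 0 (increments_spec m t k)"
    using counts_iff_path_matches[OF N, of "increments_spec m t k" 0 0] arrival_less_Suc[OF N, of 0]
    by simp
  also have "\<dots> \<longleftrightarrow> (\<forall>j\<in>{1..m}. increment N (t (j - 1)) (t j) \<omega> = enat (k j))"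
    using path_matches_iff_increments[where t = t and m = m and i = 0 and n = 0 and k = k, OF N t(2)] t(1) counting_process_path(1)[OF N]
    by (simp add: increments_spec_def zero_enat_def atLeastSucAtMost_greaterThanAtMost)
  finally show ?thesis .
qed

lemma emeasure_counts_increments_spec:
  assumes "0 < l" and "\<And>j. j < m \<Longrightarrow> t j < t (Suc j)"
  shows "emeasure (stream_space (expo l)) {w. counts (increments_spec m t k) w}
    = ennreal (\<Prod>j=1..m. pmf (poisson_pmf ((t j - t (j - 1)) * l)) (k j))"
proof -
  have "emeasure (stream_space (expo l)) {w. counts (increments_spec m t k) w}
      = ennreal (\<Prod>(d, k)\<leftarrow>increments_spec m t k. exp (- l * d) * (l * d) ^ k / fact k)"
    using assms by (intro emeasure_counts) (auto simp: increments_spec_def less_imp_le)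
  also have "(\<Prod>(d, k)\<leftarrow>increments_spec m t k. exp (- l * d) * (l * d) ^ k / fact k)
    = (\<Prod>j\<in>set [0..<m]. exp (- l * (t (Suc j) - t j)) * (l * (t (Suc j) - t j)) ^ k (Suc j) / fact (k (Suc j)))"
    by (subst prod.distinct_set_conv_list) (simp_all add: increments_spec_def o_def)
  also have "\<dots> = (\<Prod>j=1..m. exp (- l * (t j - t (j - 1))) * (l * (t j - t (j - 1))) ^ k j / fact (k j))"
    by (rule prod.reindex_bij_witness[of _ "\<lambda>j. j - 1" Suc]) auto
  also have "\<dots> = (\<Prod>j=1..m. pmf (poisson_pmf ((t j - t (j - 1)) * l)) (k j))"
  proof (rule prod.cong)
    fix j assume "j \<in> {1..m}"
    then have "j - 1 < m" "Suc (j - 1) = j" by auto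
    then have "0 < (t j - t (j - 1)) * l" using assms(1) assms(2)[of "j - 1"] by simp
    then show "exp (- l * (t j - t (j - 1))) * (l * (t j - t (j - 1))) ^ k j / fact (k j)
        = pmf (poisson_pmf ((t j - t (j - 1)) * l)) (k j)"
      by (simp add: mult.commute algebra_simps)
  qed simp
  finally show ?thesis .
qed

section \<open>Mixed Poisson increments\<close>

lemma measurable_increment [measurable]:
  assumes "counting_process M N" "0 \<le> s" "0 \<le> t"
  shows "increment N s t \<in> M \<rightarrow>\<^sub>M count_space UNIV"
proof -
  have [measurable]: "N s \<in> M \<rightarrow>\<^sub>M count_space UNIV" "N t \<in> M \<rightarrow>\<^sub>M count_space UNIV"
    using assms by (auto simp: counting_process_def)
  have "(\<lambda>\<omega>. N t \<omega> - N s \<omega>) \<in> M \<rightarrow>\<^sub>M count_space UNIV"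
    by (rule measurable_compose_countable[where g = "N s" and f = "\<lambda>i \<omega>. N t \<omega> - i"]) measurable
  then show ?thesis by (simp add: increment_def[abs_def])
qed

lemma strict_steps_nonneg:
  fixes t :: "nat \<Rightarrow> real"
  assumes "0 \<le> t 0" "\<And>j. j < m \<Longrightarrow> t j < t (Suc j)" "i \<le> m"
  shows "0 \<le> t i"
  using assms(3)
proof (induction i)
  case (Suc i) then show ?case using assms(2)[of i] by simp
qed (use assms in simp)

lemma borel_measurable_poisson_pmf:
  assumes [measurable]: "f \<in> borel_measurable F" and "\<And>x. 0 < f x"
  shows "(\<lambda>x. pmf (poisson_pmf (f x)) n) \<in> borel_measurable F"
  by (simp add: assms(2)) measurable

lemma borel_measurable_emeasure_poisson_pmf:
  assumes f: "f \<in> borel_measurable F" "\<And>x. 0 < f x"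
  shows "(\<lambda>x. emeasure (measure_pmf (poisson_pmf (f x))) B) \<in> borel_measurable F"
proof -
  have eq: "emeasure (measure_pmf p) B = (\<Sum>n. ennreal (pmf p n) * indicator B n)" for p :: "nat pmf"
    by (simp add: nn_integral_pmf[symmetric] nn_integral_count_space_indicator nn_integral_count_space_nat)
  show ?thesis
    unfolding eq using borel_measurable_poisson_pmf[OF f] by measurable
qed

lemma borel_measurable_measure_poisson_pmf:
  assumes f: "f \<in> borel_measurable F" "\<And>x. 0 < f x"
  shows "(\<lambda>x. measure (measure_pmf (poisson_pmf (f x))) B) \<in> borel_measurable F"
  unfolding measure_def using borel_measurable_emeasure_poisson_pmf[OF f] by measurable

lemma sets_increments:
  assumes N: "counting_process M N" and t: "t 0 = 0" "\<And>j. j < m \<Longrightarrow> t j < t (Suc j)"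
  shows "{\<omega>\<in>space M. \<forall>j\<in>{1..m}. increment N (t (j - 1)) (t j) \<omega> \<in> B j} \<in> sets M"
proof (rule sets.sets_Collect_finite_All)
  fix j assume "j \<in> {1..m}"
  then have j: "j - 1 \<le> m" "j \<le> m" by auto
  have "0 \<le> t i" if "i \<le> m" for i
    by (rule strict_steps_nonneg[of t m]) (use t that in auto)
  then have "increment N (t (j - 1)) (t j) \<in> M \<rightarrow>\<^sub>M count_space UNIV"
    using measurable_increment[OF N] j by blast
  from measurable_sets[OF this, of "B j"]
  have "increment N (t (j - 1)) (t j) -` B j \<inter> space M \<in> sets M" by simp
  also have "increment N (t (j - 1)) (t j) -` B j \<inter> space M
      = {\<omega>\<in>space M. increment N (t (j - 1)) (t j) \<omega> \<in> B j}" by auto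
  finally show "{\<omega>\<in>space M. increment N (t (j - 1)) (t j) \<omega> \<in> B j} \<in> sets M" .
qed simp

text \<open>The assumption \<open>increments\<close> fixes only the probabilities of finite values
  jointly with events of \<open>F\<close>, which is what \<open>counts\<close> computes; the full
  conditional law of the increments is derived from it. The rate is positive everywhere, so that the
  Poisson formula holds at every point; a merely almost surely positive rate has to be modified on a
  null set beforehand.\<close>

locale mixed_poisson_increments = prob_space M for M :: "'w measure" +
  fixes F :: "'w measure" and N :: "real \<Rightarrow> 'w \<Rightarrow> enat" and \<psi> :: "'w \<Rightarrow> real"
  assumes sub: "subalgebra M F" and N: "counting_process M N"
    and \<psi>: "\<psi> \<in> borel_measurable F" "\<And>\<omega>. 0 < \<psi> \<omega>"
    and increments: "\<And>A m t k. A \<in> sets F \<Longrightarrow> t 0 = 0 \<Longrightarrow> (\<And>j. j < m \<Longrightarrow> t j < t (Suc j)) \<Longrightarrow>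
      emeasure M (A \<inter> {\<omega>\<in>space M. \<forall>j\<in>{1..m}. increment N (t (j - 1)) (t j) \<omega> = enat (k j)})
      = (\<integral>\<^sup>+\<omega>. indicator A \<omega> * ennreal (\<Prod>j=1..m. pmf (poisson_pmf ((t j - t (j - 1)) * \<psi> \<omega>)) (k j)) \<partial>M)"
begin

lemma measurable_F: "A \<in> sets F \<Longrightarrow> A \<in> sets M"
  using sub by (auto simp: subalgebra_def)

lemma space_F: "space M \<in> sets F"
  using sub sets.top[of F] by (metis subalgebra_def)

lemma \<psi>_meas [measurable]: "\<psi> \<in> borel_measurable M"
  by (rule measurable_from_subalg[OF sub \<psi>(1)])

text \<open>The probabilities of the finite values are integrals of Poisson weights and sum to 1,
  which leaves no mass for the value \<open>\<infinity>\<close>.\<close>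

lemma not_exploded:
  assumes "0 < t"
  shows "AE \<omega> in M. N t \<omega> \<noteq> \<infinity>"
proof -
  have [measurable]: "N t \<in> M \<rightarrow>\<^sub>M count_space UNIV"
    using N assms by (auto simp: counting_process_def)
  have eq: "{\<omega>\<in>space M. N t \<omega> = enat n} = space M \<inter> {\<omega>\<in>space M. \<forall>j\<in>{1..1::nat}.
      increment N (if j - 1 = 0 then 0 else t) (if j = 0 then 0 else t) \<omega> = enat n}" for n
    using counting_process_path(1)[OF N] by (auto simp: increment_def)
  have "emeasure M {\<omega>\<in>space M. N t \<omega> = enat n} = (\<integral>\<^sup>+\<omega>. ennreal (pmf (poisson_pmf (t * \<psi> \<omega>)) n) \<partial>M)" for n
  proof -
    have "emeasure M {\<omega>\<in>space M. N t \<omega> = enat n}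
        = (\<integral>\<^sup>+\<omega>. indicator (space M) \<omega> * ennreal (pmf (poisson_pmf (t * \<psi> \<omega>)) n) \<partial>M)"
      unfolding eq using increments[of "space M" "\<lambda>j. if j = 0 then 0 else t" 1 "\<lambda>_. n"] assms
        space_F by simp
    also have "\<dots> = (\<integral>\<^sup>+\<omega>. ennreal (pmf (poisson_pmf (t * \<psi> \<omega>)) n) \<partial>M)"
      by (rule nn_integral_cong) simp
    finally show ?thesis .
  qed
  moreover have "{\<omega>\<in>space M. N t \<omega> \<noteq> \<infinity>} = (\<Union>n. {\<omega>\<in>space M. N t \<omega> = enat n})" by auto
  ultimately have "emeasure M {\<omega>\<in>space M. N t \<omega> \<noteq> \<infinity>}
      = (\<Sum>n. \<integral>\<^sup>+\<omega>. ennreal (pmf (poisson_pmf (t * \<psi> \<omega>)) n) \<partial>M)"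
    by (simp only:) (subst suminf_emeasure[symmetric], auto simp: disjoint_family_on_def)
  also have "\<dots> = (\<integral>\<^sup>+\<omega>. (\<Sum>n. ennreal (pmf (poisson_pmf (t * \<psi> \<omega>)) n)) \<partial>M)"
    using assms \<psi>(2) by (intro nn_integral_suminf[symmetric] measurable_compose[OF borel_measurable_poisson_pmf measurable_ennreal]) auto
  also have "\<dots> = 1"
    by (simp add: nn_integral_count_space_nat[symmetric] nn_integral_pmf emeasure_space_1
        measure_pmf.emeasure_space_1[simplified])
  finally show ?thesis
    by (intro AE_I_eq_1) simp_all
qed

lemma increment_infinity:
  assumes "s \<le> t" "0 \<le> s" "0 < t"
  shows "AE \<omega> in M. increment N s t \<omega> \<noteq> \<infinity>"
  using not_exploded[OF \<open>0 < t\<close>]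
proof (rule AE_mp, intro AE_I2 impI)
  fix \<omega> assume "N t \<omega> \<noteq> \<infinity>"
  then show "increment N s t \<omega> \<noteq> \<infinity>"
    by (cases "N t \<omega>"; cases "N s \<omega>") (auto simp: increment_def)
qed

text \<open>The passage from single values to arbitrary sets \<open>B j\<close> frees one coordinate
  at a time: the set for that coordinate is split into its points and the resulting sum is exchanged
  with the integral.\<close>

lemma emeasure_increments:
  assumes A: "A \<in> sets F" and t: "t 0 = 0" "\<And>j. j < m \<Longrightarrow> t j < t (Suc j)"
  shows "emeasure M (A \<inter> {\<omega>\<in>space M. \<forall>j\<in>{1..m}. increment N (t (j - 1)) (t j) \<omega> \<in> B j})
    = (\<integral>\<^sup>+\<omega>. indicator A \<omega> * (\<Prod>j=1..m. emeasure (measure_pmf (poisson_pmf ((t j - t (j - 1)) * \<psi> \<omega>))) (enat -` B j)) \<partial>M)"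
proof -
  let ?p = "\<lambda>j \<omega>. measure_pmf (poisson_pmf ((t j - t (j - 1)) * \<psi> \<omega>))"
  let ?inc = "\<lambda>j. increment N (t (j - 1)) (t j)"
  have tj: "t (j - 1) < t j" "0 \<le> t (j - 1)" "0 \<le> t j" "0 < t j" if "j \<in> {1..m}" for j
  proof -
    have j: "j - 1 < m" "Suc (j - 1) = j" using that by auto
    show *: "t (j - 1) < t j" using t(2)[of "j - 1"] j by simp
    show **: "0 \<le> t (j - 1)" by (rule strict_steps_nonneg[of t m]) (use t j in auto)
    show "0 \<le> t j" "0 < t j" using * ** by auto
  qed
  have inc [measurable]: "?inc j \<in> M \<rightarrow>\<^sub>M count_space UNIV" if "j \<in> {1..m}" for j
    using measurable_increment[OF N] tj[OF that] by simp
  have p_meas: "(\<lambda>\<omega>. emeasure (?p j \<omega>) X) \<in> borel_measurable M" if "j \<in> {1..m}" for j X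
    using tj[OF that] \<psi>(2) by (intro borel_measurable_emeasure_poisson_pmf) auto
  note measurable_F[OF A, measurable]
  have ev [measurable]: "{\<omega>\<in>space M. \<forall>j\<in>{1..m}. ?inc j \<omega> \<in> B j} \<in> sets M" for B
    by (rule sets_increments[OF N t])
  have "emeasure M (A \<inter> {\<omega>\<in>space M. \<forall>j\<in>{1..m}. ?inc j \<omega> \<in> B j})
    = (\<integral>\<^sup>+\<omega>. indicator A \<omega> * (\<Prod>j=1..m. emeasure (?p j \<omega>) (enat -` B j)) \<partial>M)"
    \<comment> \<open>\<open>J\<close> collects the coordinates whose set may be arbitrary; outside
      \<open>J\<close> a single finite value is prescribed.\<close>
    if "finite J" "J \<subseteq> {1..m}" "\<And>j. j \<in> {1..m} - J \<Longrightarrow> \<exists>n. B j = {enat n}" for J B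
    using that
  proof (induction J arbitrary: B)
    case empty
    then have "\<forall>j. \<exists>n. j \<in> {1..m} \<longrightarrow> B j = {enat n}" by blast
    then obtain k where k: "\<And>j. j \<in> {1..m} \<Longrightarrow> B j = {enat (k j)}" by metis
    have "{\<omega>\<in>space M. \<forall>j\<in>{1..m}. ?inc j \<omega> \<in> B j} = {\<omega>\<in>space M. \<forall>j\<in>{1..m}. ?inc j \<omega> = enat (k j)}"
      using k by auto
    moreover have "(\<Prod>j=1..m. emeasure (?p j \<omega>) (enat -` B j)) = ennreal (\<Prod>j=1..m. pmf (poisson_pmf ((t j - t (j - 1)) * \<psi> \<omega>)) (k j))" for \<omega>
    proof -
      have "enat -` {enat n} = {n}" for n by auto
      then show ?thesis
        by (subst prod_ennreal[symmetric]) (auto simp: k emeasure_pmf_single intro!: prod.cong)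
    qed
    ultimately show ?case using increments[OF A, of t m k] t by simp
  next
    case (insert i J)
    have i: "i \<in> {1..m}" using insert by auto
    let ?X = "\<lambda>n. A \<inter> {\<omega>\<in>space M. \<forall>j\<in>{1..m}. ?inc j \<omega> \<in> (B(i := {enat n})) j}"
    let ?R = "\<lambda>\<omega>. \<Prod>j\<in>{1..m}-{i}. emeasure (?p j \<omega>) (enat -` B j)"
    let ?I = "enat -` B i"
    have R [measurable]: "?R \<in> borel_measurable M"
      by (intro borel_measurable_prod_ennreal) (use p_meas in auto)
    have pi [measurable]: "(\<lambda>\<omega>. ennreal (pmf (poisson_pmf ((t i - t (i - 1)) * \<psi> \<omega>)) n)) \<in> borel_measurable M" for n
      using tj[OF i] \<psi>(2) by (intro measurable_compose[OF borel_measurable_poisson_pmf measurable_ennreal]) auto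
    have IH: "emeasure M (?X n) = (\<integral>\<^sup>+\<omega>. indicator A \<omega> * (ennreal (pmf (poisson_pmf ((t i - t (i - 1)) * \<psi> \<omega>)) n) * ?R \<omega>) \<partial>M)" for n
    proof -
      have "emeasure M (?X n) = (\<integral>\<^sup>+\<omega>. indicator A \<omega> * (\<Prod>j=1..m. emeasure (?p j \<omega>) (enat -` (B(i := {enat n})) j)) \<partial>M)"
        by (rule insert.IH) (use insert in auto)
      moreover have "(\<Prod>j=1..m. emeasure (?p j \<omega>) (enat -` (B(i := {enat n})) j))
          = ennreal (pmf (poisson_pmf ((t i - t (i - 1)) * \<psi> \<omega>)) n) * ?R \<omega>" for \<omega>
      proof -
        have "enat -` {enat n} = {n}" by auto
        then show ?thesis
          using i by (subst prod.remove[of _ i]) (auto simp: emeasure_pmf_single intro!: arg_cong2[where f = "(*)"] prod.cong)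
      qed
      ultimately show ?thesis by (simp only:)
    qed
    have X: "?X n \<in> sets M" for n
      by (intro sets.Int measurable_F A ev)
    have all_upd: "(\<forall>j\<in>{1..m}. ?inc j \<omega> \<in> (B(i := Y)) j)
        \<longleftrightarrow> ?inc i \<omega> \<in> Y \<and> (\<forall>j\<in>{1..m}-{i}. ?inc j \<omega> \<in> B j)" for \<omega> Y
      using i by (metis DiffD1 DiffD2 DiffI fun_upd_other fun_upd_same insertCI singletonD)
    \<comment> \<open>\<open>B i\<close> may contain \<open>\<infinity>\<close>, which the union
      over \<open>?I\<close> misses, so the two events agree only almost surely.\<close>
    have "emeasure M (A \<inter> {\<omega>\<in>space M. \<forall>j\<in>{1..m}. ?inc j \<omega> \<in> B j}) = emeasure M (\<Union>n\<in>?I. ?X n)"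
    proof (rule emeasure_eq_AE)
      show "AE \<omega> in M. \<omega> \<in> A \<inter> {\<omega>\<in>space M. \<forall>j\<in>{1..m}. ?inc j \<omega> \<in> B j} \<longleftrightarrow> \<omega> \<in> (\<Union>n\<in>?I. ?X n)"
        using increment_infinity[of "t (i - 1)" "t i"]
      proof (rule AE_mp)
        show "AE \<omega> in M. ?inc i \<omega> \<noteq> \<infinity> \<longrightarrow> \<omega> \<in> A \<inter> {\<omega>\<in>space M. \<forall>j\<in>{1..m}. ?inc j \<omega> \<in> B j} \<longleftrightarrow> \<omega> \<in> (\<Union>n\<in>?I. ?X n)"
        proof (intro AE_I2 impI)
          fix \<omega> assume "?inc i \<omega> \<noteq> \<infinity>"
          then obtain n where n: "?inc i \<omega> = enat n" by auto
          show "\<omega> \<in> A \<inter> {\<omega>\<in>space M. \<forall>j\<in>{1..m}. ?inc j \<omega> \<in> B j} \<longleftrightarrow> \<omega> \<in> (\<Union>n\<in>?I. ?X n)"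
            using n unfolding all_upd using all_upd[of \<omega> "B i"] by (simp del: fun_upd_apply)
        qed
      qed (use tj[OF i] in auto)
      show "(\<Union>n\<in>?I. ?X n) \<in> sets M"
        by (rule sets.countable_UN'[OF countableI_type image_subsetI]) (rule X)
      show "A \<inter> {\<omega>\<in>space M. \<forall>j\<in>{1..m}. ?inc j \<omega> \<in> B j} \<in> sets M"
        by (intro sets.Int measurable_F A ev)
    qed
    also have "\<dots> = (\<integral>\<^sup>+n. emeasure M (?X n) \<partial>count_space ?I)"
    proof (rule emeasure_UN_countable)
      show "disjoint_family_on ?X ?I"
        unfolding disjoint_family_on_def all_upd by auto
    qed (rule X countableI_type)+
    also have "\<dots> = (\<integral>\<^sup>+\<omega>. \<integral>\<^sup>+n. indicator A \<omega> * (ennreal (pmf (poisson_pmf ((t i - t (i - 1)) * \<psi> \<omega>)) n) * ?R \<omega>) \<partial>count_space ?I \<partial>M)"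
      unfolding IH
    proof (rule nn_integral_count_space_nn_integral[symmetric])
      show "(\<lambda>\<omega>. indicator A \<omega> * (ennreal (pmf (poisson_pmf ((t i - t (i - 1)) * \<psi> \<omega>)) n) * ?R \<omega>)) \<in> borel_measurable M" for n
        by (intro borel_measurable_times_ennreal pi R borel_measurable_indicator measurable_F A)
    qed simp
    also have "\<dots> = (\<integral>\<^sup>+\<omega>. indicator A \<omega> * (emeasure (?p i \<omega>) ?I * ?R \<omega>) \<partial>M)"
      by (simp add: nn_integral_cmult nn_integral_multc nn_integral_pmf)
    also have "\<dots> = (\<integral>\<^sup>+\<omega>. indicator A \<omega> * (\<Prod>j=1..m. emeasure (?p j \<omega>) (enat -` B j)) \<partial>M)"
      by (subst prod.remove[OF _ i]) simp_all
    finally show ?case .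
  qed
  from this[of "{1..m}"] show ?thesis by simp
qed

lemma cond_probability_increments:
  assumes t: "t 0 = 0" "\<And>j. j < m \<Longrightarrow> t j < t (Suc j)"
  shows "AE \<omega> in M. cond_probability M F {\<omega>\<in>space M. \<forall>j\<in>{1..m}. increment N (t (j - 1)) (t j) \<omega> \<in> B j} \<omega>
    = (\<Prod>j=1..m. measure (measure_pmf (poisson_pmf ((t j - t (j - 1)) * \<psi> \<omega>))) (enat -` B j))"
proof (rule cond_probability_eqI[OF sub])
  have tj: "t (j - 1) < t j \<and> 0 \<le> t (j - 1) \<and> 0 \<le> t j" if "j \<in> {1..m}" for j
  proof -
    have j: "j - 1 < m" "Suc (j - 1) = j" using that by auto
    have "t (j - 1) < t j" using t(2)[of "j - 1"] j by simp
    moreover have "0 \<le> t (j - 1)" by (rule strict_steps_nonneg[of t m]) (use t j in auto)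
    ultimately show ?thesis by auto
  qed
  show "{\<omega>\<in>space M. \<forall>j\<in>{1..m}. increment N (t (j - 1)) (t j) \<omega> \<in> B j} \<in> sets M"
    by (rule sets_increments[OF N t])
  show "(\<lambda>\<omega>. \<Prod>j=1..m. measure (measure_pmf (poisson_pmf ((t j - t (j - 1)) * \<psi> \<omega>))) (enat -` B j)) \<in> borel_measurable F"
    using tj \<psi>
    by (intro borel_measurable_prod borel_measurable_measure_poisson_pmf) auto
  show "(\<Prod>j=1..m. measure (measure_pmf (poisson_pmf ((t j - t (j - 1)) * \<psi> \<omega>))) (enat -` B j)) \<le> 1" for \<omega>
    by (rule prod_le_1) simp
  fix A assume "A \<in> sets F"
  then show "emeasure M (A \<inter> {\<omega>\<in>space M. \<forall>j\<in>{1..m}. increment N (t (j - 1)) (t j) \<omega> \<in> B j})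
    = (\<integral>\<^sup>+\<omega>. indicator A \<omega> * ennreal (\<Prod>j=1..m. measure (measure_pmf (poisson_pmf ((t j - t (j - 1)) * \<psi> \<omega>))) (enat -` B j)) \<partial>M)"
    using emeasure_increments[OF _ t] by (simp add: measure_pmf.emeasure_eq_measure prod_ennreal)
qed (auto intro!: prod_nonneg)

lemma cond_probability_increment:
  assumes t: "t 0 = 0" "\<And>j. j < m \<Longrightarrow> t j < t (Suc j)" and i: "i \<in> {1..m}"
  shows "AE \<omega> in M. cond_probability M F (increment N (t (i - 1)) (t i) -` B \<inter> space M) \<omega>
    = measure (measure_pmf (poisson_pmf ((t i - t (i - 1)) * \<psi> \<omega>))) (enat -` B)"
proof -
  let ?B = "\<lambda>j. if j = i then B else UNIV"
  have "{\<omega>\<in>space M. \<forall>j\<in>{1..m}. increment N (t (j - 1)) (t j) \<omega> \<in> ?B j}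
      = increment N (t (i - 1)) (t i) -` B \<inter> space M"
    using i by (auto split: if_splits)
  moreover have "(\<Prod>j=1..m. measure (measure_pmf (poisson_pmf ((t j - t (j - 1)) * \<psi> \<omega>))) (enat -` ?B j))
      = measure (measure_pmf (poisson_pmf ((t i - t (i - 1)) * \<psi> \<omega>))) (enat -` B)" for \<omega>
    using i by (subst prod.remove[of _ i]) auto
  ultimately show ?thesis using cond_probability_increments[OF t, of m ?B] by simp
qed

lemma cond_indep_increments: "cond_indep_increments M F N"
  unfolding cond_indep_increments_def cond_indep_vars_def
proof (intro allI impI conjI ballI)
  fix m :: nat and t :: "nat \<Rightarrow> real" and j
  assume t: "t 0 = 0" "\<forall>j<m. t j < t (Suc j)" and "j \<in> {1..m}"
  then have j: "j - 1 \<le> m" "j \<le> m" by auto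
  show "increment N (t (j - 1)) (t j) \<in> M \<rightarrow>\<^sub>M count_space UNIV"
    by (rule measurable_increment[OF N]; rule strict_steps_nonneg[of t m]) (use j t in auto)
next
  fix m :: nat and t :: "nat \<Rightarrow> real" and J and B :: "nat \<Rightarrow> enat set"
  assume t: "t 0 = 0" "\<forall>j<m. t j < t (Suc j)" and J: "J \<subseteq> {1..m}" "J \<noteq> {}" "finite J"
  let ?B = "\<lambda>j. if j \<in> J then B j else UNIV"
  let ?q = "\<lambda>j \<omega>. measure (measure_pmf (poisson_pmf ((t j - t (j - 1)) * \<psi> \<omega>)))"
  have "{\<omega>\<in>space M. \<forall>j\<in>{1..m}. increment N (t (j - 1)) (t j) \<omega> \<in> ?B j}
      = (\<Inter>j\<in>J. increment N (t (j - 1)) (t j) -` B j \<inter> space M)"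
    using J by (fastforce split: if_splits)
  moreover have "(\<Prod>j=1..m. ?q j \<omega> (enat -` ?B j)) = (\<Prod>j\<in>J. ?q j \<omega> (enat -` B j))" for \<omega>
    using J by (intro prod.mono_neutral_cong_right) auto
  ultimately have "AE \<omega> in M. cond_probability M F (\<Inter>j\<in>J. increment N (t (j - 1)) (t j) -` B j \<inter> space M) \<omega>
      = (\<Prod>j\<in>J. ?q j \<omega> (enat -` B j))"
    using cond_probability_increments[of t m ?B] t by simp
  moreover have "AE \<omega> in M. \<forall>j\<in>J. cond_probability M F (increment N (t (j - 1)) (t j) -` B j \<inter> space M) \<omega> = ?q j \<omega> (enat -` B j)"
    using J t by (intro AE_finite_allI cond_probability_increment[of t m]) auto
  ultimately show "AE \<omega> in M. cond_probability M F (\<Inter>j\<in>J. increment N (t (j - 1)) (t j) -` B j \<inter> space M) \<omega>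
      = (\<Prod>j\<in>J. cond_probability M F (increment N (t (j - 1)) (t j) -` B j \<inter> space M) \<omega>)"
    by eventually_elim simp
qed

lemma cond_distribution_increment:
  assumes "0 \<le> t" "0 < s"
  shows "cond_distribution M F (count_space UNIV) (increment N t (t + s))
    (\<lambda>\<omega>. measure_pmf (map_pmf enat (poisson_pmf (s * \<psi> \<omega>))))"
  unfolding cond_distribution_def
proof (intro conjI ballI)
  show "increment N t (t + s) \<in> M \<rightarrow>\<^sub>M count_space UNIV"
    using assms by (intro measurable_increment[OF N]) auto
  fix B :: "enat set"
  show "(\<lambda>\<omega>. measure (measure_pmf (map_pmf enat (poisson_pmf (s * \<psi> \<omega>)))) B) \<in> borel_measurable F"
    using assms \<psi> unfolding measure_map_pmf
    by (intro borel_measurable_measure_poisson_pmf) auto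
  \<comment> \<open>The interval has to be a cell of a partition starting at 0: the only cell if
    \<open>t = 0\<close>, otherwise the second of two.\<close>
  obtain m i u where "u 0 = 0" "\<And>j. j < m \<Longrightarrow> u j < u (Suc j)" "i \<in> {1..m}" "u (i - 1) = t" "u i = t + s"
  proof (cases "t = 0")
    case True
    show ?thesis
      by (rule that[of "\<lambda>j. real j * s" 1 1]) (use True assms in auto)
  next
    case False
    show ?thesis
      by (rule that[of "\<lambda>j. if j = 0 then 0 else if j = 1 then t else t + s" 2 2]) (use False assms in auto)
  qed
  from cond_probability_increment[OF this(1-3), of B] this(4,5)
  show "AE \<omega> in M. measure (measure_pmf (map_pmf enat (poisson_pmf (s * \<psi> \<omega>)))) B
    = cond_probability M F (increment N t (t + s) -` B \<inter> space M) \<omega>"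
    by (simp add: measure_map_pmf eq_commute)
qed (auto intro: measure_pmf.prob_space_axioms)

end

section \<open>From mixed Poisson processes to the multinomial and the Markov property\<close>

lemma has_cond_distribution_cond_probability:
  assumes "has_cond_distribution M F S X \<mu>" "subalgebra M F" "B \<in> sets S"
  shows "AE \<omega> in M. cond_probability M F (X -` B \<inter> space M) \<omega> = measure (\<mu> \<omega>) B"
proof -
  obtain \<kappa> where \<kappa>: "cond_distribution M F S X \<kappa>" "AE \<omega> in restr_to_subalg M F. \<kappa> \<omega> = \<mu> \<omega>"
    using assms(1) unfolding has_cond_distribution_def by blast
  have "AE \<omega> in M. \<kappa> \<omega> = \<mu> \<omega>" by (rule AE_restr_to_subalg[OF assms(2) \<kappa>(2)])
  moreover have "AE \<omega> in M. measure (\<kappa> \<omega>) B = cond_probability M F (X -` B \<inter> space M) \<omega>"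
    using \<kappa>(1) assms(3) unfolding cond_distribution_def by blast
  ultimately show ?thesis by eventually_elim simp
qed

text \<open>The rate \<open>\<Psi>\<close> may fail to be positive on a null set; the default 1
  there makes the integrand a product of genuine Poisson weights at every point without changing the
  integral.\<close>

lemma MPP_emeasure_increments:
  assumes M: "prob_space M" and N: "counting_process M N" and MPP: "MPP M N \<Psi>"
    and t: "t 0 = 0" "\<And>j. j < m \<Longrightarrow> t j < t (Suc j)" and m: "1 \<le> m"
  shows "emeasure M {\<omega>\<in>space M. \<forall>j\<in>{1..m}. increment N (t (j - 1)) (t j) \<omega> = enat (k j)}
    = (\<integral>\<^sup>+\<omega>. ennreal (\<Prod>j=1..m. pmf (poisson_pmf ((t j - t (j - 1)) * (if 0 < \<Psi> \<omega> then \<Psi> \<omega> else 1))) (k j)) \<partial>M)"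
proof -
  interpret prob_space M by fact
  let ?F = "gen_sigma M \<Psi>" and ?\<psi> = "\<lambda>\<omega>. if 0 < \<Psi> \<omega> then \<Psi> \<omega> else 1"
  have \<Psi> [measurable]: "\<Psi> \<in> borel_measurable M" using MPP by (simp add: MPP_def)
  have sub: "subalgebra M ?F" by (rule subalgebra_gen_sigma) fact
  have pos: "AE \<omega> in M. 0 < \<Psi> \<omega>"
    using MPP AE_prob_1[of "{\<omega>\<in>space M. 0 < \<Psi> \<omega>}"] by (simp add: MPP_def)
  let ?X = "\<lambda>j. increment N (t (j - 1)) (t j) -` {enat (k j)} \<inter> space M"
  have d: "t (j - 1) < t j \<and> 0 \<le> t (j - 1)" if "j \<in> {1..m}" for j
  proof -
    have j: "j - 1 < m" "Suc (j - 1) = j" using that by auto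
    have "t (j - 1) < t j" using t(2)[of "j - 1"] j by simp
    moreover have "0 \<le> t (j - 1)" by (rule strict_steps_nonneg[of t m]) (use t j in auto)
    ultimately show ?thesis by auto
  qed
  have "AE \<omega> in M. cond_probability M ?F (?X j) \<omega> = pmf (poisson_pmf ((t j - t (j - 1)) * ?\<psi> \<omega>)) (k j)"
    if "j \<in> {1..m}" for j
  proof -
    have "has_cond_distribution M ?F (count_space UNIV) (increment N (t (j - 1)) (t (j - 1) + (t j - t (j - 1))))
        (\<lambda>\<omega>. measure_pmf (map_pmf enat (poisson_pmf ((t j - t (j - 1)) * \<Psi> \<omega>))))"
      using MPP d[OF that] unfolding MPP_def by (metis diff_gt_0_iff_gt)
    from has_cond_distribution_cond_probability[OF this sub, of "{enat (k j)}"]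
    have "AE \<omega> in M. cond_probability M ?F (?X j) \<omega> = measure (measure_pmf (map_pmf enat (poisson_pmf ((t j - t (j - 1)) * \<Psi> \<omega>)))) {enat (k j)}"
      by simp
    with pos show ?thesis
    proof eventually_elim
      case (elim \<omega>)
      then show ?case by (simp add: measure_pmf_single pmf_map_inj' inj_def del: pmf_poisson)
    qed
  qed
  then have "AE \<omega> in M. \<forall>j\<in>{1..m}. cond_probability M ?F (?X j) \<omega> = pmf (poisson_pmf ((t j - t (j - 1)) * ?\<psi> \<omega>)) (k j)"
    by (intro AE_finite_allI) auto
  moreover have "AE \<omega> in M. cond_probability M ?F (\<Inter>j\<in>{1..m}. ?X j) \<omega> = (\<Prod>j\<in>{1..m}. cond_probability M ?F (?X j) \<omega>)"
  proof -
    have "cond_indep_vars M ?F (count_space UNIV) (\<lambda>j. increment N (t (j - 1)) (t j)) {1..m}"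
      using MPP t m unfolding MPP_def cond_indep_increments_def by blast
    then show ?thesis using m unfolding cond_indep_vars_def
      by (elim conjE allE[of _ "{1..m}"]) (auto dest: spec[of _ "\<lambda>j. {enat (k j)}"])
  qed
  ultimately have AE: "AE \<omega> in M. cond_probability M ?F (\<Inter>j\<in>{1..m}. ?X j) \<omega>
      = (\<Prod>j=1..m. pmf (poisson_pmf ((t j - t (j - 1)) * ?\<psi> \<omega>)) (k j))"
    by eventually_elim simp
  have eq: "(\<Inter>j\<in>{1..m}. ?X j) = {\<omega>\<in>space M. \<forall>j\<in>{1..m}. increment N (t (j - 1)) (t j) \<omega> = enat (k j)}"
    using m by (auto intro: bexI[of _ 1])
  let ?g = "\<lambda>\<omega>. \<Prod>j=1..m. pmf (poisson_pmf ((t j - t (j - 1)) * ?\<psi> \<omega>)) (k j)"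
  have "{\<omega>\<in>space M. \<forall>j\<in>{1..m}. increment N (t (j - 1)) (t j) \<omega> \<in> {enat (k j)}} \<in> sets M"
    by (rule sets_increments[OF N t])
  then have X: "(\<Inter>j\<in>{1..m}. ?X j) \<in> sets M"
    unfolding eq by (simp only: singleton_iff)
  have F: "space M \<in> sets ?F"
    using sub sets.top[of ?F] by (metis subalgebra_def)
  have g: "?g \<in> borel_measurable M"
  proof (rule borel_measurable_prod)
    fix j assume "j \<in> {1..m}"
    then show "(\<lambda>\<omega>. pmf (poisson_pmf ((t j - t (j - 1)) * ?\<psi> \<omega>)) (k j)) \<in> borel_measurable M"
      using d by (intro borel_measurable_poisson_pmf) auto
  qed
  have "emeasure M (space M \<inter> (\<Inter>j\<in>{1..m}. ?X j))
      = (\<integral>\<^sup>+\<omega>. indicator (space M) \<omega> * ennreal (\<Prod>j=1..m. pmf (poisson_pmf ((t j - t (j - 1)) * ?\<psi> \<omega>)) (k j)) \<partial>M)"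
    by (rule emeasure_Int_cond_probability[OF sub X F AE g]) (intro prod_nonneg prod_le_1 ballI conjI pmf_nonneg pmf_le_1)+
  also have "\<dots> = (\<integral>\<^sup>+\<omega>. ennreal (\<Prod>j=1..m. pmf (poisson_pmf ((t j - t (j - 1)) * ?\<psi> \<omega>)) (k j)) \<partial>M)"
    by (rule nn_integral_cong) simp
  also have "space M \<inter> (\<Inter>j\<in>{1..m}. ?X j) = {\<omega>\<in>space M. \<forall>j\<in>{1..m}. increment N (t (j - 1)) (t j) \<omega> = enat (k j)}"
    unfolding eq by auto
  finally show ?thesis .
qed

lemma strict_steps_pos:
  fixes t :: "nat \<Rightarrow> real"
  assumes "0 \<le> t 0" "\<And>j. j < m \<Longrightarrow> t j < t (Suc j)" "1 \<le> m"
  shows "0 < t m"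
proof -
  have "Suc (m - 1) = m" "m - 1 < m" using assms(3) by auto
  moreover have "0 \<le> t (m - 1)"
    by (rule strict_steps_nonneg[of t m]) (use assms in auto)
  ultimately show ?thesis using assms(2)[of "m - 1"] by simp
qed

section \<open>Multinomial weights and the Markov property\<close>

definition multinomial_weight :: "nat \<Rightarrow> (nat \<Rightarrow> real) \<Rightarrow> (nat \<Rightarrow> nat) \<Rightarrow> real" where
  "multinomial_weight m t k = fact (\<Sum>j=1..m. k j) / (\<Prod>j=1..m. fact (k j))
    * (\<Prod>j=1..m. ((t j - t (j - 1)) / t m) ^ k j)"

text \<open>Given their sum, independent Poisson counts are multinomial with cell probabilities
  proportional to the lengths. The weight is free of the rate \<open>r\<close>, so it can be pulled
  out of any mixture over the rate; this is all that the multinomial property needs.\<close>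

lemma poisson_product_multinomial:
  assumes t: "t 0 = 0" "\<And>j. j < m \<Longrightarrow> t j < t (Suc j)" and m: "1 \<le> m" and r: "0 < r"
  shows "(\<Prod>j=1..m. pmf (poisson_pmf ((t j - t (j - 1)) * r)) (k j))
    = multinomial_weight m t k * pmf (poisson_pmf (t m * r)) (\<Sum>j=1..m. k j)"
proof -
  let ?n = "\<Sum>j=1..m. k j" and ?d = "\<lambda>j. t j - t (j - 1)"
  have tm: "0 < t m" by (rule strict_steps_pos) (use t m in auto)
  have d: "0 < ?d j" if "j \<in> {1..m}" for j
  proof -
    have "j - 1 < m" "Suc (j - 1) = j" using that by auto
    then show ?thesis using t(2)[of "j - 1"] by simp
  qed
  have "(\<Sum>j=1..m. ?d j) = t m - t 0"
    by (induction m) auto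
  then have tele: "(\<Sum>j=1..m. ?d j) = t m" using t by simp
  have "(\<Prod>j=1..m. pmf (poisson_pmf (?d j * r)) (k j)) = (\<Prod>j=1..m. (?d j * r) ^ k j / fact (k j) * exp (- (?d j * r)))"
    using d r by (intro prod.cong) auto
  also have "\<dots> = (\<Prod>j=1..m. (?d j / t m) ^ k j * ((t m * r) ^ k j / fact (k j) * exp (- (?d j * r))))"
    using tm by (intro prod.cong) (auto simp: power_mult_distrib power_divide)
  also have "\<dots> = (\<Prod>j=1..m. (?d j / t m) ^ k j) * ((t m * r) ^ ?n / (\<Prod>j=1..m. fact (k j)) * exp (- (t m * r)))"
    by (simp add: prod.distrib prod_dividef power_sum exp_sum[symmetric] sum_negf sum_distrib_right[symmetric] tele
        del: One_nat_def)
  also have "\<dots> = multinomial_weight m t k * pmf (poisson_pmf (t m * r)) ?n"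
    using tm r by (simp add: multinomial_weight_def)
  finally show ?thesis .
qed

lemma MPP_imp_multinomial:
  assumes M: "prob_space M" and N: "counting_process M N" and MPP: "MPP M N \<Psi>"
  shows "multinomial_property M N"
  unfolding multinomial_property_def Let_def
proof (intro allI impI)
  fix m :: nat and t :: "nat \<Rightarrow> real" and k :: "nat \<Rightarrow> nat"
  assume m: "1 \<le> m" and t: "t 0 = 0" "\<forall>j<m. t j < t (Suc j)"
  interpret prob_space M by fact
  let ?n = "\<Sum>j=1..m. k j" and ?\<psi> = "\<lambda>\<omega>. if 0 < \<Psi> \<omega> then \<Psi> \<omega> else 1"
  have \<Psi> [measurable]: "\<Psi> \<in> borel_measurable M" using MPP by (simp add: MPP_def)
  have tm: "0 < t m" by (rule strict_steps_pos) (use t m in auto)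
  have w: "0 \<le> multinomial_weight m t k"
    unfolding multinomial_weight_def
  proof (intro mult_nonneg_nonneg divide_nonneg_nonneg prod_nonneg zero_le_power ballI)
    fix j assume "j \<in> {1..m}"
    then have "j - 1 < m" "Suc (j - 1) = j" by auto
    then show "0 \<le> t j - t (j - 1)" using t(2)[rule_format, of "j - 1"] by simp
  qed (use tm in auto)
  have "{\<omega>\<in>space M. N (t m) \<omega> = enat ?n}
      = {\<omega>\<in>space M. \<forall>j\<in>{1..1::nat}. increment N (if j - 1 = 0 then 0 else t m) (if j = 0 then 0 else t m) \<omega> = enat ?n}"
    using counting_process_path(1)[OF N] by (auto simp: increment_def)
  also have "emeasure M \<dots> = (\<integral>\<^sup>+\<omega>. ennreal (pmf (poisson_pmf (t m * ?\<psi> \<omega>)) ?n) \<partial>M)"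
    using MPP_emeasure_increments[OF M N MPP, of "\<lambda>j. if j = 0 then 0 else t m" 1 "\<lambda>_. ?n"] tm by simp
  finally have *: "emeasure M {\<omega>\<in>space M. N (t m) \<omega> = enat ?n} = (\<integral>\<^sup>+\<omega>. ennreal (pmf (poisson_pmf (t m * ?\<psi> \<omega>)) ?n) \<partial>M)" .
  have "emeasure M {\<omega>\<in>space M. \<forall>j\<in>{1..m}. increment N (t (j - 1)) (t j) \<omega> = enat (k j)}
    = (\<integral>\<^sup>+\<omega>. ennreal (\<Prod>j=1..m. pmf (poisson_pmf ((t j - t (j - 1)) * ?\<psi> \<omega>)) (k j)) \<partial>M)"
    using MPP_emeasure_increments[OF M N MPP _ _ m] t by simp
  also have "\<dots> = (\<integral>\<^sup>+\<omega>. ennreal (multinomial_weight m t k) * ennreal (pmf (poisson_pmf (t m * ?\<psi> \<omega>)) ?n) \<partial>M)"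
  proof (rule nn_integral_cong)
    fix \<omega>
    have "0 < ?\<psi> \<omega>" by simp
    from poisson_product_multinomial[OF _ _ m this, of t k] t w
    show "ennreal (\<Prod>j=1..m. pmf (poisson_pmf ((t j - t (j - 1)) * ?\<psi> \<omega>)) (k j))
      = ennreal (multinomial_weight m t k) * ennreal (pmf (poisson_pmf (t m * ?\<psi> \<omega>)) ?n)"
      by (simp add: ennreal_mult[symmetric] del: pmf_poisson)
  qed
  also have "\<dots> = ennreal (multinomial_weight m t k) * emeasure M {\<omega>\<in>space M. N (t m) \<omega> = enat ?n}"
    unfolding * using tm
    by (intro nn_integral_cmult measurable_compose[OF borel_measurable_poisson_pmf measurable_ennreal]) auto
  finally have "measure M {\<omega>\<in>space M. \<forall>j\<in>{1..m}. increment N (t (j - 1)) (t j) \<omega> = enat (k j)}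
      = multinomial_weight m t k * measure M {\<omega>\<in>space M. N (t m) \<omega> = enat ?n}"
    using w by (simp add: measure_def enn2real_mult)
  then show "measure M {\<omega>\<in>space M. \<forall>j\<in>{1..m}. increment N (t (j - 1)) (t j) \<omega> = enat (k j)}
      = fact ?n / (\<Prod>j=1..m. fact (k j)) * (\<Prod>j=1..m. ((t j - t (j - 1)) / t m) ^ k j)
        * measure M {\<omega>\<in>space M. N (t m) \<omega> = enat ?n}"
    by (simp add: multinomial_weight_def)
qed

text \<open>Chain rule: the total is first divided binomially between the times up to
  \<open>t m\<close> and the last cell, then the first part is distributed over the first
  \<open>m\<close> cells. Only the binomial factor involves the last step, and it sees the earlier
  counts through their sum alone.\<close>

lemma multinomial_weight_Suc:
  assumes "0 < t m" "0 < t (Suc m)" "t 0 = 0" "1 \<le> m"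
  shows "multinomial_weight (Suc m) t k = multinomial_weight m t k
    * multinomial_weight 2 (\<lambda>j. if j = 0 then 0 else t (m + j - 1)) (\<lambda>j. if j = 1 then \<Sum>i=1..m. k i else k (Suc m))"
proof -
  let ?n = "\<Sum>i=1..m. k i"
  have "{1..2} = {1, 2::nat}" by auto
  then have 2: "multinomial_weight 2 (\<lambda>j. if j = 0 then 0 else t (m + j - 1)) (\<lambda>j. if j = 1 then ?n else k (Suc m))
      = fact (?n + k (Suc m)) / (fact ?n * fact (k (Suc m)))
        * ((t m / t (Suc m)) ^ ?n * ((t (Suc m) - t m) / t (Suc m)) ^ k (Suc m))"
    by (simp add: multinomial_weight_def)
  have "(\<Prod>j=1..m. ((t j - t (j - 1)) / t (Suc m)) ^ k j)
      = (\<Prod>j=1..m. ((t j - t (j - 1)) / t m) ^ k j * (t m / t (Suc m)) ^ k j)"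
    using assms by (intro prod.cong) (auto simp: power_mult_distrib[symmetric])
  also have "\<dots> = (\<Prod>j=1..m. ((t j - t (j - 1)) / t m) ^ k j) * (t m / t (Suc m)) ^ ?n"
    by (simp add: prod.distrib power_sum)
  finally show ?thesis unfolding 2 by (simp add: multinomial_weight_def)
qed

lemma multinomialD:
  assumes "multinomial_property M N" "1 \<le> m" "t 0 = 0" "\<And>j. j < m \<Longrightarrow> t j < t (Suc j)"
  shows "measure M {\<omega>\<in>space M. \<forall>j\<in>{1..m}. increment N (t (j - 1)) (t j) \<omega> = enat (k j)}
    = multinomial_weight m t k * measure M {\<omega>\<in>space M. N (t m) \<omega> = enat (\<Sum>j=1..m. k j)}"
  using assms unfolding multinomial_property_def multinomial_weight_def Let_def by blast

lemma increments_iff_values: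
  assumes N: "counting_process M N" "\<omega> \<in> space M"
    and t: "t 0 = 0" "\<And>j. j < m \<Longrightarrow> t j < t (Suc j)"
    and n: "n 0 = 0" "\<And>j. j < m \<Longrightarrow> n j \<le> n (Suc j)"
  shows "(\<forall>j\<in>{1..m}. increment N (t (j - 1)) (t j) \<omega> = enat (n j - n (j - 1)))
    \<longleftrightarrow> (\<forall>j\<in>{1..m}. N (t j) \<omega> = enat (n j))"
  using t(2) n(2)
proof (induction m)
  case (Suc m)
  have split: "(\<forall>j\<in>{1..Suc m}. P j) \<longleftrightarrow> (\<forall>j\<in>{1..m}. P j) \<and> P (Suc m)" for P
    using atLeastAtMostSuc_conv[of 1 m] by auto
  have "increment N (t m) (t (Suc m)) \<omega> = enat (n (Suc m) - n m) \<longleftrightarrow> N (t (Suc m)) \<omega> = enat (n (Suc m))"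
    if "\<forall>j\<in>{1..m}. N (t j) \<omega> = enat (n j)"
  proof -
    have m: "N (t m) \<omega> = enat (n m)"
      using that t(1) n(1) counting_process_path(1)[OF N] by (cases "m = 0") (auto simp: zero_enat_def)
    have "0 \<le> t m" by (rule strict_steps_nonneg[of t "Suc m"]) (use t(1) Suc.prems in auto)
    then have "N (t m) \<omega> \<le> N (t (Suc m)) \<omega>"
      using counting_process_mono[OF N] Suc.prems(1)[of m] by simp
    then show ?thesis using m Suc.prems(2)[of m] by (cases "N (t (Suc m)) \<omega>") (auto simp: increment_def)
  qed
  then show ?case using Suc unfolding split by (auto simp del: One_nat_def)
qed simp

lemma sets_values:
  assumes N: "counting_process M N" and "finite R" "\<And>r. r \<in> R \<Longrightarrow> 0 \<le> s r"
  shows "{\<omega>\<in>space M. \<forall>r\<in>R. N (s r) \<omega> = enat (n r)} \<in> sets M"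
proof (rule sets.sets_Collect_finite_All)
  fix r assume "r \<in> R"
  then have [measurable]: "N (s r) \<in> M \<rightarrow>\<^sub>M count_space UNIV" using N assms(3) by (auto simp: counting_process_def)
  show "{\<omega>\<in>space M. N (s r) \<omega> = enat (n r)} \<in> sets M" by measurable
qed fact

text \<open>Each of the path events involved is a weight times the probability of its final value.
  By the chain rule for the weights, the factor for the new time depends on the past only through
  the value at \<open>t m\<close>. \<open>key\<close> states this in product form, without
  conditional probabilities.\<close>

lemma multinomial_imp_markov:
  assumes M: "prob_space M" and N: "counting_process M N" and mult: "multinomial_property M N"
  shows "markov_property M N"
  unfolding markov_property_def
proof (intro allI impI)
  fix m :: nat and t :: "nat \<Rightarrow> real" and n :: "nat \<Rightarrow> nat"
  assume m: "1 \<le> m" and t: "0 < t 1" "\<forall>j\<in>{1..m}. t j < t (Suc j)"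
    and pos: "0 < measure M {\<omega>\<in>space M. \<forall>j\<in>{1..m}. N (t j) \<omega> = enat (n j)}"
  interpret prob_space M by fact
  \<comment> \<open>The Markov property leaves index 0 unspecified, whereas the multinomial property
    starts its partition at time 0 with value 0.\<close>
  define t' where "t' = t(0 := 0)"
  define n' where "n' = n(0 := 0)"
  let ?E = "{\<omega>\<in>space M. \<forall>j\<in>{1..m}. N (t j) \<omega> = enat (n j)}"
  have t': "t' 0 = 0" "\<And>j. j < Suc m \<Longrightarrow> t' j < t' (Suc j)"
    using t by (auto simp: t'_def)
  have n'0: "n' 0 = 0" by (simp add: n'_def)
  \<comment> \<open>A path in this event of positive probability certifies that the prescribed
    values are nondecreasing up to \<open>m\<close>, so that differences of natural numbers are true
    increments.\<close>
  have "?E \<noteq> {}" using pos by (metis measure_empty less_irrefl)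
  then obtain \<omega>0 where \<omega>0: "\<omega>0 \<in> space M" "\<And>j. j \<in> {1..m} \<Longrightarrow> N (t' j) \<omega>0 = enat (n' j)"
    by (auto simp: t'_def n'_def)
  have \<omega>0': "N (t' j) \<omega>0 = enat (n' j)" if "j \<le> m" for j
    using \<omega>0 that counting_process_path(1)[OF N \<omega>0(1)] by (cases "j = 0") (auto simp: t'_def n'_def zero_enat_def)
  have t'0: "0 \<le> t' j" if "j \<le> Suc m" for j
    by (rule strict_steps_nonneg[of t' "Suc m"]) (use t' that in auto)
  have n'm: "n' j \<le> n' (Suc j)" if "j < m" for j
    using counting_process_mono[OF N \<omega>0(1) t'0[of j], of "t' (Suc j)"] \<omega>0'[of j] \<omega>0'[of "Suc j"] t'(2)[of j] that by simp
  have tm: "0 < t m" "0 < t (Suc m)" "t m < t (Suc m)"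
    using strict_steps_pos[of t' m] strict_steps_pos[of t' "Suc m"] t' t m by (auto simp: t'_def)
  have m2: "{\<omega>\<in>space M. (\<forall>j\<in>{1..m}. N (t j) \<omega> = enat (n j)) \<and> N (t (Suc m)) \<omega> = enat (n (Suc m))}
      = {\<omega>\<in>space M. \<forall>j\<in>{1..Suc m}. N (t j) \<omega> = enat (n j)}"
    using atLeastAtMostSuc_conv[of 1 m] by auto
  let ?C = "{\<omega>\<in>space M. N (t (Suc m)) \<omega> = enat (n (Suc m)) \<and> N (t m) \<omega> = enat (n m)}"
  let ?Em = "{\<omega>\<in>space M. N (t m) \<omega> = enat (n m)}"
  have key: "measure M {\<omega>\<in>space M. \<forall>j\<in>{1..Suc m}. N (t j) \<omega> = enat (n j)} * measure M ?Em
    = measure M ?E * measure M ?C"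
  proof (cases "n m \<le> n (Suc m)")
    case False
    have no: "\<not> (N (t (Suc m)) \<omega> = enat (n (Suc m)) \<and> N (t m) \<omega> = enat (n m))" if "\<omega> \<in> space M" for \<omega>
      using counting_process_mono[OF N that, of "t m" "t (Suc m)"] tm False by auto
    have "{\<omega>\<in>space M. \<forall>j\<in>{1..Suc m}. N (t j) \<omega> = enat (n j)} = {}"
    proof -
      have "m \<in> {1..Suc m}" "Suc m \<in> {1..Suc m}" using m by auto
      then show ?thesis using no by blast
    qed
    moreover have "?C = {}" using no by blast
    ultimately show ?thesis by (simp only: measure_empty)
  next
    case True
    then have n'm': "n' j \<le> n' (Suc j)" if "j < Suc m" for j
      using n'm[of j] that m by (cases "j = m") (auto simp: n'_def)
    let ?k = "\<lambda>j. n' j - n' (j - 1)"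
    \<comment> \<open>The partition 0, \<open>t m\<close>, \<open>t (Suc m)\<close>, which isolates
      the last transition.\<close>
    let ?t2 = "\<lambda>j. if j = 0 then 0 else t' (m + j - 1)"
    let ?n2 = "\<lambda>j. if j = 0 then 0 else n' (m + j - 1)"
    have sum: "(\<Sum>j=1..i. ?k j) = n' i" if "i \<le> Suc m" for i
      using that
    proof (induction i)
      case (Suc i) then show ?case using n'm'[of i] by simp
    qed (simp add: n'0)
    have val: "measure M {\<omega>\<in>space M. \<forall>j\<in>{1..i}. N (t j) \<omega> = enat (n j)}
        = multinomial_weight i t' ?k * measure M {\<omega>\<in>space M. N (t i) \<omega> = enat (n i)}" if "1 \<le> i" "i \<le> Suc m" for i
    proof -
      have V1: "{\<omega>\<in>space M. \<forall>j\<in>{1..i}. N (t j) \<omega> = enat (n j)} = {\<omega>\<in>space M. \<forall>j\<in>{1..i}. N (t' j) \<omega> = enat (n' j)}"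
        by (auto simp: t'_def n'_def)
      have V2: "{\<omega>\<in>space M. \<forall>j\<in>{1..i}. N (t' j) \<omega> = enat (n' j)} = {\<omega>\<in>space M. \<forall>j\<in>{1..i}. increment N (t' (j - 1)) (t' j) \<omega> = enat (?k j)}"
        using increments_iff_values[OF N, of _ t' i n'] t' n'0 n'm' that by auto
      have V3: "measure M {\<omega>\<in>space M. \<forall>j\<in>{1..i}. increment N (t' (j - 1)) (t' j) \<omega> = enat (?k j)} = multinomial_weight i t' ?k * measure M {\<omega>\<in>space M. N (t' i) \<omega> = enat (\<Sum>j=1..i. ?k j)}"
        using that t' by (intro multinomialD[OF mult]) auto
      have "N (t' i) = N (t i)" "n' i = n i" using that by (auto simp: t'_def n'_def)
      then show ?thesis unfolding V1 V2 V3 sum[OF that(2)] by simp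
    qed
    have C1: "?C = {\<omega>\<in>space M. \<forall>j\<in>{1..2}. N (?t2 j) \<omega> = enat (?n2 j)}"
    proof -
      have "{1..2} = {1, 2::nat}" by auto
      then show ?thesis using m by (auto simp: t'_def n'_def)
    qed
    have C2: "{\<omega>\<in>space M. \<forall>j\<in>{1..2}. N (?t2 j) \<omega> = enat (?n2 j)} = {\<omega>\<in>space M. \<forall>j\<in>{1..2}. increment N (?t2 (j - 1)) (?t2 j) \<omega> = enat (?n2 j - ?n2 (j - 1))}"
    proof -
      have "?t2 j < ?t2 (Suc j)" "?n2 j \<le> ?n2 (Suc j)" if "j < 2" for j
        using that m tm t'(2)[of m] n'm'[of m] by (cases j; simp add: t'_def n'_def; fail)+
      then show ?thesis
        by (intro Collect_cong conj_cong refl increments_iff_values[OF N, symmetric]) simp_all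
    qed
    have C3: "measure M {\<omega>\<in>space M. \<forall>j\<in>{1..2}. increment N (?t2 (j - 1)) (?t2 j) \<omega> = enat (?n2 j - ?n2 (j - 1))} = multinomial_weight 2 ?t2 (\<lambda>j. ?n2 j - ?n2 (j - 1))
        * measure M {\<omega>\<in>space M. N (?t2 2) \<omega> = enat (\<Sum>j=1..2. ?n2 j - ?n2 (j - 1))}"
    proof (rule multinomialD[OF mult])
      show "?t2 j < ?t2 (Suc j)" if "j < 2" for j
        using that m tm t'(2)[of m] by (cases j) (simp_all add: t'_def)
    qed auto
    have C4: "multinomial_weight 2 ?t2 (\<lambda>j. ?n2 j - ?n2 (j - 1))
        = multinomial_weight 2 ?t2 (\<lambda>j. if j = 1 then \<Sum>i=1..m. ?k i else ?k (Suc m))"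
    proof -
      have "{1..2} = {1, 2::nat}" by auto
      then show ?thesis unfolding multinomial_weight_def using m sum[of m] by simp
    qed
    have C5: "{\<omega>\<in>space M. N (?t2 2) \<omega> = enat (\<Sum>j=1..2. ?n2 j - ?n2 (j - 1))} = {\<omega>\<in>space M. N (t (Suc m)) \<omega> = enat (n (Suc m))}"
    proof -
      have "{1..2} = {1, 2::nat}" by auto
      then show ?thesis using n'm'[of m] m by (simp add: t'_def n'_def)
    qed
    have "measure M ?C = multinomial_weight 2 ?t2 (\<lambda>j. if j = 1 then \<Sum>i=1..m. ?k i else ?k (Suc m))
        * measure M {\<omega>\<in>space M. N (t (Suc m)) \<omega> = enat (n (Suc m))}"
      unfolding C1 C2 C3 C4 C5 ..
    then show ?thesis
      using val[of m] val[of "Suc m"] m multinomial_weight_Suc[of t' m ?k] tm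
      by (simp add: t'_def)
  qed
  have "?E \<subseteq> ?Em" using m by auto
  moreover have "?Em \<in> sets M"
    using sets_values[OF N, of "{m}" t n] tm by simp
  ultimately have "measure M ?E \<le> measure M ?Em" by (rule finite_measure_mono)
  with pos have pos': "0 < measure M ?Em" by simp
  show "\<P>(\<omega> in M. N (t (Suc m)) \<omega> = enat (n (Suc m)) \<bar> \<forall>j\<in>{1..m}. N (t j) \<omega> = enat (n j))
      = \<P>(\<omega> in M. N (t (Suc m)) \<omega> = enat (n (Suc m)) \<bar> N (t m) \<omega> = enat (n m))"
    using key pos pos' m2 unfolding cond_prob_def by (simp add: field_simps conj_commute)
qed

section \<open>The Markov property for the whole future\<close>

definition values_event :: "'w measure \<Rightarrow> (real \<Rightarrow> 'w \<Rightarrow> enat) \<Rightarrow> (nat \<Rightarrow> real) \<Rightarrow> (nat \<Rightarrow> nat) \<Rightarrow> nat set \<Rightarrow> 'w set" where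
  "values_event M N s n I = {\<omega>\<in>space M. \<forall>j\<in>I. N (s j) \<omega> = enat (n j)}"

text \<open>The transition factor involves the indices \<open>l\<close> and \<open>Suc l\<close>
  only, whatever the starting index \<open>i\<close>. This lets chains with and without a past be
  extended by the same factor.\<close>

lemma markov_step:
  assumes markov: "markov_property M N" and "i \<le> l" "0 < s i" "\<And>j. i \<le> j \<Longrightarrow> j \<le> l \<Longrightarrow> s j < s (Suc j)"
    and pos: "0 < measure M (values_event M N s n {i..l})"
  shows "measure M (values_event M N s n {i..Suc l}) = measure M (values_event M N s n {i..l})
    * (measure M (values_event M N s n {l, Suc l}) / measure M (values_event M N s n {l}))"
proof -
  define m where "m = Suc l - i"
  let ?t = "\<lambda>j. s (i + j - 1)" and ?n = "\<lambda>j. n (i + j - 1)"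
  have im: "i + m = Suc l" "1 \<le> m" using assms(2) by (auto simp: m_def)
  have past: "(\<forall>j\<in>{1..m}. N (?t j) \<omega> = enat (?n j)) \<longleftrightarrow> (\<forall>j\<in>{i..l}. N (s j) \<omega> = enat (n j))" for \<omega>
  proof -
    have eq: "{i..l} = (\<lambda>j. i + j - 1) ` {1..m}"
    proof (safe)
      fix j assume "j \<in> {i..l}"
      then have "j = i + (j - i + 1) - 1" "j - i + 1 \<in> {1..m}" using im by auto
      then show "j \<in> (\<lambda>j. i + j - 1) ` {1..m}" by (rule image_eqI)
    qed (use im in auto)
    show ?thesis unfolding eq by blast
  qed
  have split: "{i..Suc l} = insert (Suc l) {i..l}" using assms(2) by auto
  have idx: "?t (Suc m) = s (Suc l)" "?n (Suc m) = n (Suc l)" "?t m = s l" "?n m = n l"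
    using im by auto
  have steps: "\<forall>j\<in>{1..m}. ?t j < ?t (Suc j)"
  proof
    fix j assume j: "j \<in> {1..m}"
    then have "s (i + j - 1) < s (Suc (i + j - 1))" using im by (intro assms(4)) auto
    then show "?t j < ?t (Suc j)" using j by simp
  qed
  have "\<P>(\<omega> in M. N (?t (Suc m)) \<omega> = enat (?n (Suc m)) \<bar> \<forall>j\<in>{1..m}. N (?t j) \<omega> = enat (?n j))
      = \<P>(\<omega> in M. N (?t (Suc m)) \<omega> = enat (?n (Suc m)) \<bar> N (?t m) \<omega> = enat (?n m))"
  proof (rule markov[unfolded markov_property_def, rule_format, OF im(2)])
    show "0 < measure M {\<omega>\<in>space M. \<forall>j\<in>{1..m}. N (?t j) \<omega> = enat (?n j)}"
      unfolding past using pos by (simp add: values_event_def)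
    show "?t j < ?t (Suc j)" if "j \<in> {1..m}" for j using steps that by blast
  qed (use assms(3) in simp)
  then have "measure M (values_event M N s n {i..Suc l}) / measure M (values_event M N s n {i..l})
      = measure M (values_event M N s n {l, Suc l}) / measure M (values_event M N s n {l})"
    unfolding past idx cond_prob_def split values_event_def by (simp add: conj_commute)
  then show ?thesis using pos by (simp add: field_simps)
qed

text \<open>Index 0 is the past, 1 the present and the rest the future. The chains from 0 and from 1
  pick up the same factor \<open>?q\<close> at each step. Where a conditioning event is null, every
  event with more constraints is null too, so the product form survives although the conditional
  probability carries no information.\<close>

lemma markov_chain_split:
  assumes M: "prob_space M" and N: "counting_process M N" and markov: "markov_property M N"
    and "1 \<le> l" "0 < s 0" "\<And>j. j < l \<Longrightarrow> s j < s (Suc j)"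
  shows "measure M (values_event M N s n {0..l}) * measure M (values_event M N s n {1})
    = measure M (values_event M N s n {0..1}) * measure M (values_event M N s n {1..l})"
  using assms(4,6)
proof (induction l rule: dec_induct)
  case base then show ?case by simp
next
  case (step l)
  interpret prob_space M by fact
  let ?V = "values_event M N s n"
  let ?q = "measure M (?V {l, Suc l}) / measure M (?V {l})"
  have IH: "measure M (?V {0..l}) * measure M (?V {1}) = measure M (?V {0..1}) * measure M (?V {1..l})"
    using step by simp
  have s1: "0 < s 1" using assms(5) step.prems[of 0] by simp
  have s: "0 \<le> s j" if "j \<le> Suc l" for j
    by (rule strict_steps_nonneg[of s "Suc l"]) (use assms(5) step that in auto)
  have sets: "?V I \<in> sets M" if "I \<subseteq> {0..Suc l}" for I
    unfolding values_event_def using that s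
    by (intro sets_values[OF N]) (auto intro: finite_subset)
  have mono: "?V I \<subseteq> ?V J" if "J \<subseteq> I" for I J
    using that by (auto simp: values_event_def)
  have null: "measure M (?V I) = 0" if "measure M (?V J) = 0" "J \<subseteq> I" "J \<subseteq> {0..Suc l}" for I J
    using finite_measure_mono[OF mono[OF that(2)] sets[OF that(3)]] that(1)
    by (simp add: measure_le_0_iff)
  have eq1: "measure M (?V {1..Suc l}) = measure M (?V {1..l}) * ?q"
  proof (cases "measure M (?V {1..l}) = 0")
    case True
    then show ?thesis using null[of "{1..l}" "{1..Suc l}"] by simp
  next
    case False
    then show ?thesis
      using step s1 by (intro markov_step[OF markov]) (auto simp: zero_less_measure_iff)
  qed
  have eq0: "measure M (?V {0..Suc l}) = measure M (?V {0..l}) * ?q"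
  proof (cases "measure M (?V {0..l}) = 0")
    case True
    then show ?thesis using null[of "{0..l}" "{0..Suc l}"] by simp
  next
    case False
    then show ?thesis
      using step assms(5) by (intro markov_step[OF markov]) (auto simp: zero_less_measure_iff)
  qed
  have "measure M (?V {0..Suc l}) * measure M (?V {1}) = (measure M (?V {0..l}) * measure M (?V {1})) * ?q"
    unfolding eq0 by (simp only: ac_simps)
  also have "\<dots> = measure M (?V {0..1}) * measure M (?V {1..Suc l})"
    unfolding IH eq1 by (simp only: ac_simps)
  finally show ?case .
qed

lemma markov_finite_future:
  assumes M: "prob_space M" and N: "counting_process M N" and markov: "markov_property M N"
    and a: "0 < a" "a < t" and R: "finite R" "R \<subseteq> {t<..}"
  shows "measure M {\<omega>\<in>space M. N a \<omega> = enat i \<and> N t \<omega> = enat k \<and> (\<forall>r\<in>R. N r \<omega> = enat (\<nu> r))}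
      * measure M {\<omega>\<in>space M. N t \<omega> = enat k}
    = measure M {\<omega>\<in>space M. N a \<omega> = enat i \<and> N t \<omega> = enat k}
      * measure M {\<omega>\<in>space M. N t \<omega> = enat k \<and> (\<forall>r\<in>R. N r \<omega> = enat (\<nu> r))}"
proof -
  define xs where "xs = sorted_list_of_set R"
  have xs: "set xs = R" "sorted_wrt (<) xs" using R(1) by (auto simp: xs_def)
  let ?s = "\<lambda>j. (a # t # xs) ! j" and ?n = "\<lambda>j. (i # k # map \<nu> xs) ! j"
  let ?l = "Suc (length xs)"
  have sorted: "sorted_wrt (<) (a # t # xs)" using xs R(2) a by fastforce
  have steps: "?s j < ?s (Suc j)" if "j < ?l" for j
    using sorted_wrt_nth_less[OF sorted, of j "Suc j"] that by simp
  have all: "(\<forall>j\<in>{1..?l}. N (?s j) \<omega> = enat (?n j)) \<longleftrightarrow> N t \<omega> = enat k \<and> (\<forall>r\<in>R. N r \<omega> = enat (\<nu> r))" for \<omega>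
  proof -
    have "(\<forall>j\<in>{1..?l}. N (?s j) \<omega> = enat (?n j)) \<longleftrightarrow> (\<forall>j<?l. N (?s (Suc j)) \<omega> = enat (?n (Suc j)))"
      by (metis One_nat_def Suc_le_eq Suc_le_mono Suc_pred atLeastAtMost_iff less_Suc_eq_le not_less_eq_eq le0)
    also have "\<dots> \<longleftrightarrow> N t \<omega> = enat k \<and> (\<forall>j<length xs. N (xs ! j) \<omega> = enat (\<nu> (xs ! j)))"
      by (auto simp: less_Suc_eq_0_disj)
    also have "\<dots> \<longleftrightarrow> N t \<omega> = enat k \<and> (\<forall>r\<in>R. N r \<omega> = enat (\<nu> r))"
      by (simp add: xs(1)[symmetric] all_set_conv_all_nth)
    finally show ?thesis .
  qed
  have ins: "{0..?l} = insert 0 {1..?l}" by auto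
  have "(\<forall>j\<in>{0..?l}. P j) \<longleftrightarrow> P 0 \<and> (\<forall>j\<in>{1..?l}. P j)" for P unfolding ins by blast
  note split = this[of "\<lambda>j. N (?s j) _ = enat (?n j)"]
  have e1: "values_event M N ?s ?n {0..?l}
      = {\<omega>\<in>space M. N a \<omega> = enat i \<and> N t \<omega> = enat k \<and> (\<forall>r\<in>R. N r \<omega> = enat (\<nu> r))}"
    unfolding values_event_def split all by (simp only: nth_Cons_0)
  have e2: "values_event M N ?s ?n {1..?l} = {\<omega>\<in>space M. N t \<omega> = enat k \<and> (\<forall>r\<in>R. N r \<omega> = enat (\<nu> r))}"
    unfolding values_event_def all ..
  have "{0..1} = {0, 1::nat}" by auto
  then have e3: "values_event M N ?s ?n {0..1} = {\<omega>\<in>space M. N a \<omega> = enat i \<and> N t \<omega> = enat k}"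
    by (simp add: values_event_def)
  have e4: "values_event M N ?s ?n {1} = {\<omega>\<in>space M. N t \<omega> = enat k}"
    by (simp add: values_event_def)
  have "measure M (values_event M N ?s ?n {0..?l}) * measure M (values_event M N ?s ?n {1})
    = measure M (values_event M N ?s ?n {0..1}) * measure M (values_event M N ?s ?n {1..?l})"
    by (rule markov_chain_split[OF M N markov]) (use a steps in auto)
  then show ?thesis unfolding e1 e2 e3 e4 .
qed

text \<open>The empty set is adjoined for stability under intersection: two cylinders may prescribe
  different values at the same time. Only finite values are prescribed, as in the Markov property;
  explosion is reached through complements.\<close>

definition future_cylinders :: "'w measure \<Rightarrow> (real \<Rightarrow> 'w \<Rightarrow> enat) \<Rightarrow> real \<Rightarrow> 'w set set" where
  "future_cylinders M N t = insert {} {{\<omega>\<in>space M. \<forall>r\<in>R. N r \<omega> = enat (\<nu> r)} |R \<nu>. finite R \<and> R \<subseteq> {t..}}"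

lemma Int_stable_future_cylinders: "Int_stable (future_cylinders M N t)"
proof (rule Int_stableI)
  fix X Y assume X: "X \<in> future_cylinders M N t" and Y: "Y \<in> future_cylinders M N t"
  show "X \<inter> Y \<in> future_cylinders M N t"
  proof (cases "X \<inter> Y = {}")
    case True then show ?thesis by (simp add: future_cylinders_def)
  next
    case False
    then obtain R \<nu> R' \<nu>' where R: "X = {\<omega>\<in>space M. \<forall>r\<in>R. N r \<omega> = enat (\<nu> r)}" "finite R" "R \<subseteq> {t..}"
      and R': "Y = {\<omega>\<in>space M. \<forall>r\<in>R'. N r \<omega> = enat (\<nu>' r)}" "finite R'" "R' \<subseteq> {t..}"
      using X Y unfolding future_cylinders_def by blast
    from False obtain \<omega> where \<omega>: "\<omega> \<in> X" "\<omega> \<in> Y" by blast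
    let ?\<nu> = "\<lambda>r. if r \<in> R then \<nu> r else \<nu>' r"
    have "\<nu> r = \<nu>' r" if "r \<in> R" "r \<in> R'" for r using \<omega> that R(1) R'(1) by auto
    then have "X \<inter> Y = {\<omega>\<in>space M. \<forall>r\<in>R \<union> R'. N r \<omega> = enat (?\<nu> r)}"
      unfolding R(1) R'(1) by auto
    moreover have "finite (R \<union> R')" "R \<union> R' \<subseteq> {t..}" using R R' by auto
    ultimately show ?thesis unfolding future_cylinders_def
      by (intro insertI2 CollectI exI[of _ "R \<union> R'"] exI[of _ ?\<nu>] conjI)
  qed
qed

text \<open>Both sides are finite measures in \<open>E\<close> with the same total mass, and they
  agree on an intersection-stable generator by the finite-dimensional case.\<close>

lemma markov_future:
  assumes M: "prob_space M" and N: "counting_process M N" and markov: "markov_property M N"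
    and a: "0 < a" "a < t" and E: "E \<in> sigma_sets (space M) (future_cylinders M N t)"
  shows "measure M ({\<omega>\<in>space M. N a \<omega> = enat i \<and> N t \<omega> = enat k} \<inter> E) * measure M {\<omega>\<in>space M. N t \<omega> = enat k}
    = measure M {\<omega>\<in>space M. N a \<omega> = enat i \<and> N t \<omega> = enat k} * measure M ({\<omega>\<in>space M. N t \<omega> = enat k} \<inter> E)"
    (is "measure M (?A \<inter> E) * measure M ?B = measure M ?A * measure M (?B \<inter> E)")
proof -
  interpret prob_space M by fact
  have Nm [measurable]: "N r \<in> M \<rightarrow>\<^sub>M count_space UNIV" if "t \<le> r" for r
    using N a that by (auto simp: counting_process_def)
  have [measurable]: "N a \<in> M \<rightarrow>\<^sub>M count_space UNIV"
    using N a by (auto simp: counting_process_def)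
  have B [measurable]: "?B \<in> sets M" using Nm[of t] by measurable
  have A [measurable]: "?A \<in> sets M" using Nm[of t] by measurable
  have cyl_sets: "future_cylinders M N t \<subseteq> sets M"
  proof
    fix X assume "X \<in> future_cylinders M N t"
    then consider "X = {}"
      | R \<nu> where "X = {\<omega>\<in>space M. \<forall>r\<in>R. N r \<omega> = enat (\<nu> r)}" "finite R" "R \<subseteq> {t..}"
      unfolding future_cylinders_def by blast
    then show "X \<in> sets M"
    proof cases
      case 2
      have "0 \<le> r" if "r \<in> R" for r using 2(3) a that by auto
      then show ?thesis unfolding 2(1) by (rule sets_values[OF N 2(2)])
    qed simp
  qed
  have sub: "future_cylinders M N t \<subseteq> Pow (space M)"
    using cyl_sets sets.sets_into_space by blast
  have E_sets: "C \<in> sets M" if "C \<in> sigma_sets (space M) (future_cylinders M N t)" for C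
    using sets.sigma_sets_subset[OF cyl_sets] that by blast
  from Int_stable_future_cylinders sub E show ?thesis
  proof (induction rule: sigma_sets_induct_disjoint)
    case (basic C)
    show ?case
    proof (cases "C = {}")
      case False
      with basic obtain R \<nu> where C: "C = {\<omega>\<in>space M. \<forall>r\<in>R. N r \<omega> = enat (\<nu> r)}" and R: "finite R" "R \<subseteq> {t..}"
        unfolding future_cylinders_def by blast
      show ?thesis
      proof (cases "t \<in> R \<and> \<nu> t \<noteq> k")
        case True
        then have "?A \<inter> C = {}" "?B \<inter> C = {}" using C by auto
        then show ?thesis by simp
      next
        case False
        let ?R = "R - {t}"
        have "?A \<inter> C = {\<omega>\<in>space M. N a \<omega> = enat i \<and> N t \<omega> = enat k \<and> (\<forall>r\<in>?R. N r \<omega> = enat (\<nu> r))}"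
          "?B \<inter> C = {\<omega>\<in>space M. N t \<omega> = enat k \<and> (\<forall>r\<in>?R. N r \<omega> = enat (\<nu> r))}"
          unfolding C using False by auto
        moreover have "finite ?R" "?R \<subseteq> {t<..}" using R by auto
        ultimately show ?thesis using markov_finite_future[OF M N markov a, of ?R i k \<nu>] by simp
      qed
    qed simp
  next
    case empty then show ?case by simp
  next
    case (compl C)
    have diff: "measure M (X \<inter> (space M - C)) = measure M X - measure M (X \<inter> C)" if "X \<in> sets M" for X
    proof -
      have "X \<inter> (space M - C) = X - X \<inter> C" using sets.sets_into_space[OF that] by auto
      then show ?thesis using finite_measure_Diff[of X "X \<inter> C"] that E_sets[OF compl(1)] by auto
    qed
    show ?case using compl(2) unfolding diff[OF A] diff[OF B] by (simp add: algebra_simps)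
  next
    case (union C)
    have sums: "(\<lambda>i. measure M (X \<inter> C i)) sums measure M (X \<inter> \<Union>(range C))" if "X \<in> sets M" for X
    proof -
      have "X \<inter> \<Union>(range C) = (\<Union>i. X \<inter> C i)" by auto
      moreover have "range (\<lambda>i. X \<inter> C i) \<subseteq> sets M" using union(2) E_sets that by auto
      moreover have "disjoint_family (\<lambda>i. X \<inter> C i)"
        using union(1) by (auto simp: disjoint_family_on_def)
      ultimately show ?thesis using finite_measure_UNION by metis
    qed
    have "(\<lambda>i. measure M (?A \<inter> C i) * measure M ?B) sums (measure M (?A \<inter> \<Union>(range C)) * measure M ?B)"
      by (intro sums_mult2 sums A)
    moreover have "(\<lambda>i. measure M ?A * measure M (?B \<inter> C i)) sums (measure M ?A * measure M (?B \<inter> \<Union>(range C)))"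
      by (intro sums_mult sums B)
    ultimately show ?case unfolding union(3) by (rule sums_unique2)
  qed
qed

text \<open>An arrival before \<open>t\<close> cannot be dated from the path after \<open>t\<close>,
  hence the truncation. For \<open>u \<ge> t\<close> the event that the truncated time is at most
  \<open>u\<close> is the complement of \<open>N u < n\<close>, a description by finite values that
  also covers exploded paths.\<close>

lemma measurable_max_arrival:
  assumes N: "counting_process M N" and t: "0 \<le> t"
  shows "(\<lambda>\<omega>. max t (arrival N n \<omega>)) \<in> borel_measurable (sigma (space M) (future_cylinders M N t))"
    (is "_ \<in> borel_measurable ?S")
proof (rule borel_measurableI_le)
  have sub: "future_cylinders M N t \<subseteq> Pow (space M)" by (auto simp: future_cylinders_def)
  fix u
  show "{\<omega>\<in>space ?S. max t (arrival N n \<omega>) \<le> u} \<in> sets ?S"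
  proof (cases "t \<le> u")
    case False
    then have e: "{\<omega>\<in>space ?S. max t (arrival N n \<omega>) \<le> u} = {}" by auto
    show ?thesis unfolding e by (rule sets.empty_sets)
  next
    case True
    have "{\<omega>\<in>space M. N u \<omega> = enat k} \<in> sets ?S" for k
    proof -
      have "{\<omega>\<in>space M. N u \<omega> = enat k} = {\<omega>\<in>space M. \<forall>r\<in>{u}. N r \<omega> = enat k}" by auto
      also have "\<dots> \<in> future_cylinders M N t" unfolding future_cylinders_def using True
        by (intro insertI2 CollectI exI[of _ "{u}"] exI[of _ "\<lambda>_. k"]) auto
      finally show ?thesis using sub by auto
    qed
    then have "(\<Union>k<n. {\<omega>\<in>space M. N u \<omega> = enat k}) \<in> sets ?S" by auto
    then have "space ?S - (\<Union>k<n. {\<omega>\<in>space M. N u \<omega> = enat k}) \<in> sets ?S" by (rule sets.compl_sets)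
    also have "space ?S - (\<Union>k<n. {\<omega>\<in>space M. N u \<omega> = enat k}) = {\<omega>\<in>space ?S. max t (arrival N n \<omega>) \<le> u}"
    proof -
      have "arrival N n \<omega> \<le> u \<longleftrightarrow> (\<forall>k<n. N u \<omega> \<noteq> enat k)" if "\<omega> \<in> space M" for \<omega>
      proof -
        have "(\<forall>k<n. j \<noteq> k) \<longleftrightarrow> n \<le> j" for j
          by (auto simp: not_less[symmetric])
        then show ?thesis
          using arrival_le_iff[OF N that, of u n] t True by (cases "N u \<omega>") simp_all
      qed
      then show ?thesis using True sub by auto
    qed
    finally show ?thesis .
  qed
qed

section \<open>The Markov property on events of the first four gaps\<close>

definition first_two :: "real \<Rightarrow> real \<Rightarrow> real \<Rightarrow> real stream \<Rightarrow> bool" where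
  "first_two a t u w \<longleftrightarrow> a < w !! 0 \<and> w !! 0 \<le> t \<and> u < w !! 0 + w !! 1"

lemma interarrival_stream_snth: "interarrival_stream N 0 \<omega> !! i = interarrival N (Suc i) \<omega>"
  by (simp add: interarrival_stream_def to_stream_def)

lemma first_two_interarrival_iff:
  assumes N: "counting_process M N" "\<omega> \<in> space M" and "0 \<le> a" "a < t" "t \<le> u"
  shows "first_two a t u (interarrival_stream N 0 \<omega>)
    \<longleftrightarrow> N a \<omega> = enat 0 \<and> N t \<omega> = enat 1 \<and> u < arrival N 2 \<omega>"
proof -
  have "arrival N 0 \<omega> = 0" by (simp add: arrival_def)
  then show ?thesis
    using counting_process_eq_iff[OF N, of a 0] counting_process_eq_iff[OF N, of t 1] assms
    unfolding first_two_def interarrival_stream_snth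
    by (auto simp: interarrival_def numeral_2_eq_2)
qed

lemma first_two_sdrop_iff:
  "first_two c t u (sdrop 2 (interarrival_stream N 0 \<omega>))
    \<longleftrightarrow> c < arrival N 3 \<omega> - arrival N 2 \<omega> \<and> arrival N 3 \<omega> - arrival N 2 \<omega> \<le> t
      \<and> u < arrival N 4 \<omega> - arrival N 2 \<omega>"
  by (simp add: first_two_def sdrop_snth interarrival_stream_snth interarrival_def numeral_eq_Suc
      del: snth.simps sdrop.simps)

text \<open>On \<open>N t = 1\<close> the arrivals 2, 3 and 4 come after \<open>t\<close>, so
  conditions on the second arrival and on the third and fourth gaps belong to the future. The
  right-hand side has lower bound 0 in place of \<open>a\<close>, because \<open>N 0 = 0\<close> is
  no restriction on the past.\<close>

lemma markov_first_two:
  assumes M: "prob_space M" and N: "counting_process M N" and markov: "markov_property M N"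
    and a: "0 < a" "a < t" and u: "t \<le> u"
  shows "measure M {\<omega>\<in>space M. first_two a t u (interarrival_stream N 0 \<omega>) \<and> first_two c t u (sdrop 2 (interarrival_stream N 0 \<omega>))}
      * measure M {\<omega>\<in>space M. N t \<omega> = enat 1}
    = measure M {\<omega>\<in>space M. N a \<omega> = enat 0 \<and> N t \<omega> = enat 1}
      * measure M {\<omega>\<in>space M. first_two 0 t u (interarrival_stream N 0 \<omega>) \<and> first_two c t u (sdrop 2 (interarrival_stream N 0 \<omega>))}"
proof -
  let ?S = "sigma (space M) (future_cylinders M N t)"
  let ?T = "\<lambda>n \<omega>. max t (arrival N n \<omega>)"
  have sub: "future_cylinders M N t \<subseteq> Pow (space M)" by (auto simp: future_cylinders_def)
  \<comment> \<open>Truncated arrival times make this an event of the future; on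
    \<open>N t = 1\<close> the truncation has no effect.\<close>
  define E where "E = {\<omega>\<in>space ?S. u < ?T 2 \<omega> \<and> c < ?T 3 \<omega> - ?T 2 \<omega> \<and> ?T 3 \<omega> - ?T 2 \<omega> \<le> t \<and> u < ?T 4 \<omega> - ?T 2 \<omega>}"
  have [measurable]: "?T n \<in> borel_measurable ?S" for n
    by (rule measurable_max_arrival[OF N]) (use a in simp)
  have "E \<in> sets ?S" unfolding E_def by measurable
  then have E: "E \<in> sigma_sets (space M) (future_cylinders M N t)" using sub by simp
  have T: "?T 2 \<omega> = arrival N 2 \<omega>" "?T 3 \<omega> = arrival N 3 \<omega>" "?T 4 \<omega> = arrival N 4 \<omega>"
    if "\<omega> \<in> space M" "N t \<omega> = enat 1" for \<omega>
  proof -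
    have "t < arrival N 2 \<omega>"
      using counting_process_eq_iff[OF N that(1), of t 1] that(2) a by (simp add: numeral_2_eq_2)
    moreover have "arrival N 2 \<omega> < arrival N 3 \<omega>" "arrival N 3 \<omega> < arrival N 4 \<omega>"
      using arrival_less_Suc[OF N that(1), of 2] arrival_less_Suc[OF N that(1), of 3] by simp_all
    ultimately show "?T 2 \<omega> = arrival N 2 \<omega>" "?T 3 \<omega> = arrival N 3 \<omega>" "?T 4 \<omega> = arrival N 4 \<omega>" by auto
  qed
  have N0: "N 0 \<omega> = enat 0" if "\<omega> \<in> space M" for \<omega>
    using counting_process_path(1)[OF N that] by (simp add: zero_enat_def)
  have eq: "{\<omega>\<in>space M. first_two b t u (interarrival_stream N 0 \<omega>) \<and> first_two c t u (sdrop 2 (interarrival_stream N 0 \<omega>))}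
      = {\<omega>\<in>space M. N b \<omega> = enat 0 \<and> N t \<omega> = enat 1} \<inter> E" if b: "0 \<le> b" "b < t" for b
    using first_two_interarrival_iff[OF N _ b u] T sub
    by (auto simp: E_def first_two_sdrop_iff)
  have "{\<omega>\<in>space M. N 0 \<omega> = enat 0 \<and> N t \<omega> = enat 1} = {\<omega>\<in>space M. N t \<omega> = enat 1}"
    using N0 by auto
  then show ?thesis
    using markov_future[OF M N markov a E, of 0 1] eq[of a] eq[of 0] a by simp
qed

section \<open>Recognising the exponential law\<close>

lemma sets_first_two [measurable]: "{w. first_two a t u w} \<in> sets (stream_space borel)"
proof -
  have "{w \<in> space (stream_space borel). first_two a t u w} \<in> sets (stream_space borel)"
    unfolding first_two_def by measurable
  then show ?thesis by (simp add: space_stream_space)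
qed

locale iid_stream = prob_space \<mu> for \<mu> :: "real measure" +
  assumes sets_\<mu>: "sets \<mu> = sets borel"
begin

sublocale S: prob_space "stream_space \<mu>"
  by (rule prob_space_stream_space)

lemma sets_S: "sets (stream_space \<mu>) = sets (stream_space borel)"
  by (rule sets_stream_space_cong[OF sets_\<mu>])

lemma space_S: "space (stream_space \<mu>) = UNIV"
  using sets_eq_imp_space_eq[OF sets_\<mu>] by (simp add: space_stream_space)

lemma emeasure_first_two_Int_sdrop:
  assumes E: "{w. P w} \<in> sets (stream_space borel)"
  shows "emeasure (stream_space \<mu>) {w. first_two a t u w \<and> P (sdrop 2 w)}
    = emeasure (stream_space \<mu>) {w. first_two a t u w} * emeasure (stream_space \<mu>) {w. P w}"
proof -
  note eq = emeasure_stream_space_UNIV[OF prob_space_axioms sets_\<mu>]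
  have [measurable]: "Measurable.pred (stream_space borel) P"
    using E by (simp add: pred_def space_stream_space)
  have pair: "{w. first_two a t u (x ## w) \<and> P (sdrop 2 (x ## w))} \<in> sets (stream_space borel)"
    if [measurable]: "Measurable.pred (stream_space borel) P" for x P
  proof -
    have "{w \<in> space (stream_space borel). first_two a t u (x ## w) \<and> P (sdrop 2 (x ## w))} \<in> sets (stream_space borel)"
      unfolding first_two_def by measurable
    then show ?thesis by (simp add: space_stream_space)
  qed
  have full: "{w. first_two a t u w \<and> P (sdrop 2 w)} \<in> sets (stream_space borel)"
    if [measurable]: "Measurable.pred (stream_space borel) P" for P
  proof -
    have "{w \<in> space (stream_space borel). first_two a t u w \<and> P (sdrop 2 w)} \<in> sets (stream_space borel)"
      unfolding first_two_def by measurable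
    then show ?thesis by (simp add: space_stream_space)
  qed
  let ?I = "\<lambda>x y. a < x \<and> x \<le> t \<and> u < x + y"
  have gen: "emeasure (stream_space \<mu>) {w. first_two a t u w \<and> P (sdrop 2 w)}
      = (\<integral>\<^sup>+x. (\<integral>\<^sup>+y. indicator {y. ?I x y} y \<partial>\<mu>) \<partial>\<mu>) * emeasure (stream_space \<mu>) {w. P w}"
    if P [measurable]: "Measurable.pred (stream_space borel) P" for P
  proof -
    have "emeasure (stream_space \<mu>) {w. first_two a t u w \<and> P (sdrop 2 w)}
        = (\<integral>\<^sup>+x. (\<integral>\<^sup>+y. emeasure (stream_space \<mu>) {w. first_two a t u (x ## y ## w) \<and> P (sdrop 2 (x ## y ## w))} \<partial>\<mu>) \<partial>\<mu>)"
      by (subst eq[OF full[OF P]], intro nn_integral_cong, subst eq[OF pair[OF P]]) simp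
    also have "\<dots> = (\<integral>\<^sup>+x. (\<integral>\<^sup>+y. indicator {y. ?I x y} y * emeasure (stream_space \<mu>) {w. P w} \<partial>\<mu>) \<partial>\<mu>)"
      by (intro nn_integral_cong) (auto simp: first_two_def numeral_2_eq_2 split: split_indicator)
    also have "\<dots> = (\<integral>\<^sup>+x. (\<integral>\<^sup>+y. indicator {y. ?I x y} y \<partial>\<mu>) * emeasure (stream_space \<mu>) {w. P w} \<partial>\<mu>)"
      by (intro nn_integral_cong nn_integral_multc)
        (simp add: measurable_cong_sets[OF sets_\<mu> refl])
    also have "\<dots> = (\<integral>\<^sup>+x. (\<integral>\<^sup>+y. indicator {y. ?I x y} y \<partial>\<mu>) \<partial>\<mu>) * emeasure (stream_space \<mu>) {w. P w}"
    proof (rule nn_integral_multc)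
      have "(\<lambda>(x, y). indicator {y. ?I x y} y :: ennreal) \<in> borel_measurable (borel \<Otimes>\<^sub>M borel)"
        unfolding indicator_def split_beta' mem_Collect_eq by measurable
      then have "(\<lambda>(x, y). indicator {y. ?I x y} y :: ennreal) \<in> borel_measurable (borel \<Otimes>\<^sub>M \<mu>)"
        by (subst measurable_cong_sets[OF sets_pair_measure_cong[OF refl sets_\<mu>] refl])
      then have "(\<lambda>x. \<integral>\<^sup>+y. indicator {y. ?I x y} y \<partial>\<mu>) \<in> borel_measurable borel"
        by (rule borel_measurable_nn_integral)
      then show "(\<lambda>x. \<integral>\<^sup>+y. indicator {y. ?I x y} y \<partial>\<mu>) \<in> borel_measurable \<mu>"
        by (subst measurable_cong_sets[OF sets_\<mu> refl])
    qed
    finally show ?thesis .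
  qed
  \<comment> \<open>The instance of \<open>gen\<close> with the trivial predicate identifies the
    double integral as the probability of \<open>first_two\<close>.\<close>
  have "emeasure (stream_space \<mu>) {w. True} = 1" using S.emeasure_space_1 by (simp add: space_S)
  with gen[of "\<lambda>_. True"] have "emeasure (stream_space \<mu>) {w. first_two a t u w}
      = (\<integral>\<^sup>+x. (\<integral>\<^sup>+y. indicator {y. ?I x y} y \<partial>\<mu>) \<partial>\<mu>)" by simp
  then show ?thesis using gen[of P] by simp
qed

lemma measure_rectangle:
  assumes "A \<in> sets borel" "B \<in> sets borel"
  shows "{w. w !! 0 \<in> A \<and> w !! 1 \<in> B} \<in> sets (stream_space borel)"
    "measure (stream_space \<mu>) {w. w !! 0 \<in> A \<and> w !! 1 \<in> B} = measure \<mu> A * measure \<mu> B"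
proof -
  let ?B = "\<lambda>i::nat. if i = 0 then A else B"
  have eq: "{w. w !! 0 \<in> A \<and> w !! 1 \<in> B} = {w. \<forall>i<2. w !! i \<in> ?B i}"
    by (auto simp: less_2_cases_iff)
  show "{w. w !! 0 \<in> A \<and> w !! 1 \<in> B} \<in> sets (stream_space borel)"
    unfolding eq by (rule sets_stream_cylinder) (use assms in auto)
  have "emeasure (stream_space \<mu>) {w. w !! 0 \<in> A \<and> w !! 1 \<in> B} = (\<Prod>i<2. emeasure \<mu> (?B i))"
    unfolding eq by (rule emeasure_stream_cylinder[OF prob_space_axioms sets_\<mu>]) (use assms in auto)
  then show "measure (stream_space \<mu>) {w. w !! 0 \<in> A \<and> w !! 1 \<in> B} = measure \<mu> A * measure \<mu> B"
    by (simp add: measure_def numeral_2_eq_2 enn2real_mult)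
qed

section \<open>The tail of a gap and its functional equation\<close>

definition tail :: "real \<Rightarrow> real" where
  "tail x = measure \<mu> {x<..}"

definition \<phi> :: "real \<Rightarrow> real \<Rightarrow> real \<Rightarrow> real" where
  "\<phi> a t u = measure (stream_space \<mu>) {w. first_two a t u w}"

lemma borel_sets: "A \<in> sets borel \<Longrightarrow> A \<in> sets \<mu>"
  by (simp add: sets_\<mu>)

lemma tail_eq: "tail x = 1 - measure \<mu> {..x}"
proof -
  have "{x<..} = space \<mu> - {..x}" using sets_eq_imp_space_eq[OF sets_\<mu>] by auto
  then show ?thesis unfolding tail_def using prob_compl[of "{..x}"] borel_sets by simp
qed

lemma measure_Ioc: "a \<le> b \<Longrightarrow> measure \<mu> {a<..b} = tail a - tail b"
proof -
  assume "a \<le> b"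
  then have "{a<..b} = {a<..} - {b<..}" "{b<..} \<subseteq> {a<..}" by auto
  then show ?thesis unfolding tail_def by (simp add: finite_measure_Diff borel_sets)
qed

text \<open>The difference is the probability that W_1 lies in \<open>{a<..b}\<close> and W_1 + W_2
  exceeds \<open>u\<close>. This event contains the rectangle with W_2 > u - a and is contained in
  the one with W_2 > u - b. As \<open>b\<close> approaches \<open>a\<close>, the two bounds act as a
  derivative in \<open>a\<close>.\<close>

lemma \<phi>_diff:
  assumes "a \<le> b" "b \<le> t"
  shows "(tail a - tail b) * tail (u - a) \<le> \<phi> a t u - \<phi> b t u"
    and "\<phi> a t u - \<phi> b t u \<le> (tail a - tail b) * tail (u - b)"
proof -
  let ?D = "{w. first_two a t u w} - {w. first_two b t u w}"
  have sub: "{w. first_two b t u w} \<subseteq> {w. first_two a t u w}"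
    using assms by (auto simp: first_two_def)
  have D: "?D \<in> sets (stream_space \<mu>)" unfolding sets_S by measurable
  have eq: "\<phi> a t u - \<phi> b t u = measure (stream_space \<mu>) ?D"
    unfolding \<phi>_def using sub by (intro S.finite_measure_Diff[symmetric]) (auto simp: sets_S)
  have r: "measure (stream_space \<mu>) {w. w !! 0 \<in> {a<..b} \<and> w !! 1 \<in> {c<..}} = (tail a - tail b) * tail c" for c
    using measure_rectangle(2)[of "{a<..b}" "{c<..}"] measure_Ioc[OF assms(1)] by (simp add: tail_def)
  have s: "{w. w !! 0 \<in> {a<..b} \<and> w !! 1 \<in> {c<..}} \<in> sets (stream_space \<mu>)" for c
    unfolding sets_S by (rule measure_rectangle(1)) auto
  show "(tail a - tail b) * tail (u - a) \<le> \<phi> a t u - \<phi> b t u"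
    unfolding eq r[symmetric] using assms
    by (intro S.finite_measure_mono D) (auto simp: first_two_def simp del: snth.simps)
  show "\<phi> a t u - \<phi> b t u \<le> (tail a - tail b) * tail (u - b)"
    unfolding eq r[symmetric] using assms
    by (intro S.finite_measure_mono s) (auto simp: first_two_def simp del: snth.simps)
qed

lemma \<phi>_self [simp]: "\<phi> t t u = 0"
proof -
  have "{w. first_two t t u w} = {}" by (auto simp: first_two_def)
  then show ?thesis by (simp only: \<phi>_def measure_empty)
qed

lemma tail_mono: "x \<le> y \<Longrightarrow> tail y \<le> tail x"
  unfolding tail_def by (intro finite_measure_mono borel_sets) auto

lemma \<phi>_pos:
  assumes strict: "\<And>x y. 0 < x \<Longrightarrow> x < y \<Longrightarrow> tail y < tail x" and t: "0 < t"
  shows "0 < \<phi> 0 t t"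
proof -
  have "0 < tail t"
    by (rule le_less_trans[OF _ strict[of t "t + 1"]]) (use t in \<open>simp_all add: tail_def\<close>)
  \<comment> \<open>Strict decrease is assumed at positive arguments only, so the comparison with 0
    goes through \<open>t / 2\<close>.\<close>
  moreover have "tail t < tail 0"
    using strict[of "t / 2" t] tail_mono[of 0 "t / 2"] t by simp
  ultimately have "0 < (tail 0 - tail t) * tail (t - 0)" by simp
  also have "\<dots> \<le> \<phi> 0 t t" using \<phi>_diff(1)[of 0 t t t] t by simp
  finally show ?thesis .
qed

text \<open>By \<open>ratio\<close>, the quotient of \<open>\<phi> a t u\<close> and
  \<open>\<phi> a t t\<close> does not depend on \<open>a\<close>. The limit \<open>a -> t\<close>
  evaluates it as \<open>tail (u - t)\<close>, and comparing increments in \<open>a\<close> over a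
  short window then yields the product formula.\<close>

lemma tail_multiplicative:
  assumes cont: "\<And>x. 0 < x \<Longrightarrow> isCont tail x" and tail0: "tail 0 = 1"
    and strict: "\<And>x y. 0 < x \<Longrightarrow> x < y \<Longrightarrow> tail y < tail x"
    and ratio: "\<And>a t u. a \<in> \<rat> \<Longrightarrow> t \<in> \<rat> \<Longrightarrow> u \<in> \<rat> \<Longrightarrow> 0 < a \<Longrightarrow> a < t \<Longrightarrow> t \<le> u \<Longrightarrow>
      \<phi> a t u * \<phi> 0 t t = \<phi> a t t * \<phi> 0 t u"
    and xy: "x \<in> \<rat>" "y \<in> \<rat>" "0 < x" "0 < y"
  shows "tail (x + y) = tail x * tail y"
proof -
  \<comment> \<open>Continuity is assumed at positive points only, but the limit is also needed at
    0; there continuity of the measure along increasing sets provides it.\<close>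
  have lim: "(\<lambda>n. tail (z + 1 / real (Suc n))) \<longlonglongrightarrow> tail z" for z
  proof (cases "z \<le> 0")
    case False
    have "(\<lambda>n. z + 1 / real (Suc n)) \<longlonglongrightarrow> z + 0"
      by (intro tendsto_intros LIMSEQ_Suc[OF lim_1_over_n])
    then show ?thesis using isCont_tendsto_compose[OF cont[of z]] False by simp
  next
    case True
    have eq: "(\<Union>n. {z + 1 / real (Suc n)<..}) = {z<..}"
    proof (intro equalityI subsetI)
      fix v assume "v \<in> {z<..}"
      then obtain n where "1 / real (Suc n) < v - z"
        using nat_approx_posE[of "v - z"] by auto
      then show "v \<in> (\<Union>n. {z + 1 / real (Suc n)<..})" by (auto intro!: exI[of _ n])
    qed (auto intro: less_trans[rotated] simp: add_pos_pos less_add_same_cancel1)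
    have "(\<lambda>n. measure \<mu> {z + 1 / real (Suc n)<..}) \<longlonglongrightarrow> measure \<mu> (\<Union>n. {z + 1 / real (Suc n)<..})"
    proof (rule finite_Lim_measure_incseq)
      show "range (\<lambda>n. {z + 1 / real (Suc n)<..}) \<subseteq> sets \<mu>" using borel_sets by auto
      show "incseq (\<lambda>n. {z + 1 / real (Suc n)<..})"
      proof (rule incseq_SucI, rule subsetI)
        fix n v assume v: "v \<in> {z + 1 / real (Suc n)<..}"
        have "1 / real (Suc (Suc n)) \<le> 1 / real (Suc n)" by (intro divide_left_mono) auto
        then show "v \<in> {z + 1 / real (Suc (Suc n))<..}" using v by simp
      qed
    qed
    then show ?thesis unfolding eq tail_def .
  qed
  \<comment> \<open>Letting \<open>a \<rightarrow> t\<close> identifies \<open>\<phi> 0 t u\<close>.\<close>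
  have \<phi>0: "\<phi> 0 t u = tail (u - t) * \<phi> 0 t t"
    and \<phi>0_pos: "0 < \<phi> 0 t t" if tu: "t \<in> \<rat>" "u \<in> \<rat>" "0 < t" "t < u" for t u
  proof -
    show pos: "0 < \<phi> 0 t t" by (rule \<phi>_pos[OF strict tu(3)])
    have bounds: "tail (u - t + 1 / real (Suc n)) * \<phi> 0 t t \<le> \<phi> 0 t u
        \<and> tail (1 / real (Suc n)) * \<phi> 0 t u \<le> tail (u - t) * \<phi> 0 t t" for n
    proof -
      \<comment> \<open>A rational point within \<open>1 / real (Suc n)\<close> of \<open>t\<close>;
        the maximum with \<open>t / 2\<close> keeps it positive.\<close>
      define a where "a = max (t - 1 / real (Suc n)) (t / 2)"
      have a: "a \<in> \<rat>" "0 < a" "a < t" "t - a \<le> 1 / real (Suc n)"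
        using tu by (auto simp: a_def max_def)
      \<comment> \<open>The probability that W_1 lies in \<open>{a<..t}\<close>. It bounds
        \<open>\<phi> a t u\<close> and \<open>\<phi> a t t\<close> from both sides and cancels from
        \<open>R\<close>.\<close>
      let ?c = "tail a - tail t"
      have c: "0 < ?c" using strict[of a t] a by simp
      have \<phi>: "\<phi> a t v \<ge> ?c * tail (v - a)" "\<phi> a t v \<le> ?c * tail (v - t)" for v
        using \<phi>_diff[of a t t v] a by simp_all
      have R: "\<phi> a t u * \<phi> 0 t t = \<phi> a t t * \<phi> 0 t u" using ratio[of a t u] a tu by simp
      have nn: "0 \<le> \<phi> 0 t u" by (simp add: \<phi>_def)
      have "?c * (tail (u - a) * \<phi> 0 t t) \<le> \<phi> a t u * \<phi> 0 t t"
        using \<phi>(1)[of u] pos by (simp add: mult.assoc[symmetric])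
      also have "\<dots> \<le> ?c * tail (t - t) * \<phi> 0 t u"
        unfolding R by (intro mult_right_mono \<phi>(2) nn)
      finally have "tail (u - a) * \<phi> 0 t t \<le> \<phi> 0 t u" using c by (simp add: tail0)
      moreover have "tail (u - t + 1 / real (Suc n)) \<le> tail (u - a)" using a by (intro tail_mono) simp
      ultimately have 1: "tail (u - t + 1 / real (Suc n)) * \<phi> 0 t t \<le> \<phi> 0 t u"
        using pos by (meson mult_right_mono order_trans less_imp_le)
      have "?c * (tail (t - a) * \<phi> 0 t u) \<le> \<phi> a t t * \<phi> 0 t u"
        using \<phi>(1)[of t] nn by (simp add: mult.assoc[symmetric] mult_right_mono)
      also have "\<dots> \<le> ?c * tail (u - t) * \<phi> 0 t t"
        unfolding R[symmetric] using pos by (intro mult_right_mono \<phi>(2)) simp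
      finally have "tail (t - a) * \<phi> 0 t u \<le> tail (u - t) * \<phi> 0 t t" using c by simp
      moreover have "tail (1 / real (Suc n)) \<le> tail (t - a)" using a by (intro tail_mono) simp
      ultimately have "tail (1 / real (Suc n)) * \<phi> 0 t u \<le> tail (u - t) * \<phi> 0 t t"
        using nn by (meson mult_right_mono order_trans)
      with 1 show ?thesis by blast
    qed
    show "\<phi> 0 t u = tail (u - t) * \<phi> 0 t t"
    proof (rule antisym)
      have "(\<lambda>n. tail (u - t + 1 / real (Suc n)) * \<phi> 0 t t) \<longlonglongrightarrow> tail (u - t) * \<phi> 0 t t"
        by (intro tendsto_intros lim)
      then show "tail (u - t) * \<phi> 0 t t \<le> \<phi> 0 t u"
        by (rule LIMSEQ_le_const2) (use bounds in blast)
      have "(\<lambda>n. tail (0 + 1 / real (Suc n)) * \<phi> 0 t u) \<longlonglongrightarrow> tail 0 * \<phi> 0 t u"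
        by (intro tendsto_intros lim)
      then have "(\<lambda>n. tail (1 / real (Suc n)) * \<phi> 0 t u) \<longlonglongrightarrow> \<phi> 0 t u"
        by (simp add: tail0)
      then show "\<phi> 0 t u \<le> tail (u - t) * \<phi> 0 t t"
        by (rule LIMSEQ_le_const2) (use bounds in blast)
    qed
  qed
  have \<phi>a: "\<phi> a t u = tail (u - t) * \<phi> a t t"
    if "a \<in> \<rat>" "t \<in> \<rat>" "u \<in> \<rat>" "0 < a" "a < t" "t < u" for a t u
  proof -
    have "\<phi> a t u * \<phi> 0 t t = \<phi> a t t * \<phi> 0 t u" using ratio[of a t u] that by simp
    then show ?thesis using \<phi>0[of t u] \<phi>0_pos[of t u] that by simp
  qed
  \<comment> \<open>The first arrival is now confined to \<open>(1, 1 + \<epsilon>]\<close> with \<open>\<epsilon> \<rightarrow> 0\<close>.\<close>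
  have bounds: "tail (x + y + \<epsilon>) \<le> tail y * tail x \<and> tail y * tail (x + \<epsilon>) \<le> tail (x + y)"
    if \<epsilon>: "\<epsilon> \<in> \<rat>" "0 < \<epsilon>" for \<epsilon>
  proof -
    \<comment> \<open>For W_1 in the window from 1 to \<open>1 + \<epsilon>\<close>, the time left
      until \<open>?t\<close> is between \<open>x\<close> and \<open>x + \<epsilon>\<close>, the
      time left until \<open>?u\<close> is between \<open>x + y\<close> and
      \<open>x + y + \<epsilon>\<close>, and \<open>?u - ?t = y\<close>. The base point 1 only has
      to be rational and positive.\<close>
    let ?t = "1 + x + \<epsilon>" and ?u = "1 + x + y + \<epsilon>"
    have eq: "\<phi> 1 ?t ?u - \<phi> (1 + \<epsilon>) ?t ?u = tail y * (\<phi> 1 ?t ?t - \<phi> (1 + \<epsilon>) ?t ?t)"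
      using \<phi>a[of 1 ?t ?u] \<phi>a[of "1 + \<epsilon>" ?t ?u] xy \<epsilon> by (simp add: algebra_simps)
    let ?c = "tail 1 - tail (1 + \<epsilon>)"
    have c: "0 < ?c" using strict[of 1 "1 + \<epsilon>"] \<epsilon> by simp
    have y: "0 \<le> tail y" by (simp add: tail_def)
    have "?c * tail (x + y + \<epsilon>) \<le> tail y * (\<phi> 1 ?t ?t - \<phi> (1 + \<epsilon>) ?t ?t)"
      using \<phi>_diff(1)[of 1 "1 + \<epsilon>" ?t ?u] xy \<epsilon> eq by (simp add: algebra_simps)
    also have "\<dots> \<le> tail y * (?c * tail x)"
      using \<phi>_diff(2)[of 1 "1 + \<epsilon>" ?t ?t] xy \<epsilon> y by (intro mult_left_mono) simp_all
    finally have 1: "tail (x + y + \<epsilon>) \<le> tail y * tail x" using c by (simp add: mult.left_commute)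
    have "?c * (tail y * tail (x + \<epsilon>)) = tail y * (?c * tail (x + \<epsilon>))" by (rule mult.left_commute)
    also have "\<dots> \<le> tail y * (\<phi> 1 ?t ?t - \<phi> (1 + \<epsilon>) ?t ?t)"
      using \<phi>_diff(1)[of 1 "1 + \<epsilon>" ?t ?t] xy \<epsilon> y by (intro mult_left_mono) simp_all
    also have "\<dots> \<le> ?c * tail (x + y)"
      using \<phi>_diff(2)[of 1 "1 + \<epsilon>" ?t ?u] xy \<epsilon> eq by (simp add: algebra_simps)
    finally show ?thesis using 1 c by simp
  qed
  show ?thesis
  proof (rule antisym)
    show "tail (x + y) \<le> tail x * tail y"
      by (rule LIMSEQ_le_const2[OF lim]) (use bounds in \<open>auto simp: mult.commute\<close>)
    have "(\<lambda>n. tail y * tail (x + 1 / real (Suc n))) \<longlonglongrightarrow> tail y * tail x"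
      by (intro tendsto_intros lim)
    then show "tail x * tail y \<le> tail (x + y)"
      unfolding mult.commute[of "tail x"] by (rule LIMSEQ_le_const2) (use bounds in auto)
  qed
qed

text \<open>Cauchy's functional equation: on positive rationals the tail is a power of
  \<open>tail 1\<close>, and continuity extends this to all positive reals. Strict decrease makes
  \<open>tail 1\<close> lie strictly between 0 and 1, so the rate is positive.\<close>

lemma tail_exponential:
  assumes cont: "\<And>x. 0 < x \<Longrightarrow> isCont tail x"
    and strict: "\<And>x y. 0 < x \<Longrightarrow> x < y \<Longrightarrow> tail y < tail x"
    and mult: "\<And>x y. x \<in> \<rat> \<Longrightarrow> y \<in> \<rat> \<Longrightarrow> 0 < x \<Longrightarrow> 0 < y \<Longrightarrow> tail (x + y) = tail x * tail y"
    and x: "0 < x"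
  shows "0 < - ln (tail 1)" "tail x = exp (ln (tail 1) * x)"
proof -
  have tail_pos: "0 < tail z" if "0 < z" for z
    by (rule le_less_trans[OF _ strict[of z "z + 1"]]) (use that in \<open>simp_all add: tail_def\<close>)
  have "tail 1 < tail (1 / 2)" by (rule strict) auto
  also have "\<dots> \<le> 1" by (simp add: tail_def)
  finally show "0 < - ln (tail 1)" using tail_pos[of 1] by simp
  have pow: "tail (real (Suc n) * z) = tail z ^ Suc n" if "z \<in> \<rat>" "0 < z" for n z
  proof (induction n)
    case (Suc n)
    have "tail (real (Suc n) * z + z) = tail (real (Suc n) * z) * tail z"
      using that by (intro mult) auto
    then show ?case using Suc by (simp add: algebra_simps)
  qed simp
  have rat: "tail r = exp (ln (tail 1) * r)" if r: "r \<in> \<rat>" "0 < r" for r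
  proof -
    obtain m n where mn: "n \<noteq> 0" "\<bar>r\<bar> = real m / real n" using Rats_abs_nat_div_natE[OF r(1)] by metis
    then have "m \<noteq> 0" using r(2) by (intro notI) simp
    then obtain m' n' where m'n': "m = Suc m'" "n = Suc n'" using mn(1) by (metis not0_implies_Suc)
    define z where "z = 1 / real n"
    have z: "z \<in> \<rat>" "0 < z" using mn(1) by (auto simp: z_def)
    have "tail 1 = tail z ^ n"
      using pow[OF z, of n'] mn(1) by (simp add: m'n' z_def del: power_Suc of_nat_Suc)
    then have "ln (tail z) = ln (tail 1) / real n"
      using tail_pos[OF z(2)] mn(1) by (simp add: ln_realpow)
    then have "tail z = exp (ln (tail 1) / real n)" using tail_pos[OF z(2)] by (metis exp_ln)
    moreover have "tail r = tail z ^ m"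
      using pow[OF z, of m'] mn(2) r(2) by (simp add: m'n'(1) z_def del: power_Suc of_nat_Suc)
    ultimately show ?thesis
      using mn r by (simp add: exp_of_nat_mult[symmetric] field_simps)
  qed
  show "tail x = exp (ln (tail 1) * x)"
  proof (rule ccontr)
    assume "tail x \<noteq> exp (ln (tail 1) * x)"
    then have "tail x - exp (ln (tail 1) * x) \<noteq> 0" by simp
    moreover have "isCont (\<lambda>x. tail x - exp (ln (tail 1) * x)) x"
      by (intro continuous_intros cont x)
    ultimately obtain e where e: "0 < e" "\<And>y. dist x y < e \<Longrightarrow> tail y - exp (ln (tail 1) * y) \<noteq> 0"
      using continuous_at_avoid by blast
    obtain r where "r \<in> \<rat>" "x < r" "r < x + e" using Rats_dense_in_real[of x "x + e"] e by auto
    then show False using e(2)[of r] rat[of r] x by (auto simp: dist_real_def)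
  qed
qed

lemma eq_expo:
  assumes l: "0 < l" and "tail 0 = 1" and tail: "\<And>x. 0 < x \<Longrightarrow> tail x = exp (- l * x)"
  shows "\<mu> = expo l"
proof (rule cdf_unique)
  show "real_distribution \<mu>"
    by (intro real_distribution.intro real_distribution_axioms.intro prob_space_axioms sets_\<mu>)
  interpret E: prob_space "expo l" using l by (rule prob_space_exponential_density)
  show "real_distribution (expo l)"
    by (intro real_distribution.intro real_distribution_axioms.intro E.prob_space_axioms) auto
  show "cdf \<mu> = cdf (expo l)"
  proof
    fix x
    have "cdf \<mu> x = 1 - tail x" by (simp add: cdf_def tail_eq)
    also have "\<dots> = erlang_CDF 0 l x"
    proof (cases "0 < x")
      case True then show ?thesis by (simp add: erlang_CDF_0 tail)
    next
      case False
      then have "1 \<le> tail x" using tail_mono[of x 0] assms(2) by simp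
      moreover have "tail x \<le> 1" by (simp add: tail_def)
      ultimately have "tail x = 1" by simp
      then show ?thesis using False by (auto simp: erlang_CDF_0)
    qed
    also have "\<dots> = cdf (expo l) x"
      using emeasure_erlang_density[OF l, of 0 x] l
      by (simp add: cdf_def measure_def erlang_CDF_0)
    finally show "cdf \<mu> x = cdf (expo l) x" .
  qed
qed

end

section \<open>Extended mixed renewal processes\<close>

context iid_stream
begin

text \<open>\<open>G\<close> stands for \<open>F (h \<theta>)\<close>, which is tied to the law of a
  gap on the nonnegative half-line only; derivatives are therefore transferred inside
  \<open>{0<..}\<close>.\<close>

context
  fixes G :: "real \<Rightarrow> real"
  assumes G: "\<And>x. 0 \<le> x \<Longrightarrow> tail x = 1 - G x" "G 0 = 0"
    and C1: "G C1_differentiable_on {0<..}" and pos: "\<And>x. 0 < x \<Longrightarrow> 0 < deriv G x"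
begin

lemma tail_deriv:
  assumes "0 < x"
  shows "(tail has_real_derivative - deriv G x) (at x)"
proof (rule has_field_derivative_transform_within_open)
  obtain G' where "(G has_vector_derivative G' x) (at x)"
    using C1 assms unfolding C1_differentiable_on_def by auto
  then have "(G has_real_derivative G' x) (at x)"
    by (simp add: has_real_derivative_iff_has_vector_derivative)
  then have "(G has_real_derivative deriv G x) (at x)" using DERIV_imp_deriv by metis
  then show "((\<lambda>x. 1 - G x) has_real_derivative - deriv G x) (at x)"
    by (auto intro!: derivative_eq_intros)
  show "open {0::real<..}" by simp
qed (use assms G in auto)

lemma tail_strict:
  assumes "0 < x" "x < y"
  shows "tail y < tail x"
proof (rule DERIV_neg_imp_decreasing[OF assms(2)])
  fix z assume "x \<le> z" "z \<le> y"
  then have "0 < z" using assms by simp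
  then show "\<exists>d. (tail has_real_derivative d) (at z) \<and> d < 0"
    using tail_deriv[of z] pos[of z] by auto
qed

lemma eq_expo_of_deriv:
  assumes p: "(deriv G \<longlongrightarrow> p) (at_right 0)"
    and ratio: "\<And>a t u. a \<in> \<rat> \<Longrightarrow> t \<in> \<rat> \<Longrightarrow> u \<in> \<rat> \<Longrightarrow> 0 < a \<Longrightarrow> a < t \<Longrightarrow> t \<le> u \<Longrightarrow>
      \<phi> a t u * \<phi> 0 t t = \<phi> a t t * \<phi> 0 t u"
  shows "\<mu> = expo p"
proof -
  have cont: "isCont tail x" if "0 < x" for x
    using DERIV_isCont[OF tail_deriv[OF that]] .
  note strict = tail_strict
  have tail0: "tail 0 = 1" using G by simp
  define l where "l = - ln (tail 1)"
  note mult = tail_multiplicative[OF cont tail0 strict ratio]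
  have l: "0 < l" unfolding l_def using tail_exponential(1)[OF cont strict mult, of 1] by simp
  have tail: "tail x = exp (- l * x)" if "0 < x" for x
    using tail_exponential(2)[OF cont strict mult that] by (simp add: l_def)
  have "deriv G x = l * exp (- l * x)" if "0 < x" for x
  proof (rule DERIV_imp_deriv)
    show "(G has_real_derivative l * exp (- l * x)) (at x)"
    proof (rule has_field_derivative_transform_within_open)
      show "((\<lambda>x. 1 - exp (- l * x)) has_real_derivative l * exp (- l * x)) (at x)"
        by (auto intro!: derivative_eq_intros)
      show "open {0::real<..}" by simp
      show "1 - exp (- l * z) = G z" if "z \<in> {0<..}" for z
        using tail[of z] G(1)[of z] that by simp
    qed (use that in auto)
  qed
  then have "eventually (\<lambda>x. deriv G x = l * exp (- l * x)) (at_right 0)"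
    by (intro eventually_at_right_less[THEN eventually_mono]) simp
  moreover have "((\<lambda>x. l * exp (- l * x)) \<longlongrightarrow> l * exp (- l * 0)) (at_right 0)"
    by (intro tendsto_intros)
  ultimately have "(deriv G \<longlongrightarrow> l) (at_right 0)"
    by (simp add: filterlim_cong)
  then have "p = l" using p tendsto_unique[of "at_right (0::real)"] by simp
  then show ?thesis using eq_expo[OF l tail0 tail] by simp
qed

end

end

section \<open>The gap sequence given the parameter, and its consequences\<close>

lemma measurable_kernel:
  fixes h :: "'a::topological_space \<Rightarrow> 'b::topological_space"
  assumes \<Theta>: "\<Theta> \<in> borel_measurable M" "\<Theta> ` space M \<subseteq> D"
    and h: "h \<in> borel_measurable (restrict_space borel D)"
    and K: "prob_family K" and B: "B \<in> sets borel"
  shows "(\<lambda>\<omega>. measure (K (h (\<Theta> \<omega>))) B) \<in> borel_measurable (gen_sigma M \<Theta>)"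
proof -
  have "\<Theta> \<in> gen_sigma M \<Theta> \<rightarrow>\<^sub>M restrict_space borel D"
    by (rule measurable_restrict_space2)
      (use \<Theta> measurable_gen_sigma[OF \<Theta>(1)] in \<open>auto simp: gen_sigma_def\<close>)
  from measurable_compose[OF this h] show ?thesis
    by (rule measurable_compose) (use K B in \<open>simp add: prob_family_def\<close>)
qed

text \<open>Given \<open>\<Theta>\<close>, the whole sequence of gaps is i.i.d. with law
  \<open>K (h (\<Theta> \<omega>))\<close>. The finite-dimensional identities come from conditional
  independence together with the common conditional law, and the mixture lemma extends them to all
  stream events.\<close>

lemma eMRP_iid_stream:
  fixes h :: "'a::topological_space \<Rightarrow> 'b::topological_space"
  assumes M: "prob_space M" and \<Theta>: "\<Theta> \<in> borel_measurable M" "\<Theta> ` space M \<subseteq> D"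
    and h: "h \<in> borel_measurable (restrict_space borel D)"
    and K: "prob_family K" and eMRP: "eMRP M K h \<Theta> N" and E: "E \<in> sets (stream_space borel)"
  shows "(\<lambda>\<omega>. emeasure (stream_space (K (h (\<Theta> \<omega>)))) E) \<in> borel_measurable (gen_sigma M \<Theta>) \<and>
    (\<forall>A\<in>sets (gen_sigma M \<Theta>). emeasure M (A \<inter> {\<omega>\<in>space M. interarrival_stream N 0 \<omega> \<in> E})
      = (\<integral>\<^sup>+\<omega>. indicator A \<omega> * emeasure (stream_space (K (h (\<Theta> \<omega>)))) E \<partial>M))"
proof -
  interpret prob_space M by fact
  let ?F = "gen_sigma M \<Theta>" and ?\<kappa> = "\<lambda>\<omega>. K (h (\<Theta> \<omega>))"
  have sub: "subalgebra M ?F" by (rule subalgebra_gen_sigma) fact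
  have \<kappa>: "prob_space (?\<kappa> \<omega>)" "sets (?\<kappa> \<omega>) = sets borel" for \<omega>
    using K by (auto simp: prob_family_def)
  note \<kappa>_meas = measurable_kernel[OF \<Theta> h K]
  have indep: "cond_indep_vars M ?F borel (interarrival N) {1..}"
    and dist: "\<And>n. 1 \<le> n \<Longrightarrow> has_cond_distribution M ?F borel (interarrival N n) ?\<kappa>"
    using eMRP by (auto simp: eMRP_def)
  have W [measurable]: "interarrival N (Suc i) \<in> borel_measurable M" for i
    using indep by (auto simp: cond_indep_vars_def)
  have cyl: "emeasure M (A \<inter> {\<omega>\<in>space M. \<forall>i<n. interarrival N (Suc i) \<omega> \<in> B i})
      = (\<integral>\<^sup>+\<omega>. indicator A \<omega> * (\<Prod>i<n. emeasure (?\<kappa> \<omega>) (B i)) \<partial>M)"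
    if A: "A \<in> sets ?F" and B: "\<And>i. B i \<in> sets borel" for A n and B :: "nat \<Rightarrow> real set"
  \<comment> \<open>Conditional independence is stated for nonempty index sets, so the empty
    cylinder is treated apart.\<close>
  proof (cases "n = 0")
    case True
    have "A \<in> sets M" using A sub by (auto simp: subalgebra_def)
    then show ?thesis using True sets.sets_into_space[of A M] by (simp add: Int_absorb2)
  next
    case False
    \<comment> \<open>Gaps are numbered from 1, stream coordinates from 0.\<close>
    let ?X = "\<lambda>j. interarrival N j -` B (j - 1) \<inter> space M"
    have eq: "(\<Inter>j\<in>{1..n}. ?X j) = {\<omega>\<in>space M. \<forall>i<n. interarrival N (Suc i) \<omega> \<in> B i}"
    proof (intro equalityI subsetI CollectI conjI allI impI)
      fix \<omega> assume \<omega>: "\<omega> \<in> (\<Inter>j\<in>{1..n}. ?X j)"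
      have "1 \<in> {1..n}" using False by auto
      then show "\<omega> \<in> space M" using \<omega> by blast
      fix i assume "i < n"
      then have "Suc i \<in> {1..n}" by auto
      then have "\<omega> \<in> ?X (Suc i)" using \<omega> by blast
      then show "interarrival N (Suc i) \<omega> \<in> B i" by simp
    next
      fix \<omega> assume \<omega>: "\<omega> \<in> {\<omega>\<in>space M. \<forall>i<n. interarrival N (Suc i) \<omega> \<in> B i}"
      show "\<omega> \<in> (\<Inter>j\<in>{1..n}. ?X j)"
      proof
        fix j assume "j \<in> {1..n}"
        then have "j - 1 < n" "Suc (j - 1) = j" by auto
        with \<omega> have "interarrival N (Suc (j - 1)) \<omega> \<in> B (j - 1)" by blast
        then show "\<omega> \<in> ?X j" using \<omega> \<open>Suc (j - 1) = j\<close> by simp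
      qed
    qed
    have "AE \<omega> in M. \<forall>j\<in>{1..n}. cond_probability M ?F (?X j) \<omega> = measure (?\<kappa> \<omega>) (B (j - 1))"
      using dist B by (intro AE_finite_allI has_cond_distribution_cond_probability[OF _ sub]) auto
    moreover have "AE \<omega> in M. cond_probability M ?F (\<Inter>j\<in>{1..n}. ?X j) \<omega> = (\<Prod>j\<in>{1..n}. cond_probability M ?F (?X j) \<omega>)"
    proof -
      have "{1..n} \<subseteq> {1..}" "{1..n} \<noteq> {}" "\<forall>j\<in>{1..n}. B (j - 1) \<in> sets borel" using False B by auto
      then show ?thesis using indep[unfolded cond_indep_vars_def, THEN conjunct2, rule_format, of "{1..n}" "\<lambda>j. B (j - 1)"] by simp
    qed
    ultimately have AE: "AE \<omega> in M. cond_probability M ?F (\<Inter>j\<in>{1..n}. ?X j) \<omega> = (\<Prod>i<n. measure (?\<kappa> \<omega>) (B i))"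
    proof eventually_elim
      case (elim \<omega>)
      have "(\<Prod>j\<in>{1..n}. measure (?\<kappa> \<omega>) (B (j - 1))) = (\<Prod>i<n. measure (?\<kappa> \<omega>) (B i))"
        by (rule prod.reindex_bij_witness[of _ Suc "\<lambda>j. j - 1"]) auto
      then show ?case using elim by simp
    qed
    have X: "(\<Inter>j\<in>{1..n}. ?X j) \<in> sets M"
    proof (rule sets.finite_INT)
      fix j assume "j \<in> {1..n}"
      then have "interarrival N j \<in> borel_measurable M" using W[of "j - 1"] by simp
      then show "?X j \<in> sets M" using B measurable_sets by blast
    qed (use False in auto)
    have "(\<lambda>\<omega>. \<Prod>i<n. measure (?\<kappa> \<omega>) (B i)) \<in> borel_measurable M"
      by (intro borel_measurable_prod measurable_from_subalg[OF sub] \<kappa>_meas B)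
    then have "emeasure M (A \<inter> (\<Inter>j\<in>{1..n}. ?X j)) = (\<integral>\<^sup>+\<omega>. indicator A \<omega> * ennreal (\<Prod>i<n. measure (?\<kappa> \<omega>) (B i)) \<partial>M)"
      by (rule emeasure_Int_cond_probability[OF sub X A AE])
        (intro prod_nonneg prod_le_1 ballI conjI measure_nonneg prob_space.prob_le_1 \<kappa>)+
    then show ?thesis
      unfolding eq by (simp add: prod_ennreal
          finite_measure.emeasure_eq_measure[OF prob_space.finite_measure[OF \<kappa>(1)]])
  qed
  show ?thesis
    unfolding interarrival_stream_def add_0
    by (rule mixture_of_iid_streams[where W = "\<lambda>i. interarrival N (Suc i)", OF M sub \<kappa> \<kappa>_meas W cyl E])
qed

text \<open>The gap law is known given \<open>\<Theta>\<close>, whereas the conclusion conditions on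
  \<open>\<Psi>\<close>. Since almost surely \<open>\<Psi>\<close> is a function of the kernel,
  every event of its sigma-algebra agrees up to a null set with one generated by
  \<open>\<Theta>\<close>. The integrand depends on the point through the rate alone, so the
  identity moves to the smaller conditioning.\<close>

lemma MPP_of_exponential:
  fixes h :: "'a::topological_space \<Rightarrow> 'b::topological_space"
  assumes M: "prob_space M" and \<Theta>: "\<Theta> \<in> borel_measurable M" "\<Theta> ` space M \<subseteq> D"
    and h: "h \<in> borel_measurable (restrict_space borel D)"
    and K: "prob_family K" and eMRP: "eMRP M K h \<Theta> N" and N: "counting_process M N"
    and \<Psi>: "\<Psi> \<in> borel_measurable M"
    and expo: "AE \<omega> in M. 0 < \<Psi> \<omega> \<and> K (h (\<Theta> \<omega>)) = expo (\<Psi> \<omega>)"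
  shows "MPP M N \<Psi>"
proof -
  interpret prob_space M by fact
  let ?G = "gen_sigma M \<Psi>" and ?F = "gen_sigma M \<Theta>" and ?\<kappa> = "\<lambda>\<omega>. K (h (\<Theta> \<omega>))"
  define \<psi> where "\<psi> \<omega> = (if 0 < \<Psi> \<omega> then \<Psi> \<omega> else 1)" for \<omega>
  \<comment> \<open>An exponential law of rate \<open>l\<close> gives \<open>{1<..}\<close> the mass
    \<open>exp (- l)\<close>; \<open>r\<close> recovers the rate from the kernel and is measurable
    with respect to \<open>\<Theta>\<close>.\<close>
  define r where "r \<omega> = - ln (measure (?\<kappa> \<omega>) {1<..})" for \<omega>
  have subG: "subalgebra M ?G" by (rule subalgebra_gen_sigma) fact
  have subF: "subalgebra M ?F" by (rule subalgebra_gen_sigma) fact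
  have [measurable]: "\<Psi> \<in> borel_measurable ?G" by (rule measurable_gen_sigma) fact
  have \<psi>: "\<psi> \<in> borel_measurable ?G" "\<And>\<omega>. 0 < \<psi> \<omega>" unfolding \<psi>_def[abs_def] by measurable
  have [measurable]: "(\<lambda>\<omega>. measure (?\<kappa> \<omega>) {1<..}) \<in> borel_measurable ?F"
    by (rule measurable_kernel[OF \<Theta> h K]) simp
  have r_meas [measurable]: "r \<in> borel_measurable ?F" unfolding r_def[abs_def] by measurable
  have r_expo: "r \<omega> = \<Psi> \<omega>" if "0 < \<Psi> \<omega>" "?\<kappa> \<omega> = expo (\<Psi> \<omega>)" for \<omega>
  proof -
    interpret E: prob_space "expo (\<Psi> \<omega>)" using that(1) by (rule prob_space_exponential_density)
    have "{1<..} = space (expo (\<Psi> \<omega>)) - {..1::real}" by auto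
    then have "measure (expo (\<Psi> \<omega>)) {1<..} = 1 - measure (expo (\<Psi> \<omega>)) {..1}"
      using E.prob_compl[of "{..1}"] by simp
    also have "measure (expo (\<Psi> \<omega>)) {..1} = 1 - exp (- \<Psi> \<omega>)"
      using emeasure_erlang_density[OF that(1), of 0 1] that(1) by (simp add: measure_def erlang_CDF_0)
    finally show ?thesis by (simp add: r_def that(2))
  qed
  interpret mixed_poisson_increments M ?G N \<psi>
  proof (unfold_locales; (rule subG N \<psi>)?)
    fix A m and t :: "nat \<Rightarrow> real" and k :: "nat \<Rightarrow> nat"
    assume A: "A \<in> sets ?G" and t: "t 0 = 0" "\<And>j. j < m \<Longrightarrow> t j < t (Suc j)"
    let ?L = "{w. counts (increments_spec m t k) w}"
    let ?X = "{\<omega>\<in>space M. \<forall>j\<in>{1..m}. increment N (t (j - 1)) (t j) \<omega> = enat (k j)}"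
    have X: "?X = {\<omega>\<in>space M. interarrival_stream N 0 \<omega> \<in> ?L}"
      using counts_iff_increments[OF N, of _ t m k] t by auto
    have "?X = {\<omega>\<in>space M. \<forall>j\<in>{1..m}. increment N (t (j - 1)) (t j) \<omega> \<in> {enat (k j)}}"
      by (simp only: singleton_iff)
    then have X_sets: "?X \<in> sets M" using sets_increments[OF N t, of m "\<lambda>j. {enat (k j)}"] by (simp only:)
    obtain B where B: "B \<in> sets borel" "A = \<Psi> -` B \<inter> space M"
      using A by (auto simp: gen_sigma_def sets_vimage_algebra2)
    define A0 where "A0 = r -` B \<inter> space M"
    have A0: "A0 \<in> sets ?F"
      using measurable_sets[OF r_meas B(1)] subF by (simp add: A0_def subalgebra_def)
    have AM: "A \<in> sets M" "A0 \<in> sets M" using A A0 subG subF by (auto simp: subalgebra_def)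
    have ind: "AE \<omega> in M. \<omega> \<in> A \<longleftrightarrow> \<omega> \<in> A0"
      using expo
    proof (rule AE_mp, intro AE_I2 impI)
      fix \<omega> assume "\<omega> \<in> space M" "0 < \<Psi> \<omega> \<and> ?\<kappa> \<omega> = expo (\<Psi> \<omega>)"
      then show "\<omega> \<in> A \<longleftrightarrow> \<omega> \<in> A0" using r_expo[of \<omega>] by (simp add: A0_def B(2))
    qed
    have "emeasure M (A \<inter> ?X) = emeasure M (A0 \<inter> ?X)"
    proof (rule emeasure_eq_AE)
      show "AE \<omega> in M. \<omega> \<in> A \<inter> ?X \<longleftrightarrow> \<omega> \<in> A0 \<inter> ?X" using ind by eventually_elim blast
    qed (intro sets.Int AM X_sets)+
    also have "\<dots> = (\<integral>\<^sup>+\<omega>. indicator A0 \<omega> * emeasure (stream_space (?\<kappa> \<omega>)) ?L \<partial>M)"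
      unfolding X using eMRP_iid_stream[OF M \<Theta> h K eMRP sets_counts] A0 by blast
    also have "\<dots> = (\<integral>\<^sup>+\<omega>. indicator A \<omega> * ennreal (\<Prod>j=1..m. pmf (poisson_pmf ((t j - t (j - 1)) * \<psi> \<omega>)) (k j)) \<partial>M)"
    proof (rule nn_integral_cong_AE)
      show "AE \<omega> in M. indicator A0 \<omega> * emeasure (stream_space (?\<kappa> \<omega>)) ?L
        = indicator A \<omega> * ennreal (\<Prod>j=1..m. pmf (poisson_pmf ((t j - t (j - 1)) * \<psi> \<omega>)) (k j))"
        using ind expo
      proof eventually_elim
        case (elim \<omega>)
        then have "\<psi> \<omega> = \<Psi> \<omega>" by (simp add: \<psi>_def)
        then have "emeasure (stream_space (?\<kappa> \<omega>)) ?L = ennreal (\<Prod>j=1..m. pmf (poisson_pmf ((t j - t (j - 1)) * \<psi> \<omega>)) (k j))"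
          using elim emeasure_counts_increments_spec[of "\<Psi> \<omega>" m t k] t(2) by metis
        moreover have "indicator A0 \<omega> = (indicator A \<omega> :: ennreal)" using elim by (simp add: indicator_def)
        ultimately show ?case by (simp only:)
      qed
    qed
    finally show "emeasure M (A \<inter> ?X)
      = (\<integral>\<^sup>+\<omega>. indicator A \<omega> * ennreal (\<Prod>j=1..m. pmf (poisson_pmf ((t j - t (j - 1)) * \<psi> \<omega>)) (k j)) \<partial>M)" .
  qed
  have pos: "AE \<omega> in M. 0 < \<Psi> \<omega>" using expo by eventually_elim simp
  \<comment> \<open>\<open>has_cond_distribution\<close> wants the exceptional set null within the
    conditioning sigma-algebra itself; positivity of \<open>\<Psi>\<close> is an event
    there.\<close>
  have "AE \<omega> in restr_to_subalg M ?G. 0 < \<Psi> \<omega>"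
    by (rule AE_restr_to_subalg2[OF subG pos]) measurable
  then have AE_eq: "AE \<omega> in restr_to_subalg M ?G. measure_pmf (map_pmf enat (poisson_pmf (s * \<psi> \<omega>)))
      = measure_pmf (map_pmf enat (poisson_pmf (s * \<Psi> \<omega>)))" for s
    by eventually_elim (simp add: \<psi>_def)
  have "measure M {\<omega>\<in>space M. 0 < \<Psi> \<omega>} = 1"
    using pos \<Psi> by (subst prob_eq_1) auto
  moreover have "has_cond_distribution M ?G (count_space UNIV) (increment N t (t + s))
      (\<lambda>\<omega>. measure_pmf (map_pmf enat (poisson_pmf (s * \<Psi> \<omega>))))" if "0 \<le> t" "0 < s" for t s
    unfolding has_cond_distribution_def using cond_distribution_increment[OF that] AE_eq by blast
  ultimately show ?thesis
    unfolding MPP_def using \<Psi> cond_indep_increments by blast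
qed

lemma markov_ratio:
  fixes h :: "'a::topological_space \<Rightarrow> 'b::topological_space"
  assumes M: "prob_space M" and \<Theta>: "\<Theta> \<in> borel_measurable M" "\<Theta> ` space M \<subseteq> D"
    and h: "h \<in> borel_measurable (restrict_space borel D)"
    and K: "prob_family K" and eMRP: "eMRP M K h \<Theta> N" and N: "counting_process M N"
    and markov: "markov_property M N" and a: "0 < a" "a < t" and u: "t \<le> u"
  shows "AE \<omega> in M. iid_stream.\<phi> (K (h (\<Theta> \<omega>))) a t u * measure M {\<omega>\<in>space M. N t \<omega> = enat 1}
    = measure M {\<omega>\<in>space M. N a \<omega> = enat 0 \<and> N t \<omega> = enat 1} * iid_stream.\<phi> (K (h (\<Theta> \<omega>))) 0 t u"
proof -
  interpret prob_space M by fact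
  let ?F = "gen_sigma M \<Theta>" and ?\<kappa> = "\<lambda>\<omega>. K (h (\<Theta> \<omega>))" and ?\<sigma> = "interarrival_stream N 0"
  let ?\<alpha> = "measure M {\<omega>\<in>space M. N a \<omega> = enat 0 \<and> N t \<omega> = enat 1}"
    and ?\<beta> = "measure M {\<omega>\<in>space M. N t \<omega> = enat 1}"
  have iid: "iid_stream (?\<kappa> \<omega>)" for \<omega>
    using K by (auto simp: prob_family_def iid_stream_def iid_stream_axioms_def)
  have sub: "subalgebra M ?F" by (rule subalgebra_gen_sigma) fact
  note mix = eMRP_iid_stream[OF M \<Theta> h K eMRP]
  define f where "f c \<omega> = measure (stream_space (?\<kappa> \<omega>)) {w. first_two c t u w}" for c \<omega>
  have f01: "0 \<le> f c \<omega>" "f c \<omega> \<le> 1" for c \<omega>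
  proof -
    interpret I: iid_stream "?\<kappa> \<omega>" by (rule iid)
    show "0 \<le> f c \<omega>" "f c \<omega> \<le> 1" by (simp_all add: f_def)
  qed
  have [measurable]: "f c \<in> borel_measurable M" for c
    using mix[OF sets_first_two[of c t u]] measurable_from_subalg[OF sub]
    unfolding f_def[abs_def] measure_def by (metis borel_measurable_enn2real)
  have int: "integrable M (\<lambda>\<omega>. f b \<omega> * f c \<omega>)" for b c
    by (rule integrable_const_bound[of _ 1]) (use f01 in \<open>auto simp: abs_mult mult_le_one\<close>)
  have prob: "measure M {\<omega>\<in>space M. first_two b t u (?\<sigma> \<omega>) \<and> first_two c t u (sdrop 2 (?\<sigma> \<omega>))} = (\<integral>\<omega>. f b \<omega> * f c \<omega> \<partial>M)" for b c
  proof -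
    let ?E = "{w. first_two b t u w \<and> first_two c t u (sdrop 2 w)}"
    have E: "?E \<in> sets (stream_space borel)"
    proof -
      have "{w \<in> space (stream_space borel). first_two b t u w \<and> first_two c t u (sdrop 2 w)} \<in> sets (stream_space borel)"
        unfolding first_two_def by measurable
      then show ?thesis by (simp add: space_stream_space)
    qed
    have "space M \<in> sets ?F" using sub sets.top[of ?F] by (metis subalgebra_def)
    then have "emeasure M (space M \<inter> {\<omega>\<in>space M. ?\<sigma> \<omega> \<in> ?E})
        = (\<integral>\<^sup>+\<omega>. indicator (space M) \<omega> * emeasure (stream_space (?\<kappa> \<omega>)) ?E \<partial>M)"
      using mix[OF E] by blast
    also have "\<dots> = (\<integral>\<^sup>+\<omega>. ennreal (f b \<omega> * f c \<omega>) \<partial>M)"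
    proof (rule nn_integral_cong)
      fix \<omega> assume "\<omega> \<in> space M"
      interpret I: iid_stream "?\<kappa> \<omega>" by (rule iid)
      show "indicator (space M) \<omega> * emeasure (stream_space (?\<kappa> \<omega>)) ?E = ennreal (f b \<omega> * f c \<omega>)"
        using \<open>\<omega> \<in> space M\<close> I.emeasure_first_two_Int_sdrop[OF sets_first_two[of c t u], of b t u]
        by (simp add: f_def I.S.emeasure_eq_measure ennreal_mult)
    qed
    also have "\<dots> = ennreal (\<integral>\<omega>. f b \<omega> * f c \<omega> \<partial>M)"
      by (rule nn_integral_eq_integral[OF int]) (use f01 in auto)
    also have "space M \<inter> {\<omega>\<in>space M. ?\<sigma> \<omega> \<in> ?E}
        = {\<omega>\<in>space M. first_two b t u (?\<sigma> \<omega>) \<and> first_two c t u (sdrop 2 (?\<sigma> \<omega>))}" by auto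
    finally show ?thesis using f01 by (simp add: measure_def integral_nonneg_AE)
  qed
  \<comment> \<open>\<open>W\<^sub>3, W\<^sub>4\<close> are copies of \<open>W\<^sub>1, W\<^sub>2\<close>, so \<open>f a\<close> and \<open>f 0\<close> themselves may serve as test functions.\<close>
  have key: "(\<integral>\<omega>. f a \<omega> * f c \<omega> \<partial>M) * ?\<beta> = ?\<alpha> * (\<integral>\<omega>. f 0 \<omega> * f c \<omega> \<partial>M)" for c
    using markov_first_two[OF M N markov a u, of c] unfolding prob .
  let ?x = "\<lambda>\<omega>. f a \<omega> * ?\<beta> - ?\<alpha> * f 0 \<omega>"
  \<comment> \<open>The square is grouped so that the two brackets are the integrands of
    \<open>key\<close> for \<open>c = a\<close> and \<open>c = 0\<close>; each integrates to
    0.\<close>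
  have "?x \<omega> * ?x \<omega> = ?\<beta> * (f a \<omega> * f a \<omega> * ?\<beta> - ?\<alpha> * (f 0 \<omega> * f a \<omega>))
      - ?\<alpha> * (f a \<omega> * f 0 \<omega> * ?\<beta> - ?\<alpha> * (f 0 \<omega> * f 0 \<omega>))" for \<omega>
    by (simp add: algebra_simps)
  then have x2: "(\<lambda>\<omega>. ?x \<omega> * ?x \<omega>) = (\<lambda>\<omega>. ?\<beta> * (f a \<omega> * f a \<omega> * ?\<beta> - ?\<alpha> * (f 0 \<omega> * f a \<omega>))
      - ?\<alpha> * (f a \<omega> * f 0 \<omega> * ?\<beta> - ?\<alpha> * (f 0 \<omega> * f 0 \<omega>)))" by (rule ext)
  have ints: "integrable M (\<lambda>\<omega>. f a \<omega> * f c \<omega> * ?\<beta> - ?\<alpha> * (f 0 \<omega> * f c \<omega>))" for c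
    by (intro Bochner_Integration.integrable_diff integrable_mult_left integrable_mult_right int)
  have zero: "(\<integral>\<omega>. f a \<omega> * f c \<omega> * ?\<beta> - ?\<alpha> * (f 0 \<omega> * f c \<omega>) \<partial>M) = 0" for c
    using key[of c] int by (subst Bochner_Integration.integral_diff) auto
  have "integrable M (\<lambda>\<omega>. ?x \<omega> * ?x \<omega>)"
    unfolding x2 by (intro Bochner_Integration.integrable_diff integrable_mult_right ints)
  moreover have "(\<integral>\<omega>. ?x \<omega> * ?x \<omega> \<partial>M) = 0"
    unfolding x2 using ints zero by (subst Bochner_Integration.integral_diff) auto
  ultimately have "AE \<omega> in M. ?x \<omega> * ?x \<omega> = 0"
    by (subst (asm) integral_nonneg_eq_0_iff_AE) auto
  then show ?thesis
  proof eventually_elim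
    case (elim \<omega>)
    then show ?case by (simp add: iid_stream.\<phi>_def[OF iid] f_def)
  qed
qed

text \<open>Makes division by P(N_t = 1) possible: given \<open>\<Theta>\<close>, the probability of
  one arrival up to \<open>t\<close> is \<open>\<phi> 0 t t\<close>, and the integral of an almost
  surely positive function is positive.\<close>

lemma prob_one_event:
  fixes h :: "'a::topological_space \<Rightarrow> 'b::topological_space"
  assumes M: "prob_space M" and \<Theta>: "\<Theta> \<in> borel_measurable M" "\<Theta> ` space M \<subseteq> D"
    and h: "h \<in> borel_measurable (restrict_space borel D)"
    and K: "prob_family K" and eMRP: "eMRP M K h \<Theta> N" and N: "counting_process M N" and t: "0 < t"
    and pos: "AE \<omega> in M. 0 < iid_stream.\<phi> (K (h (\<Theta> \<omega>))) 0 t t"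
  shows "0 < measure M {\<omega>\<in>space M. N t \<omega> = enat 1}"
proof -
  interpret prob_space M by fact
  let ?F = "gen_sigma M \<Theta>" and ?\<kappa> = "\<lambda>\<omega>. K (h (\<Theta> \<omega>))" and ?\<sigma> = "interarrival_stream N 0"
  let ?E = "{w. first_two 0 t t w}"
  have iid: "iid_stream (?\<kappa> \<omega>)" for \<omega>
    using K by (auto simp: prob_family_def iid_stream_def iid_stream_axioms_def)
  have sub: "subalgebra M ?F" by (rule subalgebra_gen_sigma) fact
  note mix = eMRP_iid_stream[OF M \<Theta> h K eMRP sets_first_two[of 0 t t]]
  have "space M \<in> sets ?F" using sub sets.top[of ?F] by (metis subalgebra_def)
  then have "emeasure M (space M \<inter> {\<omega>\<in>space M. ?\<sigma> \<omega> \<in> ?E})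
      = (\<integral>\<^sup>+\<omega>. indicator (space M) \<omega> * emeasure (stream_space (?\<kappa> \<omega>)) ?E \<partial>M)"
    using mix by blast
  also have "\<dots> = (\<integral>\<^sup>+\<omega>. emeasure (stream_space (?\<kappa> \<omega>)) ?E \<partial>M)"
    by (rule nn_integral_cong) simp
  also have "space M \<inter> {\<omega>\<in>space M. ?\<sigma> \<omega> \<in> ?E} = {\<omega>\<in>space M. N t \<omega> = enat 1}"
  proof -
    have "first_two 0 t t (?\<sigma> \<omega>) \<longleftrightarrow> N t \<omega> = enat 1" if "\<omega> \<in> space M" for \<omega>
      using first_two_interarrival_iff[OF N that, of 0 t t] counting_process_eq_iff[OF N that, of t 1]
        counting_process_path(1)[OF N that] t by (auto simp: zero_enat_def numeral_2_eq_2)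
    then show ?thesis by auto
  qed
  finally have eq: "emeasure M {\<omega>\<in>space M. N t \<omega> = enat 1} = (\<integral>\<^sup>+\<omega>. emeasure (stream_space (?\<kappa> \<omega>)) ?E \<partial>M)" .
  have meas: "(\<lambda>\<omega>. emeasure (stream_space (?\<kappa> \<omega>)) ?E) \<in> borel_measurable M"
    using mix measurable_from_subalg[OF sub] by blast
  show ?thesis
  proof (rule ccontr)
    assume "\<not> ?thesis"
    then have "measure M {\<omega>\<in>space M. N t \<omega> = enat 1} = 0" by (simp add: zero_less_measure_iff)
    then have "(\<integral>\<^sup>+\<omega>. emeasure (stream_space (?\<kappa> \<omega>)) ?E \<partial>M) = 0"
      using eq by (simp add: emeasure_eq_measure)
    then have "AE \<omega> in M. emeasure (stream_space (?\<kappa> \<omega>)) ?E = 0"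
      using meas by (simp add: nn_integral_0_iff_AE)
    with pos have "AE \<omega> in M. False"
    proof eventually_elim
      case (elim \<omega>)
      then show ?case by (simp add: iid_stream.\<phi>_def[OF iid] measure_def)
    qed
    then show False by simp
  qed
qed

theorem theorem2p11:
  fixes M :: "'w measure"
    and \<Theta> :: "'w \<Rightarrow> real ^ 'd"
    and D L\<^sub>0 L\<^sub>h :: "(real ^ 'd) set"
    and Q :: "real ^ 'd \<Rightarrow> 'w measure"
    and h :: "real ^ 'd \<Rightarrow> real ^ 'k"
    and N :: "real \<Rightarrow> 'w \<Rightarrow> enat"
    and K :: "real ^ 'k \<Rightarrow> real measure"
    and F :: "real ^ 'k \<Rightarrow> real \<Rightarrow> real"
    and C :: "real ^ 'k \<Rightarrow> real"
    and p :: "real ^ 'd \<Rightarrow> real"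
    and \<Theta>' :: "'w \<Rightarrow> real"
  assumes "prob_space M"
    and "\<Theta> \<in> borel_measurable M"
    and "D \<in> sets borel" and "\<Theta> ` space M \<subseteq> D"
    and "disintegration M D \<Theta> Q" and "consistent_with M D \<Theta> Q"
    and "h \<in> borel_measurable (restrict_space borel D)"
    and "L\<^sub>0 \<in> null_sets (law_on M D \<Theta>)" and "inj_on h (D - L\<^sub>0)"
    and "counting_process M N"
    and "prob_family K"
    and "eMRP M K h \<Theta> N"
    and "\<And>n \<theta>. n \<ge> 1 \<Longrightarrow> \<theta> \<in> D \<Longrightarrow> distr (Q \<theta>) borel (interarrival N n) = K (h \<theta>)"
    and "\<And>n \<theta> t. n \<ge> 1 \<Longrightarrow> \<theta> \<in> D \<Longrightarrow> 0 \<le> t \<Longrightarrow>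
           F (h \<theta>) t = measure (Q \<theta>) {\<omega>\<in>space M. interarrival N n \<omega> \<le> t}"
    and "L\<^sub>h \<in> null_sets (law_on M D \<Theta>)"
    and "integrable (distr M borel (\<lambda>\<omega>. h (\<Theta> \<omega>))) C"
    and "\<And>\<theta>. \<theta> \<in> D - L\<^sub>h \<Longrightarrow> F (h \<theta>) C1_differentiable_on {0<..}"
    and "\<And>\<theta> t. \<theta> \<in> D - L\<^sub>h \<Longrightarrow> 0 < t \<Longrightarrow>
           0 < deriv (F (h \<theta>)) t \<and> deriv (F (h \<theta>)) t < C (h \<theta>)"
    and "\<And>\<theta>. \<theta> \<in> D - L\<^sub>h \<Longrightarrow> (deriv (F (h \<theta>)) \<longlongrightarrow> p \<theta>) (at_right 0)"
    and "\<And>\<theta>. \<theta> \<in> D - L\<^sub>h \<Longrightarrow> 0 < p \<theta>"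
    and "inj_on p (D - L\<^sub>h)"
    and "\<Theta>' \<in> borel_measurable M"
    and "\<And>\<omega>. \<omega> \<in> space M \<Longrightarrow> \<Theta> \<omega> \<in> D - (L\<^sub>0 \<union> L\<^sub>h) \<Longrightarrow> \<Theta>' \<omega> = p (\<Theta> \<omega>)"
  shows "(multinomial_property M N \<longleftrightarrow> markov_property M N) \<and>
         (markov_property M N \<longleftrightarrow> MPP M N \<Theta>')"
proof -
  note M = assms(1) and \<Theta> = assms(2) and h = assms(7) and N = assms(10) and K = assms(11) and eMRP = assms(12)
  interpret prob_space M by (rule M)
  have \<Theta>D: "\<Theta> ` space M \<subseteq> D" by (rule assms(4))
  let ?\<kappa> = "\<lambda>\<omega>. K (h (\<Theta> \<omega>))"
  have iid: "iid_stream (K y)" for y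
    using K by (auto simp: prob_family_def iid_stream_def iid_stream_axioms_def)
  have W [measurable]: "interarrival N 1 \<in> borel_measurable M"
    using eMRP by (auto simp: eMRP_def cond_indep_vars_def)
  \<comment> \<open>The law of W_1 under \<open>Q \<theta>\<close> is the kernel, so the smoothness
    assumed of \<open>F\<close> becomes a property of \<open>K (h \<theta>)\<close>.\<close>
  have F: "F (h \<theta>) x = measure (K (h \<theta>)) {..x}" if "\<theta> \<in> D" "0 \<le> x" for \<theta> x
  proof -
    have Q: "sets (Q \<theta>) = sets M" using assms(5) that(1) by (auto simp: disintegration_def)
    then have "interarrival N 1 \<in> borel_measurable (Q \<theta>)" using W by (subst measurable_cong_sets[OF Q refl])
    then have "measure (distr (Q \<theta>) borel (interarrival N 1)) {..x} = measure (Q \<theta>) (interarrival N 1 -` {..x} \<inter> space (Q \<theta>))"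
      by (intro measure_distr) auto
    also have "interarrival N 1 -` {..x} \<inter> space (Q \<theta>) = {\<omega>\<in>space M. interarrival N 1 \<omega> \<le> x}"
      using sets_eq_imp_space_eq[OF Q] by auto
    also have "distr (Q \<theta>) borel (interarrival N 1) = K (h \<theta>)" using assms(13) that(1) by simp
    finally show ?thesis using assms(14)[of 1 \<theta> x] that by simp
  qed
  \<comment> \<open>Arrival times increase strictly on every path, so the event of a first gap at
    most 0 is empty, not merely null for \<open>M\<close>; hence it has measure 0 under each
    \<open>Q \<theta>\<close>.\<close>
  have F0: "F (h \<theta>) 0 = 0" if "\<theta> \<in> D" for \<theta>
  proof -
    have "\<not> interarrival N 1 \<omega> \<le> 0" if "\<omega> \<in> space M" for \<omega>
      using arrival_less_Suc[OF N that, of 0] by (simp add: interarrival_def)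
    then have empty: "{\<omega>\<in>space M. interarrival N 1 \<omega> \<le> 0} = {}" by blast
    show ?thesis using assms(14)[of 1 \<theta> 0, unfolded empty] that by simp
  qed
  have tail: "iid_stream.tail (K (h \<theta>)) x = 1 - F (h \<theta>) x" if "\<theta> \<in> D" "0 \<le> x" for \<theta> x
    using iid_stream.tail_eq[OF iid] F[OF that] by simp
  have regular: "AE \<omega> in M. \<Theta> \<omega> \<in> D - (L\<^sub>0 \<union> L\<^sub>h)"
  proof -
    have \<Theta>': "\<Theta> \<in> M \<rightarrow>\<^sub>M restrict_space borel D"
      by (rule measurable_restrict_space2[OF _ \<Theta>]) (use \<Theta>D in auto)
    have "L\<^sub>0 \<union> L\<^sub>h \<in> null_sets (law_on M D \<Theta>)" using assms(8,15) by (rule null_sets.Un)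
    then have "AE \<theta> in law_on M D \<Theta>. \<theta> \<notin> L\<^sub>0 \<union> L\<^sub>h" by (rule AE_not_in)
    then have "AE \<omega> in M. \<Theta> \<omega> \<notin> L\<^sub>0 \<union> L\<^sub>h" unfolding law_on_def by (rule AE_distrD[OF \<Theta>'])
    then show ?thesis using AE_space
    proof eventually_elim
      case (elim \<omega>)
      then show ?case using \<Theta>D by blast
    qed
  qed
  have \<phi>_pos: "AE \<omega> in M. 0 < iid_stream.\<phi> (?\<kappa> \<omega>) 0 t t" if t: "0 < t" for t
    using regular
  proof eventually_elim
    case (elim \<omega>)
    interpret I: iid_stream "?\<kappa> \<omega>" by (rule iid)
    have \<theta>: "\<Theta> \<omega> \<in> D" "\<Theta> \<omega> \<in> D - L\<^sub>h" using elim by auto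
    have strict: "I.tail y < I.tail x" if "0 < x" "x < y" for x y
      by (rule I.tail_strict[OF tail[OF \<theta>(1)] F0[OF \<theta>(1)] assms(17)[OF \<theta>(2)]])
        (use assms(18)[OF \<theta>(2)] that in auto)
    show ?case by (rule I.\<phi>_pos[OF strict t])
  qed
  have markov_imp_MPP: "MPP M N \<Theta>'" if markov: "markov_property M N"
  proof -
    let ?b = "\<lambda>t. measure M {\<omega>\<in>space M. N t \<omega> = enat 1}"
    let ?c = "\<lambda>a t. measure M {\<omega>\<in>space M. N a \<omega> = enat 0 \<and> N t \<omega> = enat 1}"
    \<comment> \<open>Countably many parameter triples keep the union of the exceptional sets
      null.\<close>
    have "AE \<omega> in M. \<forall>a\<in>\<rat>. \<forall>t\<in>\<rat>. \<forall>u\<in>\<rat>. 0 < a \<longrightarrow> a < t \<longrightarrow> t \<le> u \<longrightarrow>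
        iid_stream.\<phi> (?\<kappa> \<omega>) a t u * ?b t = ?c a t * iid_stream.\<phi> (?\<kappa> \<omega>) 0 t u"
      using markov_ratio[OF M \<Theta> \<Theta>D h K eMRP N markov]
      by (simp add: AE_ball_countable countable_rat AE_impI)
    then have "AE \<omega> in M. 0 < \<Theta>' \<omega> \<and> ?\<kappa> \<omega> = expo (\<Theta>' \<omega>)"
      using regular AE_space
    proof eventually_elim
      case (elim \<omega>)
      interpret I: iid_stream "?\<kappa> \<omega>" by (rule iid)
      have \<theta>: "\<Theta> \<omega> \<in> D" "\<Theta> \<omega> \<in> D - L\<^sub>h" using elim by auto
      have \<Theta>': "\<Theta>' \<omega> = p (\<Theta> \<omega>)" using assms(23) elim by blast
      have "?\<kappa> \<omega> = expo (p (\<Theta> \<omega>))"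
      proof (rule I.eq_expo_of_deriv[OF tail[OF \<theta>(1)] F0[OF \<theta>(1)] assms(17)[OF \<theta>(2)] _ assms(19)[OF \<theta>(2)]])
        show "0 < deriv (F (h (\<Theta> \<omega>))) x" if "0 < x" for x using assms(18)[OF \<theta>(2) that] by simp
        fix a t u :: real
        assume atu: "a \<in> \<rat>" "t \<in> \<rat>" "u \<in> \<rat>" "0 < a" "a < t" "t \<le> u"
        have b: "0 < ?b t"
          using prob_one_event[OF M \<Theta> \<Theta>D h K eMRP N _ \<phi>_pos] atu by simp
        have 1: "I.\<phi> a t u * ?b t = ?c a t * I.\<phi> 0 t u" using elim(1) atu by blast
        have 2: "I.\<phi> a t t * ?b t = ?c a t * I.\<phi> 0 t t" using elim(1) atu by blast
        \<comment> \<open>Comparing the instances for \<open>u\<close> and for \<open>t\<close>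
          eliminates the mixture constant \<open>?c a t\<close>; the positive \<open>?b t\<close>
          cancels.\<close>
        have "(I.\<phi> a t u * I.\<phi> 0 t t) * ?b t = (I.\<phi> a t u * ?b t) * I.\<phi> 0 t t" by (simp only: ac_simps)
        also have "\<dots> = (I.\<phi> a t t * ?b t) * I.\<phi> 0 t u" unfolding 1 2 by (simp only: ac_simps)
        finally show "I.\<phi> a t u * I.\<phi> 0 t t = I.\<phi> a t t * I.\<phi> 0 t u" using b by simp
      qed
      then show ?case using assms(20)[OF \<theta>(2)] \<Theta>' by simp
    qed
    then show ?thesis by (rule MPP_of_exponential[OF M \<Theta> \<Theta>D h K eMRP N assms(22)])
  qed
  show ?thesis
    using markov_imp_MPP MPP_imp_multinomial[OF M N] multinomial_imp_markov[OF M N] by blast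
qed

end
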